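(* Let $n\ge 2$, $1\le m\le n$, and $h'=((n-1)^{n-m},n^m)$, i.e. $h'(i)=n-1$ for $i\le n-m$ and $h'(i)=n$ for $i>n-m$. Let $S$ be a regular semisimple matrix and identify $H^*(\mathrm{Hess}(S,h');\mathbb{C})$ with $\mathcal{G}/(t_1,\ldots,t_n)$, where $\mathcal{G}$ is the ring of tuples $\alpha=(\alpha(w))_{w\in\mathfrak{S}_n}$ of polynomials in $\mathbb{C}[t_1,\ldots,t_n]$ such that $t_{w(i)}-t_{w(j)}$ divides $\alpha(w)-\alpha(w\circ(i\,j))$ whenever $i<j\le h'(i)$, and $t_i$ denotes the constant tuple $(t_i)_{w}$. Let $x_k,y_k\in H^*(\mathrm{Hess}(S,h');\mathbb{C})$ be the images of the tuples with $x_k(w)=t_{w(k)}$ and $y_k(w)=\prod_{\ell=n-m+1}^{n-1}(t_k-t_{w(\ell)})$ if $w(n)=k$, $y_k(w)=0$ otherwise. Then the following elements form a $\mathbb{C}$-basis of $H^*(\mathrm{Hess}(S,h');\mathbb{C})$: (i) $x_1^{i_1}x_2^{i_2}\cdots x_n^{i_n}$ with $0\le i_j\le j-1$ for all $j$, not divisible by $\prod_{\ell=n-m+1}^n x_\ell$; (ii) $x_{n-1}^{\ell_1}x_{n-2}^{\ell_2}\cdots x_1^{\ell_{n-1}}(y_{k+1}-y_1)$ with $0\le\ell_j\le j-1$ for all $j$ and $1\le k\le n-1$, such that $x_{n-1}^{\ell_1}\cdots x_1^{\ell_{n-1}}$ is not divisible by $\prod_{\ell=1}^{n-m}x_\ell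$.
   Context: $\mathrm{Hess}(S,h')=\{V_\bullet\in\mathrm{Fl}(\mathbb{C}^n): SV_i\subseteq V_{h'(i)}\}$; for regular semisimple $S$ its torus-equivariant cohomology is the GKM ring $\mathcal{G}$ above and the ordinary cohomology is its quotient by the ideal generated by $t_1,\ldots,t_n$. $w\circ(i\,j)$ is $w$ composed with the transposition of $i$ and $j$. Empty products equal $1$ (so when $m=1$, $y_k(w)=1$ if $w(n)=k$; when $m=n$ the set (ii) is empty). *)

theory Defs
  imports
    "HOL-Library.Poly_Mapping"
    "HOL-Library.FuncSet"
    "HOL-Combinatorics.Permutations"
    "HOL-Algebra.QuotRing"
    "Jordan_Normal_Form.VS_Connect"
begin

text \<open>Polynomials over the complex numbers in the variables \<open>t\<^sub>1, t\<^sub>2, \<dots>\<close>, as finitely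
  supported maps from exponent vectors to coefficients; the ring of polynomials in
  \<open>t\<^sub>1, \<dots>, t\<^sub>n\<close> is the carrier set \<open>polys n\<close>.\<close>

type_synonym cpoly = "(nat \<Rightarrow>\<^sub>0 nat) \<Rightarrow>\<^sub>0 complex"

definition tvar :: "nat \<Rightarrow> cpoly" where
  "tvar i = Poly_Mapping.single (Poly_Mapping.single i 1) 1"

definition tconst :: "complex \<Rightarrow> cpoly" where
  "tconst c = Poly_Mapping.single 0 c"

definition polys :: "nat \<Rightarrow> cpoly set" where
  "polys n = {p. \<forall>\<mu>\<in>Poly_Mapping.keys p. Poly_Mapping.keys \<mu> \<subseteq> {1..n}}"

definition poly_divides :: "nat \<Rightarrow> cpoly \<Rightarrow> cpoly \<Rightarrow> bool" where
  "poly_divides n p q \<longleftrightarrow> (\<exists>r\<in>polys n. q = p * r)"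

definition sym_group :: "nat \<Rightarrow> (nat \<Rightarrow> nat) set" where
  "sym_group n = {w. w permutes {1..n}}"

type_synonym tuple = "(nat \<Rightarrow> nat) \<Rightarrow> cpoly"

definition gkm_carrier :: "nat \<Rightarrow> (nat \<Rightarrow> nat) \<Rightarrow> tuple set" where
  "gkm_carrier n h = {\<alpha> \<in> sym_group n \<rightarrow>\<^sub>E polys n.
     \<forall>w\<in>sym_group n. \<forall>i\<in>{1..n}. \<forall>j. i < j \<and> j \<le> h i \<longrightarrow>
       poly_divides n (tvar (w i) - tvar (w j)) (\<alpha> w - \<alpha> (w \<circ> transpose i j))}"

text \<open>The ring \<open>\<G>\<close> with componentwise operations, as an algebra over the complex numbers.\<close>

definition gkm_ring :: "nat \<Rightarrow> (nat \<Rightarrow> nat) \<Rightarrow> (complex, tuple) module" where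
  "gkm_ring n h = \<lparr>
     carrier = gkm_carrier n h,
     mult = (\<lambda>\<alpha> \<beta>. \<lambda>w\<in>sym_group n. \<alpha> w * \<beta> w),
     one = (\<lambda>w\<in>sym_group n. 1),
     zero = (\<lambda>w\<in>sym_group n. 0),
     add = (\<lambda>\<alpha> \<beta>. \<lambda>w\<in>sym_group n. \<alpha> w + \<beta> w),
     smult = (\<lambda>c \<alpha>. \<lambda>w\<in>sym_group n. tconst c * \<alpha> w)\<rparr>"

definition t_ideal :: "nat \<Rightarrow> (nat \<Rightarrow> nat) \<Rightarrow> tuple set" where
  "t_ideal n h = genideal (gkm_ring n h) ((\<lambda>i. \<lambda>w\<in>sym_group n. tvar i) ` {1..n})"

text \<open>For a regular semisimple \<open>S\<close>, the cohomology \<open>H\<^sup>*(Hess(S,h); \<complex>)\<close>, identified with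
  \<open>\<G>/(t\<^sub>1, \<dots>, t\<^sub>n)\<close>. The ring structure is that of the quotient ring; the scalar multiplication
  is induced on cosets in the same way as the product.\<close>

definition hess_cohomology :: "nat \<Rightarrow> (nat \<Rightarrow> nat) \<Rightarrow> (complex, tuple set) module" where
  "hess_cohomology n h = (let G = gkm_ring n h; I = t_ideal n h; Q = G Quot I in \<lparr>
     carrier = carrier Q,
     mult = mult Q,
     one = one Q,
     zero = zero Q,
     add = add Q,
     smult = (\<lambda>c A. \<Union>\<alpha>\<in>A. I +>\<^bsub>G\<^esub> (c \<odot>\<^bsub>G\<^esub> \<alpha>))\<rparr>)"

definition hess_class :: "nat \<Rightarrow> (nat \<Rightarrow> nat) \<Rightarrow> tuple \<Rightarrow> tuple set" where
  "hess_class n h \<alpha> = t_ideal n h +>\<^bsub>gkm_ring n h\<^esub> \<alpha>"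

definition hfun :: "nat \<Rightarrow> nat \<Rightarrow> nat \<Rightarrow> nat" where
  "hfun n m i = (if i \<le> n - m then n - 1 else n)"

definition x_tuple :: "nat \<Rightarrow> nat \<Rightarrow> tuple" where
  "x_tuple n k = (\<lambda>w\<in>sym_group n. tvar (w k))"

definition y_tuple :: "nat \<Rightarrow> nat \<Rightarrow> nat \<Rightarrow> tuple" where
  "y_tuple n m k = (\<lambda>w\<in>sym_group n.
     if w n = k then (\<Prod>l = n - m + 1..n - 1. tvar k - tvar (w l)) else 0)"

definition x_class :: "nat \<Rightarrow> nat \<Rightarrow> nat \<Rightarrow> tuple set" where
  "x_class n m k = hess_class n (hfun n m) (x_tuple n k)"

definition y_class :: "nat \<Rightarrow> nat \<Rightarrow> nat \<Rightarrow> tuple set" where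
  "y_class n m k = hess_class n (hfun n m) (y_tuple n m k)"

text \<open>Divisibility of the monomials in the two index sets is divisibility of formal monomials in
  the polynomial ring in \<open>n\<close> variables, here written \<open>tvar 1, \<dots>, tvar n\<close>.\<close>

definition exps_i :: "nat \<Rightarrow> nat \<Rightarrow> (nat \<Rightarrow> nat) set" where
  "exps_i n m = {e \<in> (\<Pi>\<^sub>E j\<in>{1..n}. {0..j - 1}).
     \<not> poly_divides n (\<Prod>l = n - m + 1..n. tvar l) (\<Prod>j = 1..n. tvar j ^ e j)}"

definition elem_i :: "nat \<Rightarrow> nat \<Rightarrow> (nat \<Rightarrow> nat) \<Rightarrow> tuple set" where
  "elem_i n m e = (let H = hess_cohomology n (hfun n m) in
     \<Otimes>\<^bsub>H\<^esub>j\<in>{1..n}. x_class n m j [^]\<^bsub>H\<^esub> e j)"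

definition exps_ii :: "nat \<Rightarrow> nat \<Rightarrow> (nat \<Rightarrow> nat) set" where
  "exps_ii n m = {e \<in> (\<Pi>\<^sub>E j\<in>{1..n - 1}. {0..j - 1}).
     \<not> poly_divides n (\<Prod>l = 1..n - m. tvar l) (\<Prod>j = 1..n - 1. tvar (n - j) ^ e j)}"

definition elem_ii :: "nat \<Rightarrow> nat \<Rightarrow> (nat \<Rightarrow> nat) \<times> nat \<Rightarrow> tuple set" where
  "elem_ii n m = (\<lambda>(e, k). let H = hess_cohomology n (hfun n m) in
     (\<Otimes>\<^bsub>H\<^esub>j\<in>{1..n - 1}. x_class n m (n - j) [^]\<^bsub>H\<^esub> e j)
       \<otimes>\<^bsub>H\<^esub> (y_class n m (k + 1) \<ominus>\<^bsub>H\<^esub> y_class n m 1))"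

lemma polys_closed:
  "0 \<in> polys n" "1 \<in> polys n" "tconst c \<in> polys n"
  "p \<in> polys n \<Longrightarrow> q \<in> polys n \<Longrightarrow> p + q \<in> polys n"
  "p \<in> polys n \<Longrightarrow> - p \<in> polys n"
  "p \<in> polys n \<Longrightarrow> q \<in> polys n \<Longrightarrow> p - q \<in> polys n"
  "p \<in> polys n \<Longrightarrow> q \<in> polys n \<Longrightarrow> p * q \<in> polys n"
proof -
  show add: "p + q \<in> polys n" if "p \<in> polys n" "q \<in> polys n" for p q
    using that Poly_Mapping.keys_add[of p q] by (auto simp: polys_def)
  show neg: "- p \<in> polys n" if "p \<in> polys n" for p
    using that by (auto simp: polys_def)
  show "p - q \<in> polys n" if "p \<in> polys n" "q \<in> polys n" for p q
    using add[OF that(1) neg[OF that(2)]] by simp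
  show "p * q \<in> polys n" if "p \<in> polys n" "q \<in> polys n" for p q
    unfolding polys_def
  proof safe
    fix \<mu> i assume \<mu>: "\<mu> \<in> Poly_Mapping.keys (p * q)" and i: "i \<in> Poly_Mapping.keys \<mu>"
    from \<mu> obtain a b where ab: "\<mu> = a + b" "a \<in> Poly_Mapping.keys p" "b \<in> Poly_Mapping.keys q"
      using keys_mult[of p q] by auto
    with i Poly_Mapping.keys_add[of a b] have "i \<in> Poly_Mapping.keys a \<union> Poly_Mapping.keys b" by auto
    with ab that show "i \<in> {1..n}" unfolding polys_def by blast
  qed
  show "0 \<in> polys n" "tconst c \<in> polys n" by (auto simp: polys_def tconst_def)
  have "1 = tconst 1" by (simp add: tconst_def)
  thus "1 \<in> polys n" by (auto simp: polys_def tconst_def)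
qed

lemma tvar_in_polys: "i \<in> {1..n} \<Longrightarrow> tvar i \<in> polys n"
  by (auto simp: polys_def tvar_def)

lemma poly_divides_closed:
  "poly_divides n d 0"
  "poly_divides n d p \<Longrightarrow> poly_divides n d q \<Longrightarrow> poly_divides n d (p + q)"
  "poly_divides n d p \<Longrightarrow> r \<in> polys n \<Longrightarrow> poly_divides n d (r * p)"
  "poly_divides n d p \<Longrightarrow> poly_divides n d (- p)"
proof -
  show "poly_divides n d 0"
    unfolding poly_divides_def by (rule bexI[of _ 0]) (auto simp: polys_closed)
  show "poly_divides n d (p + q)" if "poly_divides n d p" "poly_divides n d q" for p q
    using that unfolding poly_divides_def by (metis distrib_left polys_closed(4))
  show "poly_divides n d (r * p)" if "poly_divides n d p" "r \<in> polys n" for r p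
    using that unfolding poly_divides_def by (metis mult.left_commute polys_closed(7))
  show "poly_divides n d (- p)" if "poly_divides n d p" for p
    using that unfolding poly_divides_def by (metis mult_minus_right polys_closed(5))
qed

lemma sym_group_comp_transpose:
  "w \<in> sym_group n \<Longrightarrow> i \<in> {1..n} \<Longrightarrow> j \<in> {1..n} \<Longrightarrow> w \<circ> transpose i j \<in> sym_group n"
  unfolding sym_group_def
  using permutes_compose[OF permutes_swap_id, of i "{1..n}" j w] by simp

lemma gkm_carrierI:
  assumes "\<And>i. i \<in> {1..n} \<Longrightarrow> h i \<le> n"
    and "\<And>w. w \<in> sym_group n \<Longrightarrow> f w \<in> polys n"
    and "\<And>w i j. w \<in> sym_group n \<Longrightarrow> i \<in> {1..n} \<Longrightarrow> j \<in> {1..n} \<Longrightarrow> i < j \<Longrightarrow> j \<le> h i \<Longrightarrow>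
           poly_divides n (tvar (w i) - tvar (w j)) (f w - f (w \<circ> transpose i j))"
  shows "(\<lambda>w\<in>sym_group n. f w) \<in> gkm_carrier n h"
  unfolding gkm_carrier_def
proof (intro CollectI conjI ballI allI impI)
  show "(\<lambda>w\<in>sym_group n. f w) \<in> sym_group n \<rightarrow>\<^sub>E polys n" using assms(2) by auto
  fix w i j assume w: "w \<in> sym_group n" and i: "i \<in> {1..n}" and ij: "i < j \<and> j \<le> h i"
  have j: "j \<in> {1..n}" using assms(1)[OF i] i ij by auto
  show "poly_divides n (tvar (w i) - tvar (w j))
    ((\<lambda>w\<in>sym_group n. f w) w - (\<lambda>w\<in>sym_group n. f w) (w \<circ> transpose i j))"
    using assms(3)[OF w i j] ij sym_group_comp_transpose[OF w i j] w by simp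
qed

lemma gkm_carrierD:
  assumes "\<alpha> \<in> gkm_carrier n h"
  shows "w \<in> sym_group n \<Longrightarrow> \<alpha> w \<in> polys n"
    and "w \<notin> sym_group n \<Longrightarrow> \<alpha> w = undefined"
    and "w \<in> sym_group n \<Longrightarrow> i \<in> {1..n} \<Longrightarrow> i < j \<Longrightarrow> j \<le> h i \<Longrightarrow>
           poly_divides n (tvar (w i) - tvar (w j)) (\<alpha> w - \<alpha> (w \<circ> transpose i j))"
proof -
  have \<alpha>: "\<alpha> \<in> sym_group n \<rightarrow>\<^sub>E polys n"
    and div: "\<forall>w\<in>sym_group n. \<forall>i\<in>{1..n}. \<forall>j. i < j \<and> j \<le> h i \<longrightarrow>
      poly_divides n (tvar (w i) - tvar (w j)) (\<alpha> w - \<alpha> (w \<circ> transpose i j))"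
    using assms unfolding gkm_carrier_def by blast+
  show "\<alpha> w \<in> polys n" if "w \<in> sym_group n" by (rule PiE_mem[OF \<alpha> that])
  show "\<alpha> w = undefined" if "w \<notin> sym_group n" by (rule PiE_arb[OF \<alpha> that])
  show "poly_divides n (tvar (w i) - tvar (w j)) (\<alpha> w - \<alpha> (w \<circ> transpose i j))"
    if "w \<in> sym_group n" "i \<in> {1..n}" "i < j" "j \<le> h i"
    using div that by blast
qed

context
  fixes n :: nat and h :: "nat \<Rightarrow> nat"
  assumes h_le: "\<And>i. i \<in> {1..n} \<Longrightarrow> h i \<le> n"
begin

lemma gkm_closed:
  shows gkm_const: "p \<in> polys n \<Longrightarrow> (\<lambda>w\<in>sym_group n. p) \<in> gkm_carrier n h"
    and gkm_add: "\<alpha> \<in> gkm_carrier n h \<Longrightarrow> \<beta> \<in> gkm_carrier n h \<Longrightarrow>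
       (\<lambda>w\<in>sym_group n. \<alpha> w + \<beta> w) \<in> gkm_carrier n h"
    and gkm_mult: "\<alpha> \<in> gkm_carrier n h \<Longrightarrow> \<beta> \<in> gkm_carrier n h \<Longrightarrow>
       (\<lambda>w\<in>sym_group n. \<alpha> w * \<beta> w) \<in> gkm_carrier n h"
    and gkm_smult: "\<alpha> \<in> gkm_carrier n h \<Longrightarrow>
       (\<lambda>w\<in>sym_group n. tconst c * \<alpha> w) \<in> gkm_carrier n h"
    and gkm_uminus: "\<alpha> \<in> gkm_carrier n h \<Longrightarrow>
       (\<lambda>w\<in>sym_group n. - \<alpha> w) \<in> gkm_carrier n h"
proof -
  show "(\<lambda>w\<in>sym_group n. p) \<in> gkm_carrier n h" if "p \<in> polys n"
    by (rule gkm_carrierI) (use h_le that in \<open>auto simp: poly_divides_closed\<close>)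
  show "(\<lambda>w\<in>sym_group n. \<alpha> w + \<beta> w) \<in> gkm_carrier n h"
    if \<alpha>: "\<alpha> \<in> gkm_carrier n h" and \<beta>: "\<beta> \<in> gkm_carrier n h" for \<alpha> \<beta>
  proof (rule gkm_carrierI)
    fix w i j assume a: "w \<in> sym_group n" "i \<in> {1..n}" "i < j" "j \<le> h i"
    show "poly_divides n (tvar (w i) - tvar (w j))
        (\<alpha> w + \<beta> w - (\<alpha> (w \<circ> transpose i j) + \<beta> (w \<circ> transpose i j)))"
      using poly_divides_closed(2)[OF gkm_carrierD(3)[OF \<alpha> a] gkm_carrierD(3)[OF \<beta> a]]
      by (simp add: algebra_simps)
  qed (simp_all add: h_le[simplified] polys_closed gkm_carrierD(1)[OF \<alpha>] gkm_carrierD(1)[OF \<beta>])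
  show mult: "(\<lambda>w\<in>sym_group n. \<alpha> w * \<beta> w) \<in> gkm_carrier n h"
    if \<alpha>: "\<alpha> \<in> gkm_carrier n h" and \<beta>: "\<beta> \<in> gkm_carrier n h" for \<alpha> \<beta>
  proof (rule gkm_carrierI)
    fix w i j assume a: "w \<in> sym_group n" "i \<in> {1..n}" "i < j" "j \<le> h i" and j: "j \<in> {1..n}"
    have p: "\<beta> w \<in> polys n" "\<alpha> (w \<circ> transpose i j) \<in> polys n"
      using gkm_carrierD(1)[OF \<beta> a(1)] gkm_carrierD(1)[OF \<alpha> sym_group_comp_transpose[OF a(1,2) j]]
      by auto
    show "poly_divides n (tvar (w i) - tvar (w j))
        (\<alpha> w * \<beta> w - \<alpha> (w \<circ> transpose i j) * \<beta> (w \<circ> transpose i j))"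
      using poly_divides_closed(2)[OF
        poly_divides_closed(3)[OF gkm_carrierD(3)[OF \<alpha> a] p(1)]
        poly_divides_closed(3)[OF gkm_carrierD(3)[OF \<beta> a] p(2)]]
      by (simp add: algebra_simps)
  qed (simp_all add: h_le[simplified] polys_closed gkm_carrierD(1)[OF \<alpha>] gkm_carrierD(1)[OF \<beta>])
  have const: "(\<lambda>w\<in>sym_group n. p) \<in> gkm_carrier n h" if "p \<in> polys n" for p
    by (rule gkm_carrierI) (use h_le that in \<open>auto simp: poly_divides_closed\<close>)
  show "(\<lambda>w\<in>sym_group n. tconst c * \<alpha> w) \<in> gkm_carrier n h" if "\<alpha> \<in> gkm_carrier n h" for \<alpha> c
    using mult[OF const[OF polys_closed(3)[of c]] that]
    by (simp cong: restrict_cong)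
  show "(\<lambda>w\<in>sym_group n. - \<alpha> w) \<in> gkm_carrier n h" if "\<alpha> \<in> gkm_carrier n h" for \<alpha>
    using mult[OF const[OF polys_closed(5)[OF polys_closed(2)]] that]
    by (simp cong: restrict_cong)
qed

lemma cring_gkm_ring: "cring (gkm_ring n h)"
proof (rule cringI)
  show "abelian_group (gkm_ring n h)"
  proof (rule abelian_groupI)
    fix \<alpha> assume \<alpha>: "\<alpha> \<in> carrier (gkm_ring n h)"
    show "\<exists>\<beta>\<in>carrier (gkm_ring n h). \<beta> \<oplus>\<^bsub>gkm_ring n h\<^esub> \<alpha> = \<zero>\<^bsub>gkm_ring n h\<^esub>"
      by (rule bexI[of _ "\<lambda>w\<in>sym_group n. - \<alpha> w"])
        (use \<alpha> in \<open>auto simp: gkm_ring_def gkm_uminus fun_eq_iff\<close>)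
  next
    fix \<alpha> assume "\<alpha> \<in> carrier (gkm_ring n h)"
    thus "\<zero>\<^bsub>gkm_ring n h\<^esub> \<oplus>\<^bsub>gkm_ring n h\<^esub> \<alpha> = \<alpha>"
      by (auto simp: gkm_ring_def fun_eq_iff gkm_carrierD(2))
  qed (auto simp: gkm_ring_def gkm_add gkm_const polys_closed fun_eq_iff)
  show "comm_monoid (gkm_ring n h)"
  proof (rule comm_monoidI)
    fix \<alpha> assume "\<alpha> \<in> carrier (gkm_ring n h)"
    thus "\<one>\<^bsub>gkm_ring n h\<^esub> \<otimes>\<^bsub>gkm_ring n h\<^esub> \<alpha> = \<alpha>"
      by (auto simp: gkm_ring_def fun_eq_iff gkm_carrierD(2))
  qed (auto simp: gkm_ring_def gkm_mult gkm_const polys_closed fun_eq_iff)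
qed (auto simp: gkm_ring_def fun_eq_iff algebra_simps)

lemma t_ideal: "ideal (t_ideal n h) (gkm_ring n h)"
proof -
  interpret G: cring "gkm_ring n h" by (rule cring_gkm_ring)
  show ?thesis unfolding t_ideal_def
    by (rule G.genideal_ideal) (auto simp: gkm_ring_def gkm_const tvar_in_polys)
qed

lemma hess_smult_class:
  assumes "\<alpha> \<in> gkm_carrier n h"
  shows "c \<odot>\<^bsub>hess_cohomology n h\<^esub> hess_class n h \<alpha> = hess_class n h (c \<odot>\<^bsub>gkm_ring n h\<^esub> \<alpha>)"
proof -
  let ?G = "gkm_ring n h" and ?I = "t_ideal n h" and ?k = "\<lambda>w\<in>sym_group n. tconst c"
  interpret G: cring ?G by (rule cring_gkm_ring)
  interpret I: ideal ?I ?G by (rule t_ideal)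
  have k: "?k \<in> carrier ?G" by (simp add: gkm_ring_def gkm_const polys_closed)
  have \<alpha>: "\<alpha> \<in> carrier ?G" using assms by (simp add: gkm_ring_def)
  have sm: "c \<odot>\<^bsub>?G\<^esub> \<beta> = ?k \<otimes>\<^bsub>?G\<^esub> \<beta>" for \<beta> by (auto simp: gkm_ring_def fun_eq_iff)
  have "?I +>\<^bsub>?G\<^esub> (c \<odot>\<^bsub>?G\<^esub> \<beta>) = ?I +>\<^bsub>?G\<^esub> (c \<odot>\<^bsub>?G\<^esub> \<alpha>)" if \<beta>: "\<beta> \<in> ?I +>\<^bsub>?G\<^esub> \<alpha>" for \<beta>
  proof -
    have \<beta>G: "\<beta> \<in> carrier ?G"
      using \<beta> G.a_r_coset_subset_G[OF I.a_subset \<alpha>] by blast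
    have e: "?I +>\<^bsub>?G\<^esub> \<beta> = ?I +>\<^bsub>?G\<^esub> \<alpha>" using I.a_repr_independence'[OF \<beta> \<alpha>] by simp
    have "?I +>\<^bsub>?G\<^esub> (?k \<otimes>\<^bsub>?G\<^esub> \<beta>) = ?I +>\<^bsub>?G\<^esub> (?k \<otimes>\<^bsub>?G\<^esub> \<alpha>)"
      using I.rcoset_mult_add[OF k \<beta>G] I.rcoset_mult_add[OF k \<alpha>] e by simp
    thus ?thesis by (simp add: sm)
  qed
  moreover have "?I +>\<^bsub>?G\<^esub> \<alpha> \<noteq> {}" using I.a_rcos_self[OF \<alpha>] by blast
  ultimately have "(\<Union>\<beta>\<in>?I +>\<^bsub>?G\<^esub> \<alpha>. ?I +>\<^bsub>?G\<^esub> (c \<odot>\<^bsub>?G\<^esub> \<beta>)) = ?I +>\<^bsub>?G\<^esub> (c \<odot>\<^bsub>?G\<^esub> \<alpha>)"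
    by (rule SUP_eq_const[rotated])
  thus ?thesis by (simp only: hess_cohomology_def hess_class_def Let_def module.simps)
qed

lemma cring_hess_cohomology: "cring (hess_cohomology n h)"
proof -
  interpret G: cring "gkm_ring n h" by (rule cring_gkm_ring)
  interpret I: ideal "t_ideal n h" "gkm_ring n h" by (rule t_ideal)
  interpret Q: cring "gkm_ring n h Quot t_ideal n h"
    by (rule I.quotient_is_cring[OF G.is_cring])
  have eqs: "carrier (hess_cohomology n h) = carrier (gkm_ring n h Quot t_ideal n h)"
    "mult (hess_cohomology n h) = mult (gkm_ring n h Quot t_ideal n h)"
    "one (hess_cohomology n h) = one (gkm_ring n h Quot t_ideal n h)"
    "zero (hess_cohomology n h) = zero (gkm_ring n h Quot t_ideal n h)"
    "add (hess_cohomology n h) = add (gkm_ring n h Quot t_ideal n h)"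
    by (simp_all add: hess_cohomology_def Let_def)
  show ?thesis
  proof (rule cringI)
    show "abelian_group (hess_cohomology n h)"
      by (rule abelian_groupI) (auto simp: eqs Q.a_ac intro: Q.l_neg Q.a_inv_closed)
    show "comm_monoid (hess_cohomology n h)"
      by (rule comm_monoidI) (auto simp: eqs Q.m_ac)
  qed (simp add: eqs Q.l_distr)
qed

lemma vectorspace_hess_cohomology: "vectorspace class_ring (hess_cohomology n h)"
proof -
  let ?G = "gkm_ring n h" and ?H = "hess_cohomology n h" and ?I = "t_ideal n h"
  interpret G: cring ?G by (rule cring_gkm_ring)
  interpret I: ideal ?I ?G by (rule t_ideal)
  interpret H: cring ?H by (rule cring_hess_cohomology)
  have carr: "carrier ?H = hess_class n h ` carrier ?G"
    by (auto simp: hess_cohomology_def hess_class_def Let_def FactRing_def A_RCOSETS_def'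
        image_def)
  have Gc: "carrier ?G = gkm_carrier n h" by (simp add: gkm_ring_def)
  have sG: "c \<odot>\<^bsub>?G\<^esub> \<alpha> \<in> carrier ?G" if "\<alpha> \<in> carrier ?G" for c \<alpha>
    using that by (simp add: gkm_ring_def gkm_smult)
  have add: "hess_class n h \<alpha> \<oplus>\<^bsub>?H\<^esub> hess_class n h \<beta> = hess_class n h (\<alpha> \<oplus>\<^bsub>?G\<^esub> \<beta>)"
    if "\<alpha> \<in> carrier ?G" "\<beta> \<in> carrier ?G" for \<alpha> \<beta>
    using I.a_rcos_sum[OF that] by (simp add: hess_cohomology_def hess_class_def Let_def FactRing_def)
  have mult: "hess_class n h \<alpha> \<otimes>\<^bsub>?H\<^esub> hess_class n h \<beta> = hess_class n h (\<alpha> \<otimes>\<^bsub>?G\<^esub> \<beta>)"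
    if "\<alpha> \<in> carrier ?G" "\<beta> \<in> carrier ?G" for \<alpha> \<beta>
    using I.rcoset_mult_add[OF that] by (simp add: hess_cohomology_def hess_class_def Let_def FactRing_def)
  have sm: "c \<odot>\<^bsub>?H\<^esub> hess_class n h \<alpha> = hess_class n h (c \<odot>\<^bsub>?G\<^esub> \<alpha>)" if "\<alpha> \<in> carrier ?G" for c \<alpha>
    using hess_smult_class that by (simp add: Gc)
  have tc: "tconst (a + b) = tconst a + tconst b" "tconst (a * b) = tconst a * tconst b"
    "tconst 1 = 1" for a b
    by (simp_all add: tconst_def single_add mult_single)
  have "module class_ring ?H"
  proof (rule moduleI)
    show "cring (class_ring :: complex ring)"
      by (rule class_cring.is_cring)
    show "abelian_group ?H" by (rule H.is_abelian_group)
  next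
    fix a :: complex and A assume "A \<in> carrier ?H"
    thus "a \<odot>\<^bsub>?H\<^esub> A \<in> carrier ?H" by (auto simp: carr sm sG)
  next
    fix a b :: complex and A assume "A \<in> carrier ?H"
    then obtain \<alpha> where \<alpha>: "\<alpha> \<in> carrier ?G" "A = hess_class n h \<alpha>" by (auto simp: carr)
    have "(a + b) \<odot>\<^bsub>?G\<^esub> \<alpha> = a \<odot>\<^bsub>?G\<^esub> \<alpha> \<oplus>\<^bsub>?G\<^esub> b \<odot>\<^bsub>?G\<^esub> \<alpha>"
      "(a * b) \<odot>\<^bsub>?G\<^esub> \<alpha> = a \<odot>\<^bsub>?G\<^esub> (b \<odot>\<^bsub>?G\<^esub> \<alpha>)"
      by (auto simp: gkm_ring_def tc algebra_simps fun_eq_iff)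
    thus "(a \<oplus>\<^bsub>class_ring\<^esub> b) \<odot>\<^bsub>?H\<^esub> A = a \<odot>\<^bsub>?H\<^esub> A \<oplus>\<^bsub>?H\<^esub> b \<odot>\<^bsub>?H\<^esub> A"
      "(a \<otimes>\<^bsub>class_ring\<^esub> b) \<odot>\<^bsub>?H\<^esub> A = a \<odot>\<^bsub>?H\<^esub> (b \<odot>\<^bsub>?H\<^esub> A)"
      using \<alpha> by (simp_all add: sm add sG)
  next
    fix a :: complex and A B assume "A \<in> carrier ?H" "B \<in> carrier ?H"
    then obtain \<alpha> \<beta> where \<alpha>: "\<alpha> \<in> carrier ?G" "A = hess_class n h \<alpha>"
      "\<beta> \<in> carrier ?G" "B = hess_class n h \<beta>" by (auto simp: carr)
    have "a \<odot>\<^bsub>?G\<^esub> (\<alpha> \<oplus>\<^bsub>?G\<^esub> \<beta>) = a \<odot>\<^bsub>?G\<^esub> \<alpha> \<oplus>\<^bsub>?G\<^esub> a \<odot>\<^bsub>?G\<^esub> \<beta>"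
      by (auto simp: gkm_ring_def tc algebra_simps fun_eq_iff)
    thus "a \<odot>\<^bsub>?H\<^esub> (A \<oplus>\<^bsub>?H\<^esub> B) = a \<odot>\<^bsub>?H\<^esub> A \<oplus>\<^bsub>?H\<^esub> a \<odot>\<^bsub>?H\<^esub> B"
      using \<alpha> by (simp add: sm add sG)
  next
    fix A assume "A \<in> carrier ?H"
    then obtain \<alpha> where \<alpha>: "\<alpha> \<in> carrier ?G" "A = hess_class n h \<alpha>" by (auto simp: carr)
    have "(1::complex) \<odot>\<^bsub>?G\<^esub> \<alpha> = \<alpha>"
      using \<alpha>(1) by (auto simp: gkm_ring_def tc fun_eq_iff gkm_carrierD(2))
    thus "\<one>\<^bsub>class_ring\<^esub> \<odot>\<^bsub>?H\<^esub> A = A" using \<alpha> by (simp add: sm)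
  qed
  thus ?thesis
    unfolding vectorspace_def using class_field.field_axioms by auto
qed

end

lemma hfun_le: "i \<in> {1..n} \<Longrightarrow> hfun n m i \<le> n"
  by (auto simp: hfun_def)

lemma polys_prod: "(\<And>l. l \<in> A \<Longrightarrow> f l \<in> polys n) \<Longrightarrow> prod f A \<in> polys n"
  by (induction A rule: infinite_finite_induct) (simp_all add: polys_closed(2,7))

lemma sym_group_range: "w \<in> sym_group n \<Longrightarrow> i \<in> {1..n} \<Longrightarrow> w i \<in> {1..n}"
  unfolding sym_group_def using permutes_in_image[of w "{1..n}" i] by simp

lemma x_tuple_in_gkm:
  assumes "k \<in> {1..n}"
  shows "x_tuple n k \<in> carrier (gkm_ring n (hfun n m))"
proof -
  have div: "poly_divides n (tvar (w i) - tvar (w j)) (tvar (w k) - tvar ((w \<circ> transpose i j) k))"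
    for w i j
  proof -
    have d: "poly_divides n d d" for d
      unfolding poly_divides_def by (rule bexI[of _ 1]) (simp_all add: polys_closed(2))
    have d': "poly_divides n (a - b) (b - a)" for a b
      using poly_divides_closed(4)[OF d[of "a - b"]] by simp
    consider "k = i" | "k = j" | "k \<noteq> i" "k \<noteq> j" by blast
    thus ?thesis
    proof cases
      case 1
      thus ?thesis using d by simp
    next
      case 2
      thus ?thesis using d' by simp
    next
      case 3
      thus ?thesis by (simp add: transpose_def poly_divides_closed(1))
    qed
  qed
  have "(\<lambda>w\<in>sym_group n. tvar (w k)) \<in> gkm_carrier n (hfun n m)"
  proof (rule gkm_carrierI)
    show "tvar (w k) \<in> polys n" if "w \<in> sym_group n" for w
      by (rule tvar_in_polys[OF sym_group_range[OF that assms]])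
  qed (rule hfun_le div, assumption?)+
  thus ?thesis by (simp add: gkm_ring_def x_tuple_def)
qed

lemma y_tuple_in_gkm:
  assumes m: "1 \<le> m" "m \<le> n" and k: "k \<in> {1..n}"
  shows "y_tuple n m k \<in> carrier (gkm_ring n (hfun n m))"
proof -
  let ?A = "{n - m + 1..n - 1}"
  let ?f = "\<lambda>w. if w n = k then (\<Prod>l\<in>?A. tvar k - tvar (w l)) else 0"
  have inj: "w a \<noteq> w b" if "w \<in> sym_group n" "a \<noteq> b" for w a b
    using that permutes_inj[of w "{1..n}"] by (simp add: sym_group_def inj_eq)
  have poly: "tvar k - tvar (w l) \<in> polys n" if "w \<in> sym_group n" "l \<in> ?A" for w l
  proof -
    have "l \<in> {1..n}" using that(2) m by auto
    thus ?thesis using tvar_in_polys sym_group_range[OF that(1)] k by (blast intro: polys_closed(6))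
  qed
  have fpoly: "?f w \<in> polys n" if "w \<in> sym_group n" for w
  proof -
    have "(\<Prod>l\<in>?A. tvar k - tvar (w l)) \<in> polys n" by (rule polys_prod) (rule poly[OF that])
    thus ?thesis by (simp add: polys_closed(1))
  qed
  have factor: "poly_divides n (tvar k - tvar (w a)) (\<Prod>l\<in>?A. tvar k - tvar (w l))"
    if "w \<in> sym_group n" "a \<in> ?A" for w a
    unfolding poly_divides_def
  proof (rule bexI[of _ "\<Prod>l\<in>?A - {a}. tvar k - tvar (w l)"])
    show "(\<Prod>l\<in>?A. tvar k - tvar (w l))
        = (tvar k - tvar (w a)) * (\<Prod>l\<in>?A - {a}. tvar k - tvar (w l))"
      by (rule prod.remove[OF _ that(2)]) simp
    show "(\<Prod>l\<in>?A - {a}. tvar k - tvar (w l)) \<in> polys n"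
      by (rule polys_prod) (rule poly[OF that(1)], blast)
  qed
  have neg: "poly_divides n (a - b) p" if "poly_divides n (b - a) p" for a b p
  proof -
    from that obtain r where "r \<in> polys n" "p = (b - a) * r" by (auto simp: poly_divides_def)
    thus ?thesis unfolding poly_divides_def
      by (intro bexI[of _ "- r"]) (auto simp: polys_closed algebra_simps)
  qed
  have div: "poly_divides n (tvar (w i) - tvar (w j)) (?f w - ?f (w \<circ> transpose i j))"
    if w: "w \<in> sym_group n" and i: "i \<in> {1..n}" and j: "j \<in> {1..n}"
      and ij: "i < j" "j \<le> hfun n m i" for w i j
  proof (cases "j = n")
    case True
    hence iA: "i \<in> ?A" using ij i m by (auto simp: hfun_def split: if_splits)
    let ?w = "w \<circ> transpose i j"
    have w': "?w \<in> sym_group n" by (rule sym_group_comp_transpose[OF w i j])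
    have v: "?w n = w i" "?w i = w n" using True by auto
    consider "w n = k" "w i \<noteq> k" | "w i = k" "w n \<noteq> k" | "w n \<noteq> k" "w i \<noteq> k"
      using inj[OF w, of i n] ij True by auto
    thus ?thesis
    proof cases
      case 1
      thus ?thesis using neg[OF factor[OF w iA, folded 1(1)]] True v by simp
    next
      case 2
      thus ?thesis using poly_divides_closed(4)[OF factor[OF w' iA]] True v by simp
    next
      case 3
      thus ?thesis using v by (simp add: poly_divides_closed(1))
    qed
  next
    case False
    let ?w = "w \<circ> transpose i j"
    have jn: "j < n" using j False by auto
    have wn: "?w n = w n" using jn ij by (simp add: transpose_def)
    have main: "poly_divides n (tvar (w i) - tvar (w j))
      ((\<Prod>l\<in>?A. tvar k - tvar (w l)) - (\<Prod>l\<in>?A. tvar k - tvar (?w l)))"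
    proof (cases "i \<in> ?A")
      case True
      hence jA: "j \<in> ?A" using ij jn by auto
      have "(\<Prod>l\<in>?A. tvar k - tvar (?w l)) = (\<Prod>l\<in>?A. tvar k - tvar (w l))"
        using prod.permute[OF permutes_swap_id[OF True jA], of "\<lambda>l. tvar k - tvar (w l)"]
        by (simp add: o_def)
      thus ?thesis by (simp add: poly_divides_closed(1))
    next
      case iA: False
      show ?thesis
      proof (cases "j \<in> ?A")
        case True
        let ?p = "\<Prod>l\<in>?A - {j}. tvar k - tvar (w l)"
        have "(\<Prod>l\<in>?A - {j}. tvar k - tvar (?w l)) = ?p"
          by (rule prod.cong) (use iA in \<open>auto simp: transpose_def\<close>)
        hence eq: "(\<Prod>l\<in>?A. tvar k - tvar (w l)) - (\<Prod>l\<in>?A. tvar k - tvar (?w l))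
            = (tvar (w i) - tvar (w j)) * ?p"
          unfolding prod.remove[OF finite_atLeastAtMost True] by (simp add: algebra_simps)
        have "?p \<in> polys n" by (rule polys_prod) (rule poly[OF w], blast)
        thus ?thesis unfolding poly_divides_def using eq by blast
      next
        case False
        have "(\<Prod>l\<in>?A. tvar k - tvar (?w l)) = (\<Prod>l\<in>?A. tvar k - tvar (w l))"
          by (rule prod.cong) (use iA False in \<open>auto simp: transpose_def\<close>)
        thus ?thesis by (simp add: poly_divides_closed(1))
      qed
    qed
    show ?thesis
      using main wn by (cases "w n = k") (simp_all add: poly_divides_closed(1))
  qed
  have "(\<lambda>w\<in>sym_group n. ?f w) \<in> gkm_carrier n (hfun n m)"
    by (rule gkm_carrierI) (fact hfun_le fpoly div)+
  thus ?thesis unfolding y_tuple_def gkm_ring_def by simp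
qed

end

theory Submission
  imports Defs
begin

text \<open>
  Write \<open>A = {n-m+1..n-1}\<close> and \<open>B = {1..n-m}\<close>. Interpolating a GKM tuple along the position of a fixed
  value shows that \<open>\<G>\<close> is generated over the polynomials in \<open>t\<close> by the monomials in the \<open>x\<^sub>i\<close> and their
  products with the \<open>y\<^sub>k\<close>. The relations \<open>\<Prod>\<^sub>i(z - x\<^sub>i) = \<Prod>\<^sub>i(z - t\<^sub>i)\<close>, \<open>x\<^sub>n y\<^sub>k = t\<^sub>k y\<^sub>k\<close>,
  \<open>\<Sum>\<^sub>k y\<^sub>k = \<Prod>\<^sub>A(x\<^sub>n - x\<^sub>l)\<close> and \<open>\<Prod>\<^sub>B(t\<^sub>k - x\<^sub>l) y\<^sub>k = \<Prod>\<^bsub>j\<noteq>k\<^esub>(x\<^sub>n - t\<^sub>j)\<close> then rewrite every such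
  generator, by induction on its degree in \<open>x\<close> and \<open>y\<close> and a weight, as a combination of the lifts of the
  elements (i) and (ii). There are \<open>n!\<close> of these lifts, as many as points of the symmetric group, and
  they span a full-rank submodule of all tuples (every multiple of a point mass by the product of all
  \<open>t\<^sub>a - t\<^sub>b\<close> lies in \<open>\<G>\<close>), so they are independent: \<open>\<G>\<close> is free on them, and their images form a basis
  of \<open>\<G>/(t\<^sub>1, \<dots>, t\<^sub>n)\<close>.
\<close>

section \<open>Divisibility by differences of variables\<close>

text \<open>The obstacle is that no edge joins position \<open>n\<close> to a position of
  \<open>B\<close>: plain Newton interpolation would need the factor \<open>t_k - x_n\<close> there,
  and the \<open>y_k\<close> compensate for it. In the rewriting, \<open>y_k\<close> counts as
  degree \<open>m - 1\<close> and the \<open>t\<close> count nothing, so trading an \<open>x\<close>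
  for a \<open>t_k\<close> lowers the degree. Ties are broken by two opposite weights: in pure
  \<open>x\<close>-monomials exponents flow towards \<open>x_n\<close>, next to a
  \<open>y\<close>-difference towards \<open>x_1\<close>, because there \<open>x_n\<close> itself is
  absorbed. Each relation removes one way of leaving the index sets: the first enforces the exponent
  bounds, the second removes \<open>x_n\<close> from (ii), the second and third together remove the
  forbidden product of (i), the third alone reduces single \<open>y_k\<close> to differences, and
  the fourth removes the forbidden product of (ii). The count closes because the exclusion in (i)
  costs \<open>(n-m)(n-1)!\<close> of the \<open>n!\<close> Artin monomials and (ii) has exactly
  that many members.\<close>

lemma poly_mapping_sum_single:
  "(\<Sum>\<mu>\<in>Poly_Mapping.keys p. Poly_Mapping.single \<mu> (Poly_Mapping.lookup p \<mu>)) = p"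
  by (rule poly_mapping_eqI)
    (simp add: lookup_sum lookup_single when_def in_keys_iff flip: sum.delta')

lemma polys_power: "p \<in> polys n \<Longrightarrow> p ^ k \<in> polys n"
  by (induction k) (simp_all add: polys_closed)

lemma tconst_simps:
  "tconst 0 = 0" "tconst 1 = 1" "tconst (a + b) = tconst a + tconst b"
  "tconst (a * b) = tconst a * tconst b"
  by (simp_all add: tconst_def single_add mult_single)

lemma single_eq_prod_tvar:
  assumes "finite A" "Poly_Mapping.keys \<mu> \<subseteq> A"
  shows "Poly_Mapping.single \<mu> (1::complex) = (\<Prod>i\<in>A. tvar i ^ Poly_Mapping.lookup \<mu> i)"
proof -
  have pow: "tvar i ^ k = Poly_Mapping.single (Poly_Mapping.single i k) 1" for i k
    by (induction k) (simp_all add: tvar_def mult_single flip: single_add)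
  have prod: "(\<Prod>i\<in>A. Poly_Mapping.single (\<nu> i) (1::complex)) = Poly_Mapping.single (\<Sum>i\<in>A. \<nu> i) 1"
    for \<nu> :: "nat \<Rightarrow> nat \<Rightarrow>\<^sub>0 nat" and A
    by (induction A rule: infinite_finite_induct) (simp_all add: mult_single)
  have "(\<Sum>i\<in>A. Poly_Mapping.single i (Poly_Mapping.lookup \<mu> i)) =
    (\<Sum>i\<in>Poly_Mapping.keys \<mu>. Poly_Mapping.single i (Poly_Mapping.lookup \<mu> i))"
    using assms by (intro sum.mono_neutral_right) (auto simp: in_keys_iff)
  thus ?thesis by (simp add: pow prod poly_mapping_sum_single)
qed

text \<open>Induction over generators: statements about ring homomorphisms and ideals reduce to
  constants, variables and the two operations.\<close>

lemma polys_induct [consumes 1, case_names const tvar add mult]: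
  assumes "p \<in> polys n"
    and const: "\<And>c. P (tconst c)"
    and tvar: "\<And>i. i \<in> {1..n} \<Longrightarrow> P (tvar i)"
    and add: "\<And>p q. p \<in> polys n \<Longrightarrow> q \<in> polys n \<Longrightarrow> P p \<Longrightarrow> P q \<Longrightarrow> P (p + q)"
    and mult: "\<And>p q. p \<in> polys n \<Longrightarrow> q \<in> polys n \<Longrightarrow> P p \<Longrightarrow> P q \<Longrightarrow> P (p * q)"
  shows "P p"
proof -
  have one: "P 1" using const[of 1] by (simp add: tconst_simps)
  have pow: "tvar i ^ k \<in> polys n \<and> P (tvar i ^ k)" if "i \<in> {1..n}" for i k
    by (induction k) (simp_all add: one polys_closed tvar_in_polys[OF that] tvar[OF that] mult)
  have prod: "(\<Prod>i\<in>A. tvar i ^ e i) \<in> polys n \<and> P (\<Prod>i\<in>A. tvar i ^ e i)"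
    if "A \<subseteq> {1..n}" for A and e :: "nat \<Rightarrow> nat"
    using that by (induction A rule: infinite_finite_induct)
      (use pow in \<open>auto simp: one polys_closed intro!: mult\<close>)
  have mono: "Poly_Mapping.single \<mu> c \<in> polys n \<and> P (Poly_Mapping.single \<mu> c)"
    if "Poly_Mapping.keys \<mu> \<subseteq> {1..n}" for \<mu> c
  proof -
    have "Poly_Mapping.single \<mu> c = tconst c * Poly_Mapping.single \<mu> 1"
      by (simp add: tconst_def mult_single)
    also have "Poly_Mapping.single \<mu> (1::complex) = (\<Prod>i\<in>{1..n}. tvar i ^ Poly_Mapping.lookup \<mu> i)"
      by (rule single_eq_prod_tvar) (use that in auto)
    finally show ?thesis
      using prod[of "{1..n}" "Poly_Mapping.lookup \<mu>"]
      by (auto intro!: mult const simp: polys_closed)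
  qed
  have sum: "(\<Sum>\<mu>\<in>K. Poly_Mapping.single \<mu> (f \<mu>)) \<in> polys n \<and> P (\<Sum>\<mu>\<in>K. Poly_Mapping.single \<mu> (f \<mu>))"
    if "\<forall>\<mu>\<in>K. Poly_Mapping.keys \<mu> \<subseteq> {1..n}" for K and f :: "_ \<Rightarrow> complex"
    using that
  proof (induction K rule: infinite_finite_induct)
    case (insert \<mu> K)
    thus ?case using mono[of \<mu> "f \<mu>"] by (auto intro!: add simp: polys_closed)
  qed (use const[of 0] in \<open>auto simp: polys_closed tconst_simps\<close>)
  have "\<forall>\<mu>\<in>Poly_Mapping.keys p. Poly_Mapping.keys \<mu> \<subseteq> {1..n}" using assms(1) by (simp add: polys_def)
  from sum[OF this, of "Poly_Mapping.lookup p"] show ?thesis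
    by (simp add: poly_mapping_sum_single)
qed

section \<open>Substituting one variable for another\<close>

definition pushforward :: "((nat \<Rightarrow>\<^sub>0 nat) \<Rightarrow> (nat \<Rightarrow>\<^sub>0 nat)) \<Rightarrow> cpoly \<Rightarrow> cpoly" where
  "pushforward \<theta> p = (\<Sum>\<mu>\<in>Poly_Mapping.keys p. Poly_Mapping.single (\<theta> \<mu>) (Poly_Mapping.lookup p \<mu>))"

lemma pushforward_superset:
  assumes "finite A" "Poly_Mapping.keys p \<subseteq> A"
  shows "pushforward \<theta> p = (\<Sum>\<mu>\<in>A. Poly_Mapping.single (\<theta> \<mu>) (Poly_Mapping.lookup p \<mu>))"
  unfolding pushforward_def using assms
  by (intro sum.mono_neutral_left) (auto simp: in_keys_iff)

lemma pushforward_single: "pushforward \<theta> (Poly_Mapping.single \<mu> c) = Poly_Mapping.single (\<theta> \<mu>) c"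
  by (simp add: pushforward_def)

lemma pushforward_add: "pushforward \<theta> (p + q) = pushforward \<theta> p + pushforward \<theta> q"
proof -
  let ?A = "Poly_Mapping.keys p \<union> Poly_Mapping.keys q"
  have "Poly_Mapping.keys (p + q) \<subseteq> ?A" by (rule Poly_Mapping.keys_add)
  thus ?thesis
    using pushforward_superset[of ?A p] pushforward_superset[of ?A q] pushforward_superset[of ?A "p + q"]
    by (simp add: lookup_add single_add sum.distrib)
qed

lemma pushforward_sum: "pushforward \<theta> (sum f A) = (\<Sum>i\<in>A. pushforward \<theta> (f i))"
  by (induction A rule: infinite_finite_induct)
    (simp_all add: pushforward_add, simp_all add: pushforward_def)

lemma pushforward_mult:
  assumes "\<And>\<mu> \<nu>. \<theta> (\<mu> + \<nu>) = \<theta> \<mu> + \<theta> \<nu>"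
  shows "pushforward \<theta> (p * q) = pushforward \<theta> p * pushforward \<theta> q"
proof -
  have "p * q = (\<Sum>\<mu>\<in>Poly_Mapping.keys p. Poly_Mapping.single \<mu> (Poly_Mapping.lookup p \<mu>)) *
    (\<Sum>\<mu>\<in>Poly_Mapping.keys q. Poly_Mapping.single \<mu> (Poly_Mapping.lookup q \<mu>))"
    by (simp add: poly_mapping_sum_single)
  also have "pushforward \<theta> \<dots> = pushforward \<theta> p * pushforward \<theta> q"
    unfolding sum_product pushforward_sum mult_single pushforward_single assms
    by (simp add: pushforward_def sum_product mult_single)
  finally show ?thesis .
qed

text \<open>The effect of \<open>t_a := t_b\<close> on an exponent vector. It is additive, which
  makes its pushforward multiplicative.\<close>

definition merge_exp :: "nat \<Rightarrow> nat \<Rightarrow> (nat \<Rightarrow>\<^sub>0 nat) \<Rightarrow> (nat \<Rightarrow>\<^sub>0 nat)" where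
  "merge_exp a b \<mu> = (\<Sum>i\<in>Poly_Mapping.keys \<mu>.
     Poly_Mapping.single (if i = a then b else i) (Poly_Mapping.lookup \<mu> i))"

lemma merge_exp_single: "merge_exp a b (Poly_Mapping.single i k) = Poly_Mapping.single (if i = a then b else i) k"
  by (simp add: merge_exp_def)

lemma merge_exp_add: "merge_exp a b (\<mu> + \<nu>) = merge_exp a b \<mu> + merge_exp a b \<nu>"
proof -
  let ?A = "Poly_Mapping.keys \<mu> \<union> Poly_Mapping.keys \<nu>"
  have sup: "merge_exp a b \<kappa> = (\<Sum>i\<in>?A. Poly_Mapping.single (if i = a then b else i) (Poly_Mapping.lookup \<kappa> i))"
    if "Poly_Mapping.keys \<kappa> \<subseteq> ?A" for \<kappa>
    unfolding merge_exp_def using that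
    by (intro sum.mono_neutral_left) (auto simp: in_keys_iff)
  show ?thesis
    using sup[of \<mu>] sup[of \<nu>] sup[of "\<mu> + \<nu>"] Poly_Mapping.keys_add[of \<mu> \<nu>]
    by (simp add: lookup_add single_add sum.distrib)
qed

text \<open>The substitution \<open>t\<^sub>a \<mapsto> t\<^sub>b\<close>; its kernel is the ideal of \<open>t\<^sub>a - t\<^sub>b\<close>.\<close>

definition subst_var :: "nat \<Rightarrow> nat \<Rightarrow> cpoly \<Rightarrow> cpoly" where
  "subst_var a b = pushforward (merge_exp a b)"

lemma subst_var_simps:
  "subst_var a b (p + q) = subst_var a b p + subst_var a b q"
  "subst_var a b (p * q) = subst_var a b p * subst_var a b q"
  "subst_var a b (tconst c) = tconst c"
  "subst_var a b (tvar i) = tvar (if i = a then b else i)"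
proof -
  have zero: "merge_exp a b 0 = 0" by (simp add: merge_exp_def)
  show "subst_var a b (p + q) = subst_var a b p + subst_var a b q"
    "subst_var a b (p * q) = subst_var a b p * subst_var a b q"
    by (simp_all add: subst_var_def pushforward_add pushforward_mult merge_exp_add)
  show "subst_var a b (tconst c) = tconst c"
    by (simp add: subst_var_def tconst_def pushforward_single zero)
  show "subst_var a b (tvar i) = tvar (if i = a then b else i)"
    by (simp add: subst_var_def tvar_def pushforward_single merge_exp_single)
qed

lemma subst_var_zero_one: "subst_var a b 0 = 0" "subst_var a b 1 = 1"
  using subst_var_simps(3)[of a b 0] subst_var_simps(3)[of a b 1] by (simp_all add: tconst_simps)

lemma subst_var_diff: "subst_var a b (p - q) = subst_var a b p - subst_var a b q"
  using subst_var_simps(1)[of a b "p - q" q] by (simp add: algebra_simps)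

lemma subst_var_prod: "subst_var a b (prod f A) = (\<Prod>i\<in>A. subst_var a b (f i))"
  by (induction A rule: infinite_finite_induct) (simp_all add: subst_var_simps subst_var_zero_one)

lemma tvar_eq_iff [simp]: "tvar i = tvar j \<longleftrightarrow> i = j"
proof
  assume "tvar i = tvar j"
  hence "Poly_Mapping.keys (tvar i) = Poly_Mapping.keys (tvar j)" by simp
  hence "Poly_Mapping.single i (1::nat) = Poly_Mapping.single j 1" by (simp add: tvar_def)
  hence "Poly_Mapping.keys (Poly_Mapping.single i (1::nat)) = Poly_Mapping.keys (Poly_Mapping.single j (1::nat))"
    by simp
  thus "i = j" by simp
qed simp

lemma poly_divides_uminus: "poly_divides n (- p) q \<longleftrightarrow> poly_divides n p q"
  unfolding poly_divides_def by (metis add.inverse_inverse minus_mult_commute polys_closed(5))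

lemma poly_divides_swap: "poly_divides n (a - b) q \<longleftrightarrow> poly_divides n (b - a) q"
  using poly_divides_uminus[of n "a - b" q] by simp

lemma poly_divides_diff:
  "poly_divides n d p \<Longrightarrow> poly_divides n d q \<Longrightarrow> poly_divides n d (p - q)"
  using poly_divides_closed(2)[OF _ poly_divides_closed(4)] by fastforce

text \<open>The difference between \<open>p\<close> and its substituted version is divisible by
  \<open>tvar a - tvar b\<close> on generators, hence always, so the substituted polynomial is the
  remainder. Divisibility thus becomes an equation in an integral domain, where nonzero factors
  cancel.\<close>

lemma poly_divides_linear_iff:
  assumes p: "p \<in> polys n" and ab: "a \<in> {1..n}" "b \<in> {1..n}"
  shows "poly_divides n (tvar a - tvar b) p \<longleftrightarrow> subst_var a b p = 0"
proof -
  have "poly_divides n (tvar a - tvar b) (p - subst_var a b p) \<and> subst_var a b p \<in> polys n"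
    using p
  proof (induction rule: polys_induct)
    case (const c)
    thus ?case by (simp add: subst_var_simps poly_divides_closed polys_closed)
  next
    case (tvar i)
    have "poly_divides n d d" for d
      unfolding poly_divides_def by (rule bexI[of _ 1]) (simp_all add: polys_closed(2))
    thus ?case using tvar ab by (auto simp: subst_var_simps poly_divides_closed intro: tvar_in_polys)
  next
    case (add p q)
    hence "poly_divides n (tvar a - tvar b) ((p - subst_var a b p) + (q - subst_var a b q))"
      by (blast intro: poly_divides_closed)
    thus ?case using add by (simp add: subst_var_simps polys_closed algebra_simps)
  next
    case (mult p q)
    hence "poly_divides n (tvar a - tvar b) (q * (p - subst_var a b p) + subst_var a b p * (q - subst_var a b q))"
      by (blast intro: poly_divides_closed)
    thus ?case using mult by (simp add: subst_var_simps polys_closed algebra_simps)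
  qed
  moreover have "subst_var a b p = 0" if "poly_divides n (tvar a - tvar b) p"
    using that by (auto simp: poly_divides_def subst_var_simps subst_var_diff)
  ultimately show ?thesis by auto
qed

text \<open>The linear factors are pairwise coprime: replacing \<open>t_k\<close> by
  \<open>t_(v s)\<close> kills one factor but no other, since \<open>v\<close> is injective and
  avoids \<open>k\<close>. So each factor divides what remains after the others are split
  off.\<close>

lemma poly_divides_prod:
  assumes "finite S" "inj_on v S" "v ` S \<subseteq> {1..n} - {k}" "k \<in> {1..n}" "p \<in> polys n"
    and "\<And>q. q \<in> S \<Longrightarrow> poly_divides n (tvar k - tvar (v q)) p"
  shows "\<exists>r\<in>polys n. p = (\<Prod>q\<in>S. tvar k - tvar (v q)) * r"
  using assms
proof (induction S rule: finite_induct)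
  case empty
  thus ?case by auto
next
  case (insert s S)
  then obtain r where r: "r \<in> polys n" "p = (\<Prod>q\<in>S. tvar k - tvar (v q)) * r" by auto
  have sk: "v s \<in> {1..n}" using insert.prems by auto
  have "subst_var k (v s) (tvar k - tvar (v q)) \<noteq> 0" if "q \<in> S" for q
    using that insert.hyps insert.prems(1,2) by (auto simp: subst_var_simps subst_var_diff)
  hence "subst_var k (v s) (\<Prod>q\<in>S. tvar k - tvar (v q)) \<noteq> 0"
    using insert.hyps by (simp add: subst_var_prod)
  moreover have "subst_var k (v s) p = 0"
    using insert.prems(5)[of s] insert.prems(3,4) sk by (simp add: poly_divides_linear_iff)
  ultimately have "subst_var k (v s) r = 0" using r(2) by (simp add: subst_var_simps)
  hence "poly_divides n (tvar k - tvar (v s)) r"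
    using r(1) insert.prems(3) sk by (simp add: poly_divides_linear_iff)
  then obtain r' where "r' \<in> polys n" "r = (tvar k - tvar (v s)) * r'"
    by (auto simp: poly_divides_def)
  thus ?case using r insert.hyps by (intro bexI[of _ r']) (auto simp: mult_ac)
qed

section \<open>Interpolation in the full GKM ring\<close>

text \<open>For \<open>u\<close> in the symmetric group this is a coset of the permutations of the
  free positions \<open>{1..n} - P\<close>; interpolation recurses over such blocks.\<close>

definition fix_perms :: "nat \<Rightarrow> (nat \<Rightarrow> nat) \<Rightarrow> nat set \<Rightarrow> (nat \<Rightarrow> nat) set" where
  "fix_perms n u P = {w \<in> sym_group n. \<forall>i\<in>P. w i = u i}"

text \<open>The edge relation is a parameter because the recursion passes to blocks with fewer free
  positions and hence fewer edges.\<close>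

definition gkm_on :: "nat \<Rightarrow> (nat \<Rightarrow> nat) set \<Rightarrow> (nat \<Rightarrow> nat \<Rightarrow> bool) \<Rightarrow> tuple \<Rightarrow> bool" where
  "gkm_on n X E f \<longleftrightarrow> (\<forall>w\<in>X. f w \<in> polys n) \<and>
     (\<forall>w\<in>X. \<forall>i j. E i j \<longrightarrow>
        poly_divides n (tvar (w i) - tvar (w j)) (f w - f (w \<circ> transpose i j)))"

text \<open>Polynomials in the \<open>x_i\<close> over the ring of the \<open>t\<close>, taken as
  functions of arbitrary maps \<open>w\<close>, so that the closure rules carry no restriction to
  permutations.\<close>

inductive_set xpolys :: "nat \<Rightarrow> tuple set" for n where
  const: "p \<in> polys n \<Longrightarrow> (\<lambda>w. p) \<in> xpolys n"
| var: "i \<in> {1..n} \<Longrightarrow> (\<lambda>w. tvar (w i)) \<in> xpolys n"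
| add: "f \<in> xpolys n \<Longrightarrow> g \<in> xpolys n \<Longrightarrow> (\<lambda>w. f w + g w) \<in> xpolys n"
| mult: "f \<in> xpolys n \<Longrightarrow> g \<in> xpolys n \<Longrightarrow> (\<lambda>w. f w * g w) \<in> xpolys n"

lemma xpolys_uminus: "f \<in> xpolys n \<Longrightarrow> (\<lambda>w. - f w) \<in> xpolys n"
  using xpolys.mult[OF xpolys.const[OF polys_closed(5)[OF polys_closed(2)]], of f n] by simp

lemma xpolys_diff: "f \<in> xpolys n \<Longrightarrow> g \<in> xpolys n \<Longrightarrow> (\<lambda>w. f w - g w) \<in> xpolys n"
  using xpolys.add[OF _ xpolys_uminus, of f n g] by simp

lemma xpolys_prod: "(\<And>i. i \<in> A \<Longrightarrow> f i \<in> xpolys n) \<Longrightarrow> (\<lambda>w. \<Prod>i\<in>A. f i w) \<in> xpolys n"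
  by (induction A rule: infinite_finite_induct)
    (auto intro: xpolys.const polys_closed xpolys.mult)

lemma xpolys_zero: "(\<lambda>w. 0) \<in> xpolys n"
  by (rule xpolys.const) (rule polys_closed)

lemma xpolys_linear_prod:
  "S \<subseteq> {1..n} \<Longrightarrow> k \<in> {1..n} \<Longrightarrow> (\<lambda>w. \<Prod>q\<in>S. tvar k - tvar (w q)) \<in> xpolys n"
  by (intro xpolys_prod xpolys_diff xpolys.const xpolys.var tvar_in_polys) auto

lemma poly_divides_refl: "poly_divides n d d"
  unfolding poly_divides_def by (rule bexI[of _ 1]) (simp_all add: polys_closed(2))

lemma xpolys_gkm:
  assumes "f \<in> xpolys n" "w \<in> sym_group n" "i \<in> {1..n}" "j \<in> {1..n}"
  shows "f w \<in> polys n"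
    "poly_divides n (tvar (w i) - tvar (w j)) (f w - f (w \<circ> transpose i j))"
proof -
  define v where "v = w \<circ> transpose i j"
  have v: "v \<in> sym_group n" "\<And>k. v k = w (transpose i j k)"
    using sym_group_comp_transpose[OF assms(2-4)] by (auto simp: v_def)
  have "f w \<in> polys n \<and> f v \<in> polys n \<and>
    poly_divides n (tvar (w i) - tvar (w j)) (f w - f v)"
    using assms(1)
  proof induction
    case (const p)
    thus ?case by (simp add: poly_divides_closed)
  next
    case (var k)
    have "poly_divides n (tvar (w i) - tvar (w j)) (tvar (w k) - tvar (v k))"
      using poly_divides_refl[of n "tvar (w i) - tvar (w j)"] poly_divides_closed(1)
        poly_divides_swap[of n "tvar (w i)" "tvar (w j)"] poly_divides_refl[of n "tvar (w j) - tvar (w i)"]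
      by (cases "k = i"; cases "k = j") (auto simp: transpose_def v(2))
    moreover have "v k \<in> {1..n}" by (rule sym_group_range[OF v(1) var])
    ultimately show ?case
      using sym_group_range[OF assms(2) var] tvar_in_polys by blast
  next
    case (add f g)
    thus ?case
      using poly_divides_closed(2)[of n "tvar (w i) - tvar (w j)"
          "f w - f v" "g w - g v"]
      by (simp add: polys_closed algebra_simps)
  next
    case (mult f g)
    hence "poly_divides n (tvar (w i) - tvar (w j))
      (g w * (f w - f v) + f v * (g w - g v))"
      by (blast intro: poly_divides_closed)
    thus ?case using mult by (simp add: polys_closed algebra_simps)
  qed
  thus "f w \<in> polys n" "poly_divides n (tvar (w i) - tvar (w j)) (f w - f (w \<circ> transpose i j))"
    by (auto simp: v_def)
qed

lemma sym_group_inj: "w \<in> sym_group n \<Longrightarrow> w a = w b \<longleftrightarrow> a = b"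
  using permutes_inj[of w "{1..n}"] by (auto simp: sym_group_def inj_eq)

lemma fix_perms_transpose:
  assumes "w \<in> fix_perms n u P" "i \<in> {1..n} - P" "j \<in> {1..n} - P"
  shows "w \<circ> transpose i j \<in> fix_perms n u P"
  using assms sym_group_comp_transpose[of w n i j]
  by (auto simp: fix_perms_def transpose_def)

lemma fix_perms_insert:
  assumes "v \<in> fix_perms n u P"
  shows "fix_perms n v (insert p P) = {w \<in> fix_perms n u P. w p = v p}"
  using assms by (auto simp: fix_perms_def)

text \<open>Since \<open>w\<close> and \<open>u\<close> agree on \<open>P\<close>, a value that
  \<open>u\<close> takes outside \<open>P\<close> cannot sit inside \<open>P\<close> for
  \<open>w\<close>. Hence the blocks given by the position of this value exhaust the coset.\<close>

lemma fix_perms_position: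
  assumes "u \<in> sym_group n" "p0 \<in> {1..n} - P" "w \<in> fix_perms n u P"
  shows "\<exists>p\<in>{1..n} - P. w p = u p0"
proof -
  have w: "w permutes {1..n}" and u: "u permutes {1..n}"
    using assms by (auto simp: fix_perms_def sym_group_def)
  have "u p0 \<in> w ` {1..n}"
    using permutes_image[OF w] permutes_image[OF u] assms(2) by blast
  then obtain p where p: "p \<in> {1..n}" "w p = u p0" by auto
  have "p \<notin> P"
  proof
    assume "p \<in> P"
    hence "w p = u p" using assms(3) by (simp add: fix_perms_def)
    hence "p = p0" using p(2) assms(1) by (simp add: sym_group_inj)
    thus False using \<open>p \<in> P\<close> assms(2) by blast
  qed
  thus ?thesis using p by blast
qed

lemma xpolys_value:
  assumes "f \<in> xpolys n" "w \<in> sym_group n"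
  shows "f w \<in> polys n"
  using assms(1)
proof induction
  case (var k)
  thus ?case using sym_group_range[OF assms(2)] tvar_in_polys by blast
qed (auto simp: polys_closed)

lemma gkm_on_xpolys:
  assumes "f \<in> xpolys n" "X \<subseteq> sym_group n" "\<And>i j. E i j \<Longrightarrow> i \<in> {1..n} \<and> j \<in> {1..n}"
  shows "gkm_on n X E f"
  unfolding gkm_on_def using assms xpolys_value xpolys_gkm(2) by blast

lemma gkm_on_diff:
  assumes "gkm_on n X E f" "gkm_on n X E g"
  shows "gkm_on n X E (\<lambda>w. f w - g w)"
  unfolding gkm_on_def
proof (intro conjI ballI allI impI)
  fix w i j assume w: "w \<in> X" and E: "E i j"
  have "poly_divides n (tvar (w i) - tvar (w j))
    ((f w - f (w \<circ> transpose i j)) - (g w - g (w \<circ> transpose i j)))"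
    by (rule poly_divides_diff) (use assms w E in \<open>auto simp: gkm_on_def\<close>)
  thus "poly_divides n (tvar (w i) - tvar (w j))
    (f w - g w - (f (w \<circ> transpose i j) - g (w \<circ> transpose i j)))"
    by (simp add: algebra_simps)
qed (use assms in \<open>auto simp: gkm_on_def polys_closed\<close>)

lemma gkm_on_mono:
  assumes "gkm_on n X E f" "X' \<subseteq> X" "\<And>i j. E' i j \<Longrightarrow> E i j"
  shows "gkm_on n X' E' f"
  using assms unfolding gkm_on_def by blast

text \<open>Edges move only free positions, while the value at \<open>p\<close> is fixed. Hence no
  factor of the linear product vanishes modulo \<open>t_(w i) - t_(w j)\<close>, and the product can
  be cancelled from the edge condition.\<close>

lemma gkm_on_quotient:
  assumes p: "p \<in> P" "p \<in> {1..n}" and v: "v \<in> sym_group n"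
    and E: "\<And>i j. E i j \<Longrightarrow> i \<noteq> j \<and> i \<in> {1..n} - P \<and> j \<in> {1..n} - P"
    and S: "S \<subseteq> {1..n} - {p}"
    and f: "gkm_on n (fix_perms n v P) E f"
    and dvd: "\<And>w q. w \<in> fix_perms n v P \<Longrightarrow> q \<in> S \<Longrightarrow>
      poly_divides n (tvar (v p) - tvar (w q)) (f w)"
  shows "\<exists>e. gkm_on n (fix_perms n v P) E e \<and>
    (\<forall>w\<in>fix_perms n v P. f w = (\<Prod>q\<in>S. tvar (v p) - tvar (w q)) * e w)"
proof -
  let ?X = "fix_perms n v P" and ?c = "\<lambda>w. \<Prod>q\<in>S. tvar (v p) - tvar (w q)"
  have finS: "finite S" using S by (rule finite_subset) simp
  have vp: "v p \<in> {1..n}" by (rule sym_group_range[OF v p(2)])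
  have X: "w \<in> sym_group n" "w p = v p" if "w \<in> ?X" for w
    using that p by (auto simp: fix_perms_def)
  have "\<exists>r\<in>polys n. f w = ?c w * r" if w: "w \<in> ?X" for w
  proof (rule poly_divides_prod[OF finS])
    show "inj_on w S" using sym_group_inj[OF X(1)[OF w]] by (auto simp: inj_on_def)
    show "w ` S \<subseteq> {1..n} - {v p}"
    proof
      fix y assume "y \<in> w ` S"
      then obtain q where q: "q \<in> S" "y = w q" by auto
      have "w q \<noteq> w p" using q(1) S sym_group_inj[OF X(1)[OF w]] by auto
      moreover have "q \<in> {1..n}" using q(1) S by auto
      ultimately show "y \<in> {1..n} - {v p}"
        using q(2) X(2)[OF w] sym_group_range[OF X(1)[OF w]] by auto
    qed
    show "f w \<in> polys n" using f w by (simp add: gkm_on_def)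
    show "poly_divides n (tvar (v p) - tvar (w q)) (f w)" if "q \<in> S" for q by (rule dvd[OF w that])
  qed (rule vp)
  then obtain e where e: "\<And>w. w \<in> ?X \<Longrightarrow> e w \<in> polys n" "\<And>w. w \<in> ?X \<Longrightarrow> f w = ?c w * e w"
    by metis
  have "poly_divides n (tvar (w i) - tvar (w j)) (e w - e (w \<circ> transpose i j))"
    if w: "w \<in> ?X" and ij: "E i j" for w i j
  proof -
    let ?w = "w \<circ> transpose i j"
    note E' = E[OF ij]
    have w': "?w \<in> ?X" using fix_perms_transpose[OF w] E' by blast
    have c: "?c \<in> xpolys n" using S vp by (intro xpolys_linear_prod) auto
    have ran: "w i \<in> {1..n}" "w j \<in> {1..n}" using E' sym_group_range[OF X(1)[OF w]] by blast+
    \<comment> \<open>Leibniz splitting: subtracting the part in which only \<open>?c\<close> varies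
      leaves \<open>?c w * (e w - e ?w)\<close>.\<close>
    have "poly_divides n (tvar (w i) - tvar (w j)) (?c w * e w - ?c ?w * e ?w)"
      using f w ij e(2)[OF w] e(2)[OF w'] unfolding gkm_on_def by metis
    moreover have "poly_divides n (tvar (w i) - tvar (w j)) (e ?w * (?c w - ?c ?w))"
      using E' by (intro poly_divides_closed(3) xpolys_gkm(2)[OF c X(1)[OF w]] e(1)[OF w']) auto
    ultimately have "poly_divides n (tvar (w i) - tvar (w j))
      ((?c w * e w - ?c ?w * e ?w) - e ?w * (?c w - ?c ?w))"
      by (rule poly_divides_diff)
    hence "poly_divides n (tvar (w i) - tvar (w j)) (?c w * (e w - e ?w))"
      by (simp add: algebra_simps)
    hence "subst_var (w i) (w j) (?c w) * subst_var (w i) (w j) (e w - e ?w) = 0"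
      using poly_divides_linear_iff[OF _ ran] e(1)[OF w] e(1)[OF w'] xpolys_value[OF c X(1)[OF w]]
      by (simp add: polys_closed subst_var_simps)
    moreover have "subst_var (w i) (w j) (tvar (v p) - tvar (w q)) \<noteq> 0" if q: "q \<in> S" for q
    proof -
      have "w i \<noteq> w p" "w j \<noteq> w p" "w q \<noteq> w p"
        using E' p q S sym_group_inj[OF X(1)[OF w]] by auto
      thus ?thesis using X(2)[OF w] by (auto simp: subst_var_simps subst_var_diff)
    qed
    hence "subst_var (w i) (w j) (?c w) \<noteq> 0" using finS by (simp add: subst_var_prod)
    ultimately show ?thesis
      using poly_divides_linear_iff[OF _ ran] e(1)[OF w] e(1)[OF w'] by (simp add: polys_closed)
  qed
  hence "gkm_on n ?X E e" using e(1) unfolding gkm_on_def by blast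
  thus ?thesis using e(2) by blast
qed

lemma fix_perms_all:
  assumes "u \<in> sym_group n" "{1..n} \<subseteq> P" "w \<in> fix_perms n u P"
  shows "w = u"
proof
  fix i
  have "w permutes {1..n}" "u permutes {1..n}" using assms by (auto simp: fix_perms_def sym_group_def)
  thus "w i = u i" using assms by (cases "i \<in> {1..n}") (auto simp: fix_perms_def permutes_def)
qed

lemma linear_prod_zero:
  assumes "finite S" "q \<in> S" "w q = k"
  shows "(\<Prod>q\<in>S. tvar k - tvar (w q)) = 0"
  using assms by auto

text \<open>Newton interpolation along the position of a fixed value \<open>k\<close>.\<close>

lemma full_gkm_is_xpoly:
  assumes "u \<in> sym_group n"
    and "gkm_on n (fix_perms n u P) (\<lambda>i j. i \<noteq> j \<and> {i, j} \<subseteq> {1..n} - P) f"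
  shows "\<exists>g\<in>xpolys n. \<forall>w\<in>fix_perms n u P. f w = g w"
  using assms
proof (induction "card ({1..n} - P)" arbitrary: P u f rule: less_induct)
  case less
  let ?X = "fix_perms n u P" and ?E = "\<lambda>P i j. i \<noteq> j \<and> {i, j} \<subseteq> {1..n} - P"
  note u = less.prems(1) and f = less.prems(2)
  have XS: "?X \<subseteq> sym_group n" by (auto simp: fix_perms_def)
  show ?case
  proof (cases "{1..n} \<subseteq> P")
    case True
    have "u \<in> ?X" using u by (simp add: fix_perms_def)
    thus ?thesis using f fix_perms_all[OF u True]
      by (intro bexI[of _ "\<lambda>w. f u"]) (auto simp: gkm_on_def intro: xpolys.const)
  next
    case False
    then obtain p0 where p0: "p0 \<in> {1..n} - P" by blast
    define k where "k = u p0"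
    have k: "k \<in> {1..n}" using sym_group_range[OF u] p0 by (simp add: k_def)
    \<comment> \<open>\<open>S\<close> collects the treated positions of \<open>k\<close>. A
      correction by a multiple of the product over \<open>S\<close> is harmless there, since this
      product vanishes as soon as \<open>k\<close> sits in \<open>S\<close>.\<close>
    have "\<exists>g\<in>xpolys n. \<forall>w\<in>?X. (\<exists>p\<in>S. w p = k) \<longrightarrow> f w = g w"
      if "finite S" "S \<subseteq> {1..n} - P" for S
      using that
    proof (induction S rule: finite_induct)
      case empty
      thus ?case using xpolys_zero by auto
    next
      case (insert p S)
      then obtain g where g: "g \<in> xpolys n" "\<And>w q. w \<in> ?X \<Longrightarrow> q \<in> S \<Longrightarrow> w q = k \<Longrightarrow> f w = g w" by auto
      show ?case
      proof (cases "\<exists>v\<in>?X. v p = k")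
        case False
        thus ?thesis using g by (intro bexI[of _ g]) auto
      next
        case True
        then obtain v where v: "v \<in> ?X" "v p = k" by auto
        hence vS: "v \<in> sym_group n" using XS by auto
        let ?P = "insert p P"
        let ?Y = "fix_perms n v ?P" and ?c = "\<lambda>w. \<Prod>q\<in>S. tvar k - tvar (w q)"
        have Y: "?Y = {w \<in> ?X. w p = k}" using fix_perms_insert[OF v(1)] v(2) by simp
        have d: "gkm_on n ?X (?E P) (\<lambda>w. f w - g w)"
          by (intro gkm_on_diff f gkm_on_xpolys[OF g(1) XS]) auto
        have "\<exists>e. gkm_on n ?Y (?E ?P) e \<and> (\<forall>w\<in>?Y. f w - g w = (\<Prod>q\<in>S. tvar (v p) - tvar (w q)) * e w)"
        proof (rule gkm_on_quotient)
          show "gkm_on n ?Y (?E ?P) (\<lambda>w. f w - g w)"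
            by (rule gkm_on_mono[OF d]) (auto simp: Y)
          show "S \<subseteq> {1..n} - {p}" using insert by auto
          \<comment> \<open>Swapping \<open>p\<close> and \<open>q\<close> moves \<open>k\<close> to
            the treated position \<open>q\<close>, where \<open>f - g\<close> is zero; the edge
            condition turns this into divisibility on the new block.\<close>
          fix w q assume w: "w \<in> ?Y" and q: "q \<in> S"
          let ?w = "w \<circ> transpose p q"
          have wX: "w \<in> ?X" "w p = k" using w by (auto simp: Y)
          have pq: "p \<noteq> q" "p \<in> {1..n} - P" "q \<in> {1..n} - P" using insert q by auto
          have w': "?w \<in> ?X" by (rule fix_perms_transpose[OF wX(1) pq(2,3)])
          have "poly_divides n (tvar (w p) - tvar (w q)) ((f w - g w) - (f ?w - g ?w))"
            using d wX(1) pq unfolding gkm_on_def by blast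
          moreover have "f ?w = g ?w" using g(2)[OF w' q] wX(2) by simp
          ultimately show "poly_divides n (tvar (v p) - tvar (w q)) (f w - g w)"
            using wX(2) v(2) by simp
        qed (use insert.prems vS in auto)
        then obtain e where e: "gkm_on n ?Y (?E ?P) e" "\<And>w. w \<in> ?Y \<Longrightarrow> f w - g w = ?c w * e w"
          using v(2) by auto
        have "card ({1..n} - ?P) < card ({1..n} - P)"
          using insert.prems by (intro psubset_card_mono) auto
        from less.hyps[OF this vS e(1)] obtain h where
          h: "h \<in> xpolys n" "\<And>w. w \<in> ?Y \<Longrightarrow> e w = h w" by auto
        show ?thesis
        proof (intro bexI ballI impI)
          show "(\<lambda>w. g w + ?c w * h w) \<in> xpolys n"
            using insert.prems k by (intro xpolys.add xpolys.mult g h xpolys_linear_prod) auto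
          fix w assume w: "w \<in> ?X" "\<exists>q\<in>insert p S. w q = k"
          show "f w = g w + ?c w * h w"
          proof (cases "\<exists>q\<in>S. w q = k")
            case True
            thus ?thesis using g(2)[OF w(1)] linear_prod_zero[OF insert.hyps(1)] by auto
          next
            case False
            hence "w \<in> ?Y" using w by (auto simp: Y)
            thus ?thesis using e(2)[of w] h(2)[of w] by (simp add: algebra_simps)
          qed
        qed
      qed
    qed
    from this[of "{1..n} - P"] obtain g where
      "g \<in> xpolys n" "\<forall>w\<in>?X. (\<exists>p\<in>{1..n} - P. w p = k) \<longrightarrow> f w = g w" by auto
    thus ?thesis using fix_perms_position[OF u p0] unfolding k_def by blast
  qed
qed

section \<open>Generation by the classes x and y\<close>

text \<open>Symmetric form of \<open>i < j \<le> h'(i)\<close>: only the pairs between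
  \<open>n\<close> and \<open>B\<close> are missing from the complete graph on these positions.
  \<open>A\<close> and \<open>B\<close> are parameters because interpolation removes positions from
  them.\<close>

definition hess_edge :: "nat \<Rightarrow> nat set \<Rightarrow> nat set \<Rightarrow> nat \<Rightarrow> nat \<Rightarrow> bool" where
  "hess_edge n A B i j \<longleftrightarrow> i \<noteq> j \<and> ({i, j} \<subseteq> A \<union> B \<or> {i, j} \<subseteq> insert n A)"

text \<open>\<open>xy_tuple n A P Q\<close> is \<open>P + \<Sum>\<^sub>k y\<^sub>k Q\<^sub>k\<close>: at \<open>w\<close> only the summand \<open>k = w(n)\<close> survives.\<close>

definition xy_tuple :: "nat \<Rightarrow> nat set \<Rightarrow> tuple \<Rightarrow> (nat \<Rightarrow> tuple) \<Rightarrow> tuple" where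
  "xy_tuple n A P Q w = P w + (\<Prod>l\<in>A. tvar (w n) - tvar (w l)) * Q (w n) w"

definition xy_generated :: "nat \<Rightarrow> nat set \<Rightarrow> (nat \<Rightarrow> nat) set \<Rightarrow> tuple \<Rightarrow> bool" where
  "xy_generated n A X f \<longleftrightarrow> (\<exists>P Q. P \<in> xpolys n \<and> (\<forall>k\<in>{1..n}. Q k \<in> xpolys n) \<and>
     (\<forall>w\<in>X. f w = xy_tuple n A P Q w))"

text \<open>Along an edge inside \<open>A \<union> B\<close> the value at \<open>n\<close> is
  constant, so the tuple behaves like a polynomial in the \<open>x_i\<close>. Along an edge between
  \<open>A\<close> and \<open>n\<close> the \<open>y\<close>-part is divisible at each end
  separately, which leaves only \<open>P\<close>.\<close>

lemma gkm_on_xy_tuple: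
  assumes A: "A \<subseteq> {1..n}" "n \<notin> A" and B: "B \<subseteq> {1..n}" "n \<notin> B" and n: "1 \<le> n"
    and X: "X \<subseteq> sym_group n"
    and P: "P \<in> xpolys n" and Q: "\<And>k. k \<in> {1..n} \<Longrightarrow> Q k \<in> xpolys n"
  shows "gkm_on n X (hess_edge n A B) (xy_tuple n A P Q)"
proof -
  have nn: "n \<in> {1..n}" using n by simp
  define F where "F k w = P w + (\<Prod>l\<in>A. tvar k - tvar (w l)) * Q k w" for k w
  have F: "F k \<in> xpolys n" if "k \<in> {1..n}" for k
    unfolding F_def using that A P Q by (intro xpolys.add xpolys.mult xpolys_linear_prod) auto
  have eq: "xy_tuple n A P Q w = F (w n) w" for w by (simp add: F_def xy_tuple_def)
  have wn: "w n \<in> {1..n}" if "w \<in> sym_group n" for w by (rule sym_group_range[OF that nn])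
  have Yn: "poly_divides n (tvar (w n) - tvar (w a)) (xy_tuple n A P Q w - P w)"
    if w: "w \<in> sym_group n" and a: "a \<in> A" for w a
  proof -
    let ?R = "(\<Prod>l\<in>A - {a}. tvar (w n) - tvar (w l)) * Q (w n) w"
    have "finite A" using A(1) by (rule finite_subset) simp
    hence "xy_tuple n A P Q w - P w = (tvar (w n) - tvar (w a)) * ?R"
      using a by (simp add: xy_tuple_def prod.remove algebra_simps)
    moreover have "(\<lambda>v. (\<Prod>l\<in>A - {a}. tvar (w n) - tvar (v l)) * Q (w n) v) \<in> xpolys n"
      using A wn[OF w] Q by (intro xpolys.mult xpolys_linear_prod) auto
    from xpolys_value[OF this w] have "?R \<in> polys n" .
    ultimately show ?thesis unfolding poly_divides_def by blast
  qed
  have An: "poly_divides n (tvar (w a) - tvar (w n))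
      (xy_tuple n A P Q w - xy_tuple n A P Q (w \<circ> transpose a n))"
    if w: "w \<in> sym_group n" and a: "a \<in> A" for w a
  proof -
    let ?w = "w \<circ> transpose a n"
    have an: "a \<in> {1..n}" using a A by auto
    have w': "?w \<in> sym_group n" by (rule sym_group_comp_transpose[OF w an nn])
    have "poly_divides n (tvar (w a) - tvar (w n)) (xy_tuple n A P Q ?w - P ?w)"
      using Yn[OF w' a] by simp
    moreover have "poly_divides n (tvar (w a) - tvar (w n)) (xy_tuple n A P Q w - P w)"
      using Yn[OF w a] by (subst poly_divides_swap)
    moreover have "poly_divides n (tvar (w a) - tvar (w n)) (P w - P ?w)"
      by (rule xpolys_gkm(2)[OF P w an nn])
    ultimately have "poly_divides n (tvar (w a) - tvar (w n))
      ((xy_tuple n A P Q w - P w) - (xy_tuple n A P Q ?w - P ?w) + (P w - P ?w))"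
      by (intro poly_divides_closed(2) poly_divides_diff[of n _ "xy_tuple n A P Q w - P w"])
    thus ?thesis by (simp only: algebra_simps) simp
  qed
  show ?thesis unfolding gkm_on_def
  proof (intro conjI ballI allI impI)
    fix w assume "w \<in> X"
    hence w: "w \<in> sym_group n" using X by auto
    show "xy_tuple n A P Q w \<in> polys n" unfolding eq by (rule xpolys_value[OF F[OF wn[OF w]] w])
    fix i j assume E: "hess_edge n A B i j"
    then consider "i \<noteq> n" "j \<noteq> n" "i \<in> {1..n}" "j \<in> {1..n}" | "j = n" "i \<in> A" | "i = n" "j \<in> A"
      using A B unfolding hess_edge_def by blast
    thus "poly_divides n (tvar (w i) - tvar (w j))
        (xy_tuple n A P Q w - xy_tuple n A P Q (w \<circ> transpose i j))"
    proof cases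
      case 1
      hence "(w \<circ> transpose i j) n = w n" by (simp add: transpose_def)
      thus ?thesis unfolding eq using xpolys_gkm(2)[OF F[OF wn[OF w]] w 1(3,4)] by simp
    next
      case 2
      thus ?thesis using An[OF w] by simp
    next
      case 3
      hence "poly_divides n (tvar (w i) - tvar (w j))
        (xy_tuple n A P Q w - xy_tuple n A P Q (w \<circ> transpose j i))"
        using An[OF w 3(2)] by (subst poly_divides_swap) simp
      thus ?thesis by (simp add: transpose_commute)
    qed
  qed
qed

text \<open>The transposition carries \<open>k\<close> from \<open>p\<close> to \<open>q\<close>,
  where \<open>f\<close> and \<open>g\<close> agree already; the edge condition on
  \<open>f - g\<close> brings this back as divisibility.\<close>

lemma transpose_dvd_step:
  assumes d: "gkm_on n (fix_perms n u P) E (\<lambda>w. f w - g w)"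
    and w: "w \<in> fix_perms n u P" "w p = k" and E: "E p q"
    and pq: "p \<in> {1..n} - P" "q \<in> {1..n} - P"
    and fg: "\<And>w. w \<in> fix_perms n u P \<Longrightarrow> w q = k \<Longrightarrow> f w = g w"
  shows "poly_divides n (tvar k - tvar (w q)) (f w - g w)"
proof -
  let ?w = "w \<circ> transpose p q"
  have "?w \<in> fix_perms n u P" by (rule fix_perms_transpose[OF w(1) pq])
  moreover have "?w q = k" using w(2) by simp
  ultimately have "f ?w = g ?w" by (rule fg)
  moreover have "poly_divides n (tvar (w p) - tvar (w q)) ((f w - g w) - (f ?w - g ?w))"
    using d w(1) E unfolding gkm_on_def by blast
  ultimately show ?thesis using w(2) by simp
qed

text \<open>Newton interpolation along the position of the value \<open>k = u(n)\<close>, taking the positions in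
  the order \<open>n\<close>, \<open>A\<close>, \<open>B\<close>. On the blocks of \<open>A\<close> the factor \<open>t\<^sub>k - x\<^sub>n\<close> turns the \<open>y\<close> of the
  smaller problem into the full one; on the blocks of \<open>B\<close>, where \<open>t\<^sub>k - x\<^sub>n\<close> is not available,
  the class \<open>\<Prod>\<^sub>A(t\<^sub>k - x\<^sub>l) - y\<^sub>k\<close> vanishes on all blocks of \<open>A\<close> and \<open>n\<close>.\<close>

lemma hess_gkm_is_xy_generated:
  assumes "u \<in> sym_group n" "1 \<le> n" "{1..n} - P = insert n (A \<union> B)" "n \<notin> A \<union> B" "A \<inter> B = {}"
    and "gkm_on n (fix_perms n u P) (hess_edge n A B) f"
  shows "xy_generated n A (fix_perms n u P) f"
  using assms(1,3-)
proof (induction "card (A \<union> B)" arbitrary: A B P u f rule: less_induct)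
  case less
  let ?X = "fix_perms n u P"
  note u = less.prems(1) and N = less.prems(2) and nAB = less.prems(3) and disj = less.prems(4)
    and f = less.prems(5)
  have nn: "n \<in> {1..n}" using assms(2) by simp
  have XS: "?X \<subseteq> sym_group n" by (auto simp: fix_perms_def)
  have fin: "finite A" "finite B" using finite_subset[of "A \<union> B" "{1..n}"] N by blast+
  have sub: "A \<subseteq> {1..n}" "B \<subseteq> {1..n}" using N by blast+
  have free: "A \<subseteq> {1..n} - P" "B \<subseteq> {1..n} - P" "n \<in> {1..n} - P" using N by blast+
  define k where "k = u n"
  have k: "k \<in> {1..n}" using sym_group_range[OF u nn] by (simp add: k_def)
  let ?YA = "\<lambda>w. \<Prod>l\<in>A. tvar (w n) - tvar (w l)"
  define good where "good T \<longleftrightarrow> (\<exists>P Q. P \<in> xpolys n \<and> (\<forall>k\<in>{1..n}. Q k \<in> xpolys n) \<and>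
     (\<forall>w\<in>?X. \<forall>p\<in>T. w p = k \<longrightarrow> f w = xy_tuple n A P Q w))" for T
  have uX: "u \<in> ?X" using u by (simp add: fix_perms_def)
  have gkm_d: "gkm_on n ?X (hess_edge n A B) (\<lambda>w. f w - xy_tuple n A P Q w)"
    if "P \<in> xpolys n" "\<forall>k\<in>{1..n}. Q k \<in> xpolys n" for P Q
    by (rule gkm_on_diff[OF f gkm_on_xy_tuple]) (use that sub nAB assms(2) XS in auto)
  have block: "fix_perms n v (insert p P) = {w \<in> ?X. w p = k}" if "v \<in> ?X" "v p = k" for v p
    using fix_perms_insert[OF that(1)] that(2) by simp
  have good0: "good {n}"
  proof -
    have Y: "fix_perms n u (insert n P) = {w \<in> ?X. w n = k}" by (rule block[OF uX]) (simp add: k_def)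
    \<comment> \<open>Once \<open>n\<close> is fixed, the graph on the remaining positions is
      complete, so plain interpolation applies without any \<open>y\<close>.\<close>
    have N': "{1..n} - insert n P = A \<union> B" using N nAB by blast
    have "gkm_on n (fix_perms n u (insert n P)) (\<lambda>i j. i \<noteq> j \<and> {i, j} \<subseteq> {1..n} - insert n P) f"
      unfolding N' by (rule gkm_on_mono[OF f]) (auto simp: Y hess_edge_def)
    from full_gkm_is_xpoly[OF u this] obtain g where
      "g \<in> xpolys n" "\<forall>w\<in>fix_perms n u (insert n P). f w = g w" by auto
    thus ?thesis unfolding good_def Y using xpolys_zero
      by (intro exI[of _ g] exI[of _ "\<lambda>k w. 0"]) (auto simp: xy_tuple_def)
  qed
  have goodA: "good (insert n S)" if "finite S" "S \<subseteq> A" for S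
    using that
  proof (induction S rule: finite_induct)
    case empty
    thus ?case using good0 by simp
  next
    case (insert p S)
    then obtain P0 Q0 where g: "P0 \<in> xpolys n" "\<forall>k\<in>{1..n}. Q0 k \<in> xpolys n"
      "\<And>w q. w \<in> ?X \<Longrightarrow> q \<in> insert n S \<Longrightarrow> w q = k \<Longrightarrow> f w = xy_tuple n A P0 Q0 w"
      unfolding good_def by blast
    have pA: "p \<in> A" "S \<subseteq> A" using insert.prems by auto
    have np: "n \<noteq> p" "n \<notin> S" using pA nAB by auto
    show ?case
    proof (cases "\<exists>v\<in>?X. v p = k")
      case False
      thus ?thesis unfolding good_def using g by (intro exI[of _ P0] exI[of _ Q0]) auto
    next
      case True
      then obtain v where v: "v \<in> ?X" "v p = k" by auto
      hence vS: "v \<in> sym_group n" using XS by auto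
      let ?P = "insert p P" and ?A = "A - {p}"
      let ?Y = "fix_perms n v ?P"
      let ?cS = "\<lambda>w. \<Prod>q\<in>S. tvar k - tvar (w q)" and ?c = "\<lambda>w. \<Prod>q\<in>insert n S. tvar k - tvar (w q)"
      note Y = block[OF v]
      have N': "{1..n} - ?P = insert n (?A \<union> B)" using N pA disj nAB by blast
      note d = gkm_d[OF g(1,2)]
      have "\<exists>e. gkm_on n ?Y (hess_edge n ?A B) e \<and>
        (\<forall>w\<in>?Y. f w - xy_tuple n A P0 Q0 w = (\<Prod>q\<in>insert n S. tvar (v p) - tvar (w q)) * e w)"
      proof (rule gkm_on_quotient)
        show "gkm_on n ?Y (hess_edge n ?A B) (\<lambda>w. f w - xy_tuple n A P0 Q0 w)"
          by (rule gkm_on_mono[OF d]) (auto simp: Y hess_edge_def)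
        show "insert n S \<subseteq> {1..n} - {p}" using pA insert.hyps sub nn np by auto
        show "i \<noteq> j \<and> i \<in> {1..n} - ?P \<and> j \<in> {1..n} - ?P" if "hess_edge n ?A B i j" for i j
          unfolding N' using that by (auto simp: hess_edge_def)
        fix w q assume w: "w \<in> ?Y" and q: "q \<in> insert n S"
        have "poly_divides n (tvar k - tvar (w q)) (f w - xy_tuple n A P0 Q0 w)"
        proof (rule transpose_dvd_step[OF d])
          show "hess_edge n A B p q" using q pA np insert.hyps by (auto simp: hess_edge_def)
        qed (use w q pA free g(3) in \<open>auto simp: Y\<close>)
        thus "poly_divides n (tvar (v p) - tvar (w q)) (f w - xy_tuple n A P0 Q0 w)" using v(2) by simp
      qed (use vS pA sub in auto)
      then obtain e where e: "gkm_on n ?Y (hess_edge n ?A B) e"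
        "\<And>w. w \<in> ?Y \<Longrightarrow> f w - xy_tuple n A P0 Q0 w = ?c w * e w" using v(2) by auto
      have "card (?A \<union> B) < card (A \<union> B)"
        using pA disj fin by (intro psubset_card_mono) auto
      from less.hyps[OF this vS N' _ _ e(1)] obtain P1 Q1 where h: "P1 \<in> xpolys n"
        "\<forall>k\<in>{1..n}. Q1 k \<in> xpolys n" "\<And>w. w \<in> ?Y \<Longrightarrow> e w = xy_tuple n ?A P1 Q1 w"
        using nAB disj unfolding xy_generated_def by blast
      let ?P' = "\<lambda>w. P0 w + ?c w * P1 w"
      \<comment> \<open>On this block \<open>x_p = t_k\<close>, so \<open>?c\<close> times the
        product over \<open>A - {p}\<close> is \<open>- ?cS\<close> times the product over
        \<open>A\<close>. The entry \<open>k\<close> stays untouched to preserve the blocks with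
        \<open>w n = k\<close>.\<close>
      let ?Q' = "\<lambda>j w. Q0 j w + (if j = k then 0 else - (?cS w * Q1 j w))"
      have P': "?P' \<in> xpolys n"
        using sub pA k nn by (intro xpolys.add xpolys.mult g h xpolys_linear_prod) auto
      have Q': "?Q' j \<in> xpolys n" if "j \<in> {1..n}" for j
      proof (cases "j = k")
        case False
        thus ?thesis using that sub pA k g(2) h(2)
          by (simp, intro xpolys_diff xpolys.mult xpolys_linear_prod) auto
      qed (use that g(2) in auto)
      show ?thesis unfolding good_def
      proof (intro exI conjI ballI impI)
        fix w p' assume w: "w \<in> ?X" and p': "p' \<in> insert n (insert p S)" "w p' = k"
        have w_inj: "w a = w b \<longleftrightarrow> a = b" for a b using w XS sym_group_inj by blast
        have split: "?c w = (tvar k - tvar (w n)) * ?cS w" using insert.hyps np by simp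
        consider "p' = n" | "p' \<in> S" | "p' = p" using p' by auto
        thus "f w = xy_tuple n A ?P' ?Q' w"
        proof cases
          case 1
          hence wn: "w n = k" using p' by simp
          hence "?c w = 0" by (simp add: split)
          moreover have "f w = xy_tuple n A P0 Q0 w" using g(3)[OF w _ wn] by simp
          ultimately show ?thesis using wn by (simp add: xy_tuple_def)
        next
          case 2
          hence "?cS w = 0" using insert.hyps(1) p'(2) by auto
          moreover have "f w = xy_tuple n A P0 Q0 w" using g(3)[OF w _ p'(2)] 2 by simp
          ultimately show ?thesis using split by (simp add: xy_tuple_def)
        next
          case 3
          hence wp: "w p = k" using p' by simp
          hence "w n \<noteq> k" using w_inj[of n p] np by auto
          moreover have "w \<in> ?Y" using w wp by (simp add: Y)
          note eh = e(2)[OF this] h(3)[OF this]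
          have YA: "?YA w = (tvar (w n) - tvar k) * (\<Prod>l\<in>?A. tvar (w n) - tvar (w l))"
            using prod.remove[OF fin(1) pA(1), of "\<lambda>l. tvar (w n) - tvar (w l)"] wp by simp
          ultimately show ?thesis using eh unfolding split xy_tuple_def YA by (simp add: algebra_simps)
        qed
      qed (use P' Q' in auto)
    qed
  qed
  have goodB: "good (insert n (A \<union> S))" if "finite S" "S \<subseteq> B" for S
    using that
  proof (induction S rule: finite_induct)
    case empty
    thus ?case using goodA[OF fin(1)] by simp
  next
    case (insert p S)
    then obtain P0 Q0 where g: "P0 \<in> xpolys n" "\<forall>k\<in>{1..n}. Q0 k \<in> xpolys n"
      "\<And>w q. w \<in> ?X \<Longrightarrow> q \<in> insert n (A \<union> S) \<Longrightarrow> w q = k \<Longrightarrow> f w = xy_tuple n A P0 Q0 w"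
      unfolding good_def by blast
    have pB: "p \<in> B" "S \<subseteq> B" using insert.prems by auto
    have np: "n \<noteq> p" "n \<notin> S" "p \<notin> A" using pB nAB disj by auto
    have AS: "A \<inter> S = {}" using pB disj by auto
    show ?case
    proof (cases "\<exists>v\<in>?X. v p = k")
      case False
      thus ?thesis unfolding good_def using g by (intro exI[of _ P0] exI[of _ Q0]) auto
    next
      case True
      then obtain v where v: "v \<in> ?X" "v p = k" by auto
      hence vS: "v \<in> sym_group n" using XS by auto
      let ?P = "insert p P" and ?B = "B - {p}"
      let ?Y = "fix_perms n v ?P"
      let ?cS = "\<lambda>w. \<Prod>q\<in>S. tvar k - tvar (w q)" and ?cA = "\<lambda>w. \<Prod>q\<in>A. tvar k - tvar (w q)"
      note Y = block[OF v]
      have N': "{1..n} - ?P = insert n (A \<union> ?B)" using N pB disj nAB by blast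
      note d = gkm_d[OF g(1,2)]
      have "\<exists>e. gkm_on n ?Y (hess_edge n A ?B) e \<and>
        (\<forall>w\<in>?Y. f w - xy_tuple n A P0 Q0 w = (\<Prod>q\<in>A \<union> S. tvar (v p) - tvar (w q)) * e w)"
      proof (rule gkm_on_quotient)
        show "gkm_on n ?Y (hess_edge n A ?B) (\<lambda>w. f w - xy_tuple n A P0 Q0 w)"
          by (rule gkm_on_mono[OF d]) (auto simp: Y hess_edge_def)
        show "A \<union> S \<subseteq> {1..n} - {p}" using pB insert.hyps sub np by auto
        show "i \<noteq> j \<and> i \<in> {1..n} - ?P \<and> j \<in> {1..n} - ?P" if "hess_edge n A ?B i j" for i j
          unfolding N' using that by (auto simp: hess_edge_def)
        fix w q assume w: "w \<in> ?Y" and q: "q \<in> A \<union> S"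
        have "poly_divides n (tvar k - tvar (w q)) (f w - xy_tuple n A P0 Q0 w)"
        proof (rule transpose_dvd_step[OF d])
          show "hess_edge n A B p q" using q pB np insert.hyps by (auto simp: hess_edge_def)
        qed (use w q pB free g(3)[of _ q] in \<open>auto simp: Y\<close>)
        thus "poly_divides n (tvar (v p) - tvar (w q)) (f w - xy_tuple n A P0 Q0 w)" using v(2) by simp
      qed (use vS pB sub in auto)
      moreover have split: "(\<Prod>q\<in>A \<union> S. tvar k - tvar (w q)) = ?cA w * ?cS w" for w
        using fin(1) insert.hyps(1) AS by (rule prod.union_disjoint)
      ultimately obtain e where e: "gkm_on n ?Y (hess_edge n A ?B) e"
        "\<And>w. w \<in> ?Y \<Longrightarrow> f w - xy_tuple n A P0 Q0 w = ?cA w * ?cS w * e w" using v(2) by auto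
      have "card (A \<union> ?B) < card (A \<union> B)"
        using pB disj fin by (intro psubset_card_mono) auto
      from less.hyps[OF this vS N' _ _ e(1)] obtain P1 Q1 where h: "P1 \<in> xpolys n"
        "\<forall>k\<in>{1..n}. Q1 k \<in> xpolys n" "\<And>w. w \<in> ?Y \<Longrightarrow> e w = xy_tuple n A P1 Q1 w"
        using nAB disj unfolding xy_generated_def by blast
      let ?P' = "\<lambda>w. P0 w + ?cA w * ?cS w * P1 w"
      \<comment> \<open>At \<open>w n = k\<close> the product over \<open>A\<close> equals
        \<open>?cA w\<close>, so the entry \<open>k\<close> cancels the new term of
        \<open>?P'\<close>. On the block of \<open>p\<close> one has \<open>w n \<noteq> k\<close>,
        and only the other branch is active.\<close>
      let ?Q' = "\<lambda>j w. Q0 j w + (if j = k then - (?cS w * P1 w) else ?cA w * ?cS w * Q1 j w)"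
      have P': "?P' \<in> xpolys n"
        using sub pB k by (intro xpolys.add xpolys.mult g h xpolys_linear_prod) auto
      have Q': "?Q' j \<in> xpolys n" if "j \<in> {1..n}" for j
      proof (cases "j = k")
        case True
        thus ?thesis using that sub pB k g(2) h(1)
          by (simp, intro xpolys_diff xpolys.mult xpolys_linear_prod) auto
      next
        case False
        thus ?thesis using that sub pB k g(2) h(2)
          by (simp, intro xpolys.add xpolys.mult xpolys_linear_prod) auto
      qed
      show ?thesis unfolding good_def
      proof (intro exI conjI ballI impI)
        fix w p' assume w: "w \<in> ?X" and p': "p' \<in> insert n (A \<union> insert p S)" "w p' = k"
        have w_inj: "w a = w b \<longleftrightarrow> a = b" for a b using w XS sym_group_inj by blast
        consider "p' = n" | "p' \<in> A \<union> S" | "p' = p" using p' by auto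
        thus "f w = xy_tuple n A ?P' ?Q' w"
        proof cases
          case 1
          hence wn: "w n = k" using p' by simp
          have "f w = xy_tuple n A P0 Q0 w" using g(3)[OF w _ wn] by simp
          thus ?thesis using wn by (simp add: xy_tuple_def algebra_simps)
        next
          case 2
          hence "?cA w * ?cS w = 0"
            using insert.hyps(1) fin(1) p'(2) by auto
          moreover have "w n \<noteq> k" using w_inj[of n p'] p'(2) 2 nAB np by auto
          moreover have "f w = xy_tuple n A P0 Q0 w" using g(3)[OF w _ p'(2)] 2 by simp
          ultimately show ?thesis by (auto simp: xy_tuple_def)
        next
          case 3
          hence wp: "w p = k" using p' by simp
          hence "w n \<noteq> k" using w_inj[of n p] np by auto
          moreover have "w \<in> ?Y" using w wp by (simp add: Y)
          note e(2)[OF this] h(3)[OF this]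
          ultimately show ?thesis unfolding xy_tuple_def by (simp add: algebra_simps)
        qed
      qed (use P' Q' in auto)
    qed
  qed
  from goodB[OF fin(2)] obtain P' Q' where PQ: "P' \<in> xpolys n" "\<forall>k\<in>{1..n}. Q' k \<in> xpolys n"
    "\<And>w p. w \<in> ?X \<Longrightarrow> p \<in> {1..n} - P \<Longrightarrow> w p = k \<Longrightarrow> f w = xy_tuple n A P' Q' w"
    unfolding good_def N by blast
  thus ?case unfolding xy_generated_def
    using fix_perms_position[OF u free(3)] unfolding k_def by blast
qed

lemma gkm_carrier_is_xy_generated:
  assumes "2 \<le> n" "1 \<le> m" "m \<le> n" "\<alpha> \<in> gkm_carrier n (hfun n m)"
  shows "xy_generated n {n - m + 1..n - 1} (sym_group n) \<alpha>"
proof -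
  let ?A = "{n - m + 1..n - 1}" and ?B = "{1..n - m}"
  have X: "fix_perms n id {} = sym_group n" by (auto simp: fix_perms_def)
  have "poly_divides n (tvar (w i) - tvar (w j)) (\<alpha> w - \<alpha> (w \<circ> transpose i j))"
    if w: "w \<in> sym_group n" and E: "hess_edge n ?A ?B i j" for w i j
  proof -
    have main: "poly_divides n (tvar (w i) - tvar (w j)) (\<alpha> w - \<alpha> (w \<circ> transpose i j))"
      if "hess_edge n ?A ?B i j" "i < j" for i j
      by (rule gkm_carrierD(3)[OF assms(4) w])
        (use that assms(1-3) in \<open>auto simp: hess_edge_def hfun_def\<close>)
    have "i \<noteq> j" using E by (simp add: hess_edge_def)
    then consider "i < j" | "j < i" by linarith
    thus ?thesis
    proof cases
      case 2
      moreover have "hess_edge n ?A ?B j i" using E by (auto simp: hess_edge_def)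
      ultimately show ?thesis
        using main[of j i] by (subst poly_divides_swap) (simp add: transpose_commute)
    qed (use main E in auto)
  qed
  hence "gkm_on n (sym_group n) (hess_edge n ?A ?B) \<alpha>"
    unfolding gkm_on_def using gkm_carrierD(1)[OF assms(4)] by blast
  hence "xy_generated n ?A (fix_perms n id {}) \<alpha>"
    using assms(1-3)
    by (intro hess_gkm_is_xy_generated[where B = ?B]) (auto simp: X sym_group_def permutes_id)
  thus ?thesis by (simp add: X)
qed

section \<open>Artin monomials\<close>

definition xmon :: "nat \<Rightarrow> (nat \<Rightarrow> nat) \<Rightarrow> tuple" where
  "xmon n a w = (\<Prod>i\<in>{1..n}. tvar (w i) ^ a i)"

lemma xmon_cong: "(\<And>i. i \<in> {1..n} \<Longrightarrow> a i = b i) \<Longrightarrow> xmon n a = xmon n b"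
  by (auto simp: xmon_def fun_eq_iff intro!: prod.cong)

lemma xmon_add: "xmon n (\<lambda>i. a i + b i) w = xmon n a w * xmon n b w"
  by (simp add: xmon_def power_add prod.distrib)

lemma xmon_indicator:
  assumes "T \<subseteq> {1..n}"
  shows "xmon n (\<lambda>i. if i \<in> T then c else 0) w = (\<Prod>i\<in>T. tvar (w i)) ^ c"
proof -
  have "xmon n (\<lambda>i. if i \<in> T then c else 0) w = (\<Prod>i\<in>T. tvar (w i) ^ c)"
    unfolding xmon_def using assms by (intro prod.mono_neutral_cong_right) auto
  thus ?thesis by (simp add: prod_power_distrib)
qed

lemma xmon_single:
  assumes "t \<in> {1..n}"
  shows "xmon n (\<lambda>i. if i = t then c else 0) w = tvar (w t) ^ c"
  using xmon_indicator[of "{t}" n c w] assms by simp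

text \<open>An upper bound for the degree in the \<open>x_i\<close> with \<open>i \<in> T\<close>;
  coefficients in the \<open>t\<close> cost nothing. Variables are multiplied on one at a time, so
  inductions peel off a single \<open>x_i\<close>.\<close>

inductive xdeg :: "nat \<Rightarrow> nat set \<Rightarrow> tuple \<Rightarrow> nat \<Rightarrow> bool" for n T where
  const: "p \<in> polys n \<Longrightarrow> xdeg n T (\<lambda>w. p) d"
| var: "i \<in> T \<Longrightarrow> xdeg n T f d \<Longrightarrow> xdeg n T (\<lambda>w. tvar (w i) * f w) (Suc d)"
| add: "xdeg n T f d \<Longrightarrow> xdeg n T g d \<Longrightarrow> xdeg n T (\<lambda>w. f w + g w) d"

lemma xdeg_mono: "xdeg n T f d \<Longrightarrow> T \<subseteq> T' \<Longrightarrow> xdeg n T' f d"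
  by (induction rule: xdeg.induct) (auto intro: xdeg.intros)

lemma coeff_prod_linear_polys:
  assumes "finite A" "\<And>i. i \<in> A \<Longrightarrow> v i \<in> polys n"
  shows "coeff (\<Prod>i\<in>A. [:- v i, 1:]) k \<in> polys n"
  using assms
proof (induction A arbitrary: k rule: finite_induct)
  case empty
  thus ?case by (simp add: polys_closed)
next
  case (insert a A)
  show ?case using insert by (cases k) (auto simp: polys_closed)
qed

lemma monic_prod_linear:
  fixes v :: "'b \<Rightarrow> 'a :: idom"
  assumes "finite A"
  shows "degree (\<Prod>i\<in>A. [:- v i, 1:]) = card A" "coeff (\<Prod>i\<in>A. [:- v i, 1:]) (card A) = 1"
proof -
  show deg: "degree (\<Prod>i\<in>A. [:- v i, 1:]) = card A"
    using assms by (subst degree_prod_eq_sum_degree) auto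
  have "lead_coeff (\<Prod>i\<in>A. [:- v i, 1:]) = (\<Prod>i\<in>A. lead_coeff [:- v i, 1:])"
    by (rule lead_coeff_prod)
  thus "coeff (\<Prod>i\<in>A. [:- v i, 1:]) (card A) = 1" by (simp add: deg)
qed

text \<open>The coefficients of \<open>\<Prod>\<^sub>i (z - x\<^sub>i)\<close> over all \<open>i\<close> are constants; splitting off the factors of \<open>T\<close>
  one by one expresses the coefficients of the remaining product through the variables of \<open>T\<close>.\<close>

lemma coeff_complement_xdeg:
  assumes "finite T" "T \<subseteq> {1..n}" "i \<le> card ({1..n} - T)"
  shows "\<exists>f. xdeg n T f (card ({1..n} - T) - i) \<and>
    (\<forall>w\<in>sym_group n. coeff (\<Prod>l\<in>{1..n} - T. [:- tvar (w l), 1:]) i = f w)"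
  using assms
proof (induction T arbitrary: i rule: finite_induct)
  case empty
  let ?p = "\<lambda>v. \<Prod>l\<in>{1..n}. [:- tvar (v l), 1:]"
  have "?p w = ?p id" if "w \<in> sym_group n" for w
    using prod.permute[of w "{1..n}" "\<lambda>l. [:- tvar l, 1:]"] that by (simp add: sym_group_def o_def)
  moreover have "coeff (?p id) i \<in> polys n"
    by (rule coeff_prod_linear_polys) (auto intro: tvar_in_polys)
  ultimately show ?case
    by (intro exI[of _ "\<lambda>w. coeff (?p id) i"] conjI xdeg.const ballI) auto
next
  case (insert t T)
  let ?R = "{1..n} - T" and ?R' = "{1..n} - insert t T"
  let ?q = "\<lambda>w. \<Prod>l\<in>?R'. [:- tvar (w l), 1:]" and ?p = "\<lambda>w. \<Prod>l\<in>?R. [:- tvar (w l), 1:]"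
  have t: "t \<in> ?R" using insert by auto
  have R': "?R' = ?R - {t}" by auto
  have card: "card ?R = Suc (card ?R')" unfolding R' using card_Suc_Diff1[OF _ t] by simp
  \<comment> \<open>Compare coefficients in \<open>?p = (z - x_t) * ?q\<close>. Lower coefficients
    of \<open>?q\<close> come from higher ones, hence the downward induction from the leading
    coefficient 1.\<close>
  have pq: "coeff (?q w) i = coeff (?p w) (Suc i) + tvar (w t) * coeff (?q w) (Suc i)" for w i
  proof -
    have "?p w = [:- tvar (w t), 1:] * ?q w"
      unfolding R' by (rule prod.remove[OF _ t]) simp
    thus ?thesis by simp
  qed
  show ?case using insert.prems(2)
  proof (induction i rule: inc_induct)
    case base
    have "coeff (?q w) (card ?R') = 1" for w by (rule monic_prod_linear) simp
    thus ?case by (intro exI[of _ "\<lambda>w. 1"] conjI xdeg.const polys_closed) auto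
  next
    case (step i)
    then obtain g where g: "xdeg n (insert t T) g (card ?R' - Suc i)"
      "\<forall>w\<in>sym_group n. coeff (?q w) (Suc i) = g w" by auto
    have "Suc i \<le> card ?R" using step card by simp
    from insert.IH[OF _ this] insert.prems(1) obtain f where f: "xdeg n T f (card ?R - Suc i)"
      "\<forall>w\<in>sym_group n. coeff (?p w) (Suc i) = f w" by auto
    have "xdeg n (insert t T) (\<lambda>w. f w + tvar (w t) * g w) (card ?R' - i)"
    proof (rule xdeg.add)
      show "xdeg n (insert t T) f (card ?R' - i)"
        using xdeg_mono[OF f(1), of "insert t T"] card by auto
      have "card ?R' - i = Suc (card ?R' - Suc i)" using step by simp
      thus "xdeg n (insert t T) (\<lambda>w. tvar (w t) * g w) (card ?R' - i)"
        using xdeg.var[OF _ g(1), of t] by simp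
    qed
    thus ?case using f(2) g(2) pq[of _ i] by (intro exI[of _ "\<lambda>w. f w + tvar (w t) * g w"]) auto
  qed
qed

text \<open>Each unit of exponent that leaves \<open>t\<close> either vanishes or moves to a
  position of \<open>T\<close> that weighs at least one less; both lower the weight.\<close>

lemma weight_decreases:
  fixes a b wt :: "nat \<Rightarrow> nat"
  assumes T: "T \<subseteq> {1..n}" and t: "t \<in> {1..n} - T" and wt: "\<And>i. i \<in> T \<Longrightarrow> wt i < wt t" "0 < wt t"
    and b: "\<And>i. i \<in> {1..n} - insert t T \<Longrightarrow> b i = a i" "\<And>i. i \<in> T \<Longrightarrow> a i \<le> b i" "b t < a t"
      "b t + sum b T \<le> a t + sum a T"
  shows "sum b {1..n} \<le> sum a {1..n}" "(\<Sum>i\<in>{1..n}. b i * wt i) < (\<Sum>i\<in>{1..n}. a i * wt i)"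
proof -
  let ?R = "{1..n} - insert t T"
  have finT: "finite T" using T by (rule finite_subset) simp
  have split: "sum f {1..n} = sum f ?R + (f t + sum f T)" for f :: "nat \<Rightarrow> nat"
    using sum.subset_diff[of "insert t T" "{1..n}" f] T t finT by simp
  have R: "sum b ?R = sum a ?R" "(\<Sum>i\<in>?R. b i * wt i) = (\<Sum>i\<in>?R. a i * wt i)"
    using b(1) by (auto intro!: sum.cong)
  show "sum b {1..n} \<le> sum a {1..n}" using split[of b] split[of a] R(1) b(4) by simp
  define d where "d i = b i - a i" for i
  have bd: "b i = a i + d i" if "i \<in> T" for i using b(2)[OF that] by (simp add: d_def)
  have sd: "sum b T = sum a T + sum d T" unfolding sum.distrib[symmetric] by (rule sum.cong) (simp_all add: bd)
  have wd: "(\<Sum>i\<in>T. b i * wt i) = (\<Sum>i\<in>T. a i * wt i) + (\<Sum>i\<in>T. d i * wt i)"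
    unfolding sum.distrib[symmetric] by (rule sum.cong) (simp_all add: bd algebra_simps)
  have "b t * wt t + (\<Sum>i\<in>T. b i * wt i) < a t * wt t + (\<Sum>i\<in>T. a i * wt i)"
  proof -
    define v where "v = wt t - 1"
    have wtv: "wt t = Suc v" using wt(2) by (simp add: v_def)
    have "(\<Sum>i\<in>T. d i * wt i) \<le> (\<Sum>i\<in>T. d i * v)"
      by (intro sum_mono mult_le_mono2) (use wt(1) in \<open>simp add: wtv less_Suc_eq_le\<close>)
    also have "\<dots> = sum d T * v" by (simp add: sum_distrib_right)
    also have "\<dots> \<le> (a t - b t) * v" using b(4) sd by (intro mult_le_mono1) simp
    also have "\<dots> < (a t - b t) * wt t" using b(3) by (simp add: wtv)
    also have "\<dots> = a t * wt t - b t * wt t" by (rule diff_mult_distrib)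
    finally show ?thesis using wd by linarith
  qed
  thus "(\<Sum>i\<in>{1..n}. b i * wt i) < (\<Sum>i\<in>{1..n}. a i * wt i)"
    using split[of "\<lambda>i. b i * wt i"] split[of "\<lambda>i. a i * wt i"] R(2) by linarith
qed

section \<open>Monomial divisibility and the two index sets\<close>

lemma poly_divides_monomial_iff:
  assumes L: "L \<subseteq> {1..n}"
  shows "poly_divides n (\<Prod>l\<in>L. tvar l) (\<Prod>j\<in>{1..n}. tvar j ^ e j) \<longleftrightarrow> (\<forall>l\<in>L. 1 \<le> e l)"
proof
  assume "\<forall>l\<in>L. 1 \<le> e l"
  define e' where "e' j = e j - (if j \<in> L then 1 else 0)" for j
  have e: "e j = (if j \<in> L then 1 else 0) + e' j" for j using \<open>\<forall>l\<in>L. 1 \<le> e l\<close> by (auto simp: e'_def)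
  have "(\<Prod>j\<in>{1..n}. tvar j ^ e j) = (\<Prod>j\<in>{1..n}. if j \<in> L then tvar j else 1) * (\<Prod>j\<in>{1..n}. tvar j ^ e' j)"
    unfolding prod.distrib[symmetric] by (rule prod.cong) (auto simp: e power_add)
  also have "(\<Prod>j\<in>{1..n}. if j \<in> L then tvar j else 1) = (\<Prod>j\<in>L. tvar j)"
    using L by (intro prod.mono_neutral_cong_right) auto
  finally show "poly_divides n (\<Prod>l\<in>L. tvar l) (\<Prod>j\<in>{1..n}. tvar j ^ e j)"
    unfolding poly_divides_def by (blast intro: polys_prod polys_power tvar_in_polys)
next
  assume "poly_divides n (\<Prod>l\<in>L. tvar l) (\<Prod>j\<in>{1..n}. tvar j ^ e j)"
  then obtain r where r: "(\<Prod>j\<in>{1..n}. tvar j ^ e j) = (\<Prod>l\<in>L. tvar l) * r"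
    by (auto simp: poly_divides_def)
  show "\<forall>l\<in>L. 1 \<le> e l"
  proof
    fix l assume l: "l \<in> L"
    have "finite L" using L by (rule finite_subset) simp
    \<comment> \<open>The exponent vector of the monomial. As a key of a multiple of
      \<open>tvar l\<close> it is the unit vector of \<open>l\<close> plus another exponent
      vector.\<close>
    define \<mu> where "\<mu> = (\<Sum>j\<in>{1..n}. Poly_Mapping.single j (e j))"
    have look: "Poly_Mapping.lookup \<mu> j = (if j \<in> {1..n} then e j else 0)" for j
      unfolding \<mu>_def lookup_sum lookup_single when_def by simp
    have "Poly_Mapping.keys \<mu> \<subseteq> {1..n}" using look by (auto simp: in_keys_iff split: if_splits)
    hence "Poly_Mapping.single \<mu> 1 = (\<Prod>j\<in>{1..n}. tvar j ^ Poly_Mapping.lookup \<mu> j)"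
      by (intro single_eq_prod_tvar) auto
    also have "\<dots> = (\<Prod>j\<in>{1..n}. tvar j ^ e j)" by (rule prod.cong) (simp_all add: look)
    also have "\<dots> = tvar l * ((\<Prod>j\<in>L - {l}. tvar j) * r)"
      unfolding r prod.remove[OF \<open>finite L\<close> l, of tvar] by (simp add: mult.assoc)
    finally have "\<mu> \<in> Poly_Mapping.keys (tvar l * ((\<Prod>j\<in>L - {l}. tvar j) * r))"
      by (metis keys_single one_neq_zero singletonI)
    then obtain b where "\<mu> = Poly_Mapping.single l 1 + b"
      using keys_mult[of "tvar l"] by (auto simp: tvar_def)
    hence "Poly_Mapping.lookup \<mu> l \<ge> 1" by (simp add: lookup_add)
    thus "1 \<le> e l" using look[of l] L l by auto
  qed
qed

lemma exps_i_iff: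
  "e \<in> exps_i n m \<longleftrightarrow> e \<in> (\<Pi>\<^sub>E j\<in>{1..n}. {0..j - 1}) \<and> \<not> (\<forall>l\<in>{n - m + 1..n}. 1 \<le> e l)"
  unfolding exps_i_def by (subst poly_divides_monomial_iff) auto

lemma exps_ii_iff:
  assumes "1 \<le> n" "1 \<le> m"
  shows "e \<in> exps_ii n m \<longleftrightarrow>
    e \<in> (\<Pi>\<^sub>E j\<in>{1..n - 1}. {0..j - 1}) \<and> \<not> (\<forall>l\<in>{1..n - m}. 1 \<le> e (n - l))"
proof -
  obtain n' where n': "n = Suc n'" using assms by (cases n) auto
  \<comment> \<open>The index is reversed so that the exponent belongs to the variable itself;
    \<open>x_n\<close> does not occur and gets exponent 0.\<close>
  let ?e = "\<lambda>i. if i = n then 0 else e (n - i)"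
  have "(\<Prod>j = 1..n - 1. tvar (n - j) ^ e j) = (\<Prod>j = 1..n - 1. tvar j ^ ?e j)"
    by (rule prod.reindex_bij_witness[of _ "\<lambda>j. n - j" "\<lambda>j. n - j"]) (auto simp: n')
  also have "\<dots> = (\<Prod>j\<in>{1..n}. tvar j ^ ?e j)" by (simp add: n')
  finally have "(\<Prod>j = 1..n - 1. tvar (n - j) ^ e j) = (\<Prod>j\<in>{1..n}. tvar j ^ ?e j)" .
  moreover have "poly_divides n (\<Prod>l = 1..n - m. tvar l) (\<Prod>j\<in>{1..n}. tvar j ^ ?e j)
      \<longleftrightarrow> (\<forall>l\<in>{1..n - m}. 1 \<le> ?e l)"
    by (rule poly_divides_monomial_iff) auto
  moreover have "(\<forall>l\<in>{1..n - m}. 1 \<le> ?e l) \<longleftrightarrow> (\<forall>l\<in>{1..n - m}. 1 \<le> e (n - l))"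
    by (rule ball_cong) (use assms in auto)
  ultimately show ?thesis unfolding exps_ii_def by simp
qed

section \<open>The classes \<open>y_k\<close> as unrestricted functions, and their relations\<close>

definition yfun :: "nat \<Rightarrow> nat \<Rightarrow> nat \<Rightarrow> tuple" where
  "yfun n m k w = (if w n = k then \<Prod>l = n - m + 1..n - 1. tvar k - tvar (w l) else 0)"

lemma sum_yfun:
  assumes "w \<in> sym_group n" "1 \<le> n"
  shows "(\<Sum>k\<in>{1..n}. c k * yfun n m k w) = c (w n) * (\<Prod>l = n - m + 1..n - 1. tvar (w n) - tvar (w l))"
proof -
  have "w n \<in> {1..n}" using sym_group_range[OF assms(1)] assms(2) by simp
  hence "(\<Sum>k\<in>{1..n}. c k * yfun n m k w) = (\<Sum>k\<in>{w n}. c k * yfun n m k w)"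
    by (intro sum.mono_neutral_right) (auto simp: yfun_def)
  thus ?thesis by (simp add: yfun_def)
qed

text \<open>If \<open>w n = k\<close>, the positions of \<open>B\<close> and of the product in
  \<open>yfun\<close> are all but \<open>n\<close> and carry all values but \<open>k\<close>.
  Otherwise the factor \<open>j = w n\<close> on the right vanishes.\<close>

lemma prod_B_yfun:
  assumes w: "w \<in> sym_group n" and m: "1 \<le> m" "m \<le> n" and k: "k \<in> {1..n}"
  shows "(\<Prod>l\<in>{1..n - m}. tvar k - tvar (w l)) * yfun n m k w = (\<Prod>j\<in>{1..n} - {k}. tvar (w n) - tvar j)"
proof (cases "w n = k")
  case False
  have "w n \<in> {1..n}" using sym_group_range[OF w] m by simp
  hence "(\<Prod>j\<in>{1..n} - {k}. tvar (w n) - tvar j) = 0" using False by (auto simp: prod_zero_iff)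
  thus ?thesis using False by (simp add: yfun_def)
next
  case True
  have wp: "w permutes {1..n}" using w by (simp add: sym_group_def)
  have split: "{1..n} - {n} = {1..n - m} \<union> {n - m + 1..n - 1}" using m by auto
  have img: "w ` ({1..n} - {n}) = {1..n} - {k}"
    using permutes_image[OF wp] True permutes_inj[OF wp] by (simp add: image_set_diff)
  have inj: "inj_on w ({1..n} - {n})" using permutes_inj[OF wp] by (rule inj_on_subset) simp
  have "(\<Prod>j\<in>{1..n} - {k}. tvar k - tvar j) = (\<Prod>l\<in>{1..n} - {n}. tvar k - tvar (w l))"
    unfolding img[symmetric] prod.reindex[OF inj] by simp
  also have "\<dots> = (\<Prod>l\<in>{1..n - m}. tvar k - tvar (w l)) * (\<Prod>l\<in>{n - m + 1..n - 1}. tvar k - tvar (w l))"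
    unfolding split by (rule prod.union_disjoint) auto
  finally show ?thesis using True by (simp add: yfun_def)
qed

lemma xdeg_scale: "xdeg n T f d \<Longrightarrow> p \<in> polys n \<Longrightarrow> xdeg n T (\<lambda>w. p * f w) d"
proof (induction rule: xdeg.induct)
  case (const q d)
  thus ?case by (intro xdeg.const) (simp add: polys_closed)
next
  case (var i f d)
  hence "xdeg n T (\<lambda>w. tvar (w i) * (p * f w)) (Suc d)" by (intro xdeg.var) auto
  thus ?case by (simp add: mult.left_commute)
next
  case (add f d g)
  thus ?case by (simp add: distrib_left xdeg.add)
qed

lemma xdeg_Suc: "xdeg n T f d \<Longrightarrow> xdeg n T f (Suc d)"
  by (induction rule: xdeg.induct) (auto intro: xdeg.intros)

lemma xdeg_prod_linear:
  assumes "t \<in> T" "finite J" "J \<subseteq> {1..n}"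
  shows "xdeg n T (\<lambda>w. \<Prod>j\<in>J. tvar (w t) - tvar j) (card J)"
  using assms(2,3)
proof (induction J rule: finite_induct)
  case empty
  thus ?case by (simp add: xdeg.const polys_closed)
next
  case (insert j J)
  hence f: "xdeg n T (\<lambda>w. \<Prod>j\<in>J. tvar (w t) - tvar j) (card J)" by auto
  have "- tvar j \<in> polys n" using insert.prems by (intro polys_closed tvar_in_polys) auto
  from xdeg.add[OF xdeg.var[OF assms(1) f] xdeg_Suc[OF xdeg_scale[OF f this]]]
  show ?case using insert.hyps by (simp add: algebra_simps)
qed

text \<open>\<open>eq_on\<close> makes values outside the symmetric group irrelevant, so members can
  be given as plain functions of \<open>w\<close>.\<close>

locale tuple_submodule =
  fixes n :: nat and V :: "tuple set"
  assumes zero: "(\<lambda>w. 0) \<in> V"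
    and add: "f \<in> V \<Longrightarrow> g \<in> V \<Longrightarrow> (\<lambda>w. f w + g w) \<in> V"
    and scale: "p \<in> polys n \<Longrightarrow> f \<in> V \<Longrightarrow> (\<lambda>w. p * f w) \<in> V"
    and eq_on: "f \<in> V \<Longrightarrow> (\<And>w. w \<in> sym_group n \<Longrightarrow> f w = g w) \<Longrightarrow> g \<in> V"
begin

lemma uminus: "f \<in> V \<Longrightarrow> (\<lambda>w. - f w) \<in> V"
  using scale[OF polys_closed(5)[OF polys_closed(2)], of f] by simp

lemma diff: "f \<in> V \<Longrightarrow> g \<in> V \<Longrightarrow> (\<lambda>w. f w - g w) \<in> V"
  using add[OF _ uminus, of f g] by simp

lemma sum: "(\<And>i. i \<in> I \<Longrightarrow> f i \<in> V) \<Longrightarrow> (\<lambda>w. \<Sum>i\<in>I. f i w) \<in> V"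
  by (induction I rule: infinite_finite_induct) (auto intro: zero add)

lemma uminus_power: "(\<lambda>w. (-1) ^ k * f w) \<in> V \<longleftrightarrow> f \<in> V"
  using uminus[of f] uminus[of "\<lambda>w. - f w"] by (cases "even k") auto

text \<open>Expanding \<open>f\<close> only raises exponents in \<open>T\<close>, by at most
  \<open>d\<close> in total; this is all the reductions need to know about the monomials that
  occur.\<close>

lemma xdeg_mult_mem:
  assumes "xdeg n T f d" "T \<subseteq> {1..n}"
    and "\<And>b. (\<And>i. i \<in> {1..n} - T \<Longrightarrow> b i = a i) \<Longrightarrow> (\<And>i. i \<in> T \<Longrightarrow> a i \<le> b i) \<Longrightarrow>
      sum b T \<le> sum a T + d \<Longrightarrow> (\<lambda>w. xmon n b w * g w) \<in> V"
  shows "(\<lambda>w. f w * (xmon n a w * g w)) \<in> V"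
  using assms(1,3)
proof (induction arbitrary: a rule: xdeg.induct)
  case (const p d)
  thus ?case by (intro scale) auto
next
  case (var t f d)
  have tT: "t \<in> {1..n}" using var.hyps(1) assms(2) by auto
  have finT: "finite T" using assms(2) by (rule finite_subset) simp
  let ?a = "\<lambda>i. a i + (if i = t then 1 else 0)"
  have sa: "sum ?a T = Suc (sum a T)" using finT var.hyps(1) by (simp add: sum.distrib)
  have "(\<lambda>w. f w * (xmon n ?a w * g w)) \<in> V"
  proof (rule var.IH)
    fix b assume b: "\<And>i. i \<in> {1..n} - T \<Longrightarrow> b i = ?a i" "\<And>i. i \<in> T \<Longrightarrow> ?a i \<le> b i"
      "sum b T \<le> sum ?a T + d"
    show "(\<lambda>w. xmon n b w * g w) \<in> V"
    proof (rule var.prems)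
      show "b i = a i" if "i \<in> {1..n} - T" for i using b(1)[OF that] that var.hyps(1) by auto
      show "a i \<le> b i" if "i \<in> T" for i using b(2)[OF that] by simp
      show "sum b T \<le> sum a T + Suc d" using b(3) sa by simp
    qed
  qed
  thus ?case by (simp add: xmon_add xmon_single[OF tT] mult_ac)
next
  case (add f d h)
  have "(\<lambda>w. f w * (xmon n a w * g w)) \<in> V" by (rule add.IH(1)) (rule add.prems)
  moreover have "(\<lambda>w. h w * (xmon n a w * g w)) \<in> V" by (rule add.IH(2)) (rule add.prems)
  ultimately show ?case using tuple_submodule.add[OF tuple_submodule_axioms] by (simp add: distrib_right)
qed

text \<open>\<open>x_t\<close> is a root of the monic product of \<open>z - x_l\<close> over the
  \<open>l\<close> outside \<open>T\<close>, whose coefficients are polynomials in the variables of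
  \<open>T\<close>. A high power of \<open>x_t\<close> is thus traded for lower powers and variables
  of \<open>T\<close>. The factor \<open>g\<close> is free, to serve both pure monomials and
  \<open>y\<close>-differences.\<close>

lemma artin_reduction:
  assumes T: "T \<subseteq> {1..n}" and t: "t \<in> {1..n} - T" and j: "card ({1..n} - T) \<le> a t"
    and red: "\<And>b. (\<And>i. i \<in> {1..n} - insert t T \<Longrightarrow> b i = a i) \<Longrightarrow> (\<And>i. i \<in> T \<Longrightarrow> a i \<le> b i) \<Longrightarrow>
      b t < a t \<Longrightarrow> b t + sum b T \<le> a t + sum a T \<Longrightarrow> (\<lambda>w. xmon n b w * g w) \<in> V"
  shows "(\<lambda>w. xmon n a w * g w) \<in> V"
proof -
  let ?R = "{1..n} - T"
  let ?j = "card ?R" and ?p = "\<lambda>w. \<Prod>l\<in>?R. [:- tvar (w l), 1:]"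
  have finT: "finite T" using T by (rule finite_subset) simp
  obtain f where f: "\<And>i. i < ?j \<Longrightarrow> xdeg n T (f i) (?j - i)"
    "\<And>i w. i < ?j \<Longrightarrow> w \<in> sym_group n \<Longrightarrow> coeff (?p w) i = f i w"
    using coeff_complement_xdeg[OF finT T] by (metis less_imp_le)
  \<comment> \<open>The exponents after the factor \<open>x_t ^ ?j\<close> has been replaced by
    \<open>x_t ^ i\<close>; \<open>a' ?j\<close> is \<open>a\<close> itself.\<close>
  define a' where "a' i l = (if l = t then a t - ?j + i else a l)" for i l
  have tn: "t \<in> {1..n}" using t by simp
  have a': "xmon n (a' i) w = xmon n (a' 0) w * tvar (w t) ^ i" for i w
  proof -
    have "a' i = (\<lambda>l. a' 0 l + (if l = t then i else 0))" by (auto simp: a'_def)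
    thus ?thesis by (simp add: xmon_add xmon_single[OF tn])
  qed
  have rel: "tvar (w t) ^ ?j = - (\<Sum>i<?j. f i w * tvar (w t) ^ i)" if w: "w \<in> sym_group n" for w
  proof -
    have "poly (?p w) (tvar (w t)) = 0" using t by (auto simp: poly_prod prod_zero_iff)
    moreover have "poly (?p w) (tvar (w t)) = (\<Sum>i\<le>?j. coeff (?p w) i * tvar (w t) ^ i)"
      using monic_prod_linear(1)[of ?R "\<lambda>l. tvar (w l)"] by (simp add: poly_altdef)
    ultimately have "(\<Sum>i<?j. coeff (?p w) i * tvar (w t) ^ i) + tvar (w t) ^ ?j = 0"
      using monic_prod_linear(2)[of ?R "\<lambda>l. tvar (w l)"] by (simp flip: lessThan_Suc_atMost)
    moreover have "(\<Sum>i<?j. coeff (?p w) i * tvar (w t) ^ i) = (\<Sum>i<?j. f i w * tvar (w t) ^ i)"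
      using f(2)[OF _ w] by (intro sum.cong) auto
    ultimately show ?thesis by (simp add: eq_neg_iff_add_eq_0 add.commute)
  qed
  have "(\<lambda>w. \<Sum>i<?j. f i w * (xmon n (a' i) w * g w)) \<in> V"
  proof (rule sum)
    fix i assume "i \<in> {..<?j}"
    hence i: "i < ?j" by simp
    show "(\<lambda>w. f i w * (xmon n (a' i) w * g w)) \<in> V"
    proof (rule xdeg_mult_mem[OF f(1)[OF i] T])
      fix b assume b: "\<And>l. l \<in> {1..n} - T \<Longrightarrow> b l = a' i l" "\<And>l. l \<in> T \<Longrightarrow> a' i l \<le> b l"
        "sum b T \<le> sum (a' i) T + (?j - i)"
      have aT: "a' i l = a l" if "l \<in> T" for l using that t by (auto simp: a'_def)
      have sT: "sum (a' i) T = sum a T" by (rule sum.cong) (simp_all add: aT)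
      have bt: "b t = a t - ?j + i" using b(1)[of t] t by (simp add: a'_def)
      show "(\<lambda>w. xmon n b w * g w) \<in> V"
      proof (rule red)
        show "b l = a l" if "l \<in> {1..n} - insert t T" for l using b(1)[of l] that by (auto simp: a'_def)
        show "a l \<le> b l" if "l \<in> T" for l using b(2)[OF that] aT[OF that] by simp
        show "b t < a t" using bt i j by simp
        show "b t + sum b T \<le> a t + sum a T" using bt i j b(3) sT by linarith
      qed
    qed
  qed
  from uminus[OF this] show ?thesis
  proof (rule eq_on)
    fix w assume w: "w \<in> sym_group n"
    have "a = a' ?j" using j by (auto simp: a'_def)
    hence "xmon n a w * g w = xmon n (a' 0) w * tvar (w t) ^ ?j * g w" using a'[of ?j w] by metis
    also have "\<dots> = - (xmon n (a' 0) w * g w * (\<Sum>i<?j. f i w * tvar (w t) ^ i))"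
      unfolding rel[OF w] by simp
    also have "xmon n (a' 0) w * g w * (\<Sum>i<?j. f i w * tvar (w t) ^ i) =
      (\<Sum>i<?j. f i w * (xmon n (a' i) w * g w))"
      unfolding sum_distrib_left
    proof (rule sum.cong)
      show "xmon n (a' 0) w * g w * (f i w * tvar (w t) ^ i) = f i w * (xmon n (a' i) w * g w)" for i
        by (subst a'[of i w]) (simp only: mult_ac)
    qed simp
    finally show "- (\<Sum>i<?j. f i w * (xmon n (a' i) w * g w)) = xmon n a w * g w" by simp
  qed
qed

end

section \<open>Reduction to the basis monomials\<close>

lemma card_subset_split: "finite A \<Longrightarrow> U \<subseteq> A \<Longrightarrow> card A = card U + card (A - U)"
  by (simp add: card_Diff_subset finite_subset card_mono)

text \<open>\<open>V\<close> stays abstract: every submodule containing the lifts of (i) and (ii) is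
  shown to contain all GKM tuples. It is later taken to be the span of the lifts.\<close>

locale hess_submodule = tuple_submodule +
  fixes m :: nat
  assumes nm: "2 \<le> n" "1 \<le> m" "m \<le> n"
    and mem_i: "e \<in> exps_i n m \<Longrightarrow> xmon n e \<in> V"
    and mem_ii: "e \<in> exps_ii n m \<Longrightarrow> k \<in> {1..n - 1} \<Longrightarrow>
      (\<lambda>w. (\<Prod>j = 1..n - 1. tvar (w (n - j)) ^ e j) * (yfun n m (k + 1) w - yfun n m 1 w)) \<in> V"
begin

abbreviation A where "A \<equiv> {n - m + 1..n - 1}"
abbreviation B where "B \<equiv> {1..n - m}"

lemma A_subset: "A \<subseteq> {1..n}" and B_subset: "B \<subseteq> {1..n}"
  using nm by auto

text \<open>Every rewriting either stays within degree \<open>d\<close> and lowers the weight, which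
  favours large indices, or produces \<open>y\<close>-terms of degree below \<open>d\<close>, where
  \<open>y_k\<close> counts \<open>m - 1\<close>.\<close>

lemma xmon_step:
  assumes low_y: "\<And>b k. sum b {1..n} + (m - 1) < d \<Longrightarrow> k \<in> {1..n} \<Longrightarrow> (\<lambda>w. xmon n b w * yfun n m k w) \<in> V"
    and "sum a {1..n} \<le> d"
  shows "xmon n a \<in> V"
  using assms(2)
proof (induction "\<Sum>i\<in>{1..n}. a i * (n + 1 - i)" arbitrary: a rule: less_induct)
  case less
  have nn: "n \<in> {1..n}" using nm by simp
  consider (artin) t where "t \<in> {1..n}" "t \<le> a t"
    | (prod) "\<forall>l\<in>{n - m + 1..n}. 1 \<le> a l"
    | (basis) "\<forall>t\<in>{1..n}. a t < t" "\<not> (\<forall>l\<in>{n - m + 1..n}. 1 \<le> a l)"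
    by force
  thus ?case
  proof cases
    case (artin t)
    \<comment> \<open>The complement of \<open>?T\<close> has \<open>t\<close> elements, so the
      exponent of \<open>x_t\<close> is pushed below \<open>t\<close>, the bound in (i), in favour
      of later and lighter variables.\<close>
    let ?T = "{t + 1..n}"
    have R: "{1..n} - ?T = {1..t}" using artin by auto
    have "(\<lambda>w. xmon n a w * 1) \<in> V"
    proof (rule artin_reduction[of ?T t])
      show "card ({1..n} - ?T) \<le> a t" unfolding R using artin by simp
      fix b assume b: "\<And>i. i \<in> {1..n} - insert t ?T \<Longrightarrow> b i = a i" "\<And>i. i \<in> ?T \<Longrightarrow> a i \<le> b i"
        "b t < a t" "b t + sum b ?T \<le> a t + sum a ?T"
      have "?T \<subseteq> {1..n}" "t \<in> {1..n} - ?T" "0 < n + 1 - t" using artin by auto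
      moreover have "n + 1 - i < n + 1 - t" if "i \<in> ?T" for i using that by auto
      ultimately have "sum b {1..n} \<le> sum a {1..n}"
        "(\<Sum>i\<in>{1..n}. b i * (n + 1 - i)) < (\<Sum>i\<in>{1..n}. a i * (n + 1 - i))"
        using weight_decreases[of ?T n t "\<lambda>i. n + 1 - i" b a] b by blast+
      thus "(\<lambda>w. xmon n b w * 1) \<in> V" using less.hyps[of b] less.prems by simp
    qed (use artin in auto)
    thus ?thesis by simp
  next
    case prod
    define a' where "a' i = a i - (if i \<in> {n - m + 1..n} then 1 else 0)" for i
    \<comment> \<open>The terms in the expansion of \<open>x_n * \<Prod>_A (x_n - x_l)\<close>:
      positions in \<open>U\<close> keep their \<open>x_l\<close>, the others contribute
      \<open>x_n\<close>. The term \<open>U = A\<close> gives back \<open>a\<close>.\<close>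
    define b where "b U i = a' i + ((if i \<in> U then 1 else 0) + (if i = n then card (A - U) + 1 else 0))" for U i
    have aA: "a i = b A i" if "i \<in> {1..n}" for i
    proof -
      have "1 \<le> a i" if "i \<in> {n - m + 1..n}" using prod that by blast
      thus ?thesis using that nm by (cases "i = n") (auto simp: a'_def b_def)
    qed
    have fw: "(\<Sum>i\<in>{1..n}. b U i * v i) = (\<Sum>i\<in>{1..n}. a' i * v i) + (sum v U + (card (A - U) + 1) * v n)"
      if "U \<subseteq> A" for U and v :: "nat \<Rightarrow> nat"
    proof -
      have "U \<subseteq> {1..n}" using that A_subset by blast
      hence "(\<Sum>i\<in>{1..n}. (if i \<in> U then 1 else 0) * v i) = sum v U"
        by (intro sum.mono_neutral_cong_right) auto
      moreover have "(\<Sum>i\<in>{1..n}. (if i = n then card (A - U) + 1 else 0) * v i) = (card (A - U) + 1) * v n"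
      proof -
        have "(\<Sum>i\<in>{1..n}. (if i = n then card (A - U) + 1 else 0) * v i) =
          (\<Sum>i\<in>{n}. (if i = n then card (A - U) + 1 else 0) * v i)"
          using nn by (intro sum.mono_neutral_right) auto
        thus ?thesis by simp
      qed
      ultimately show ?thesis by (simp only: b_def distrib_right sum.distrib)
    qed
    have cardU: "card A = card U + card (A - U)" if "U \<subseteq> A" for U
      using that by (intro card_subset_split) auto
    have degb: "sum (b U) {1..n} = sum a {1..n}" if U: "U \<subseteq> A" for U
    proof -
      have "sum a {1..n} = (\<Sum>i\<in>{1..n}. b A i * 1)" using aA by (intro sum.cong) auto
      thus ?thesis using fw[OF U, of "\<lambda>_. 1"] fw[of A "\<lambda>_. 1"] cardU[OF U] by simp
    qed
    \<comment> \<open>The product removed from \<open>a\<close> has degree \<open>m\<close>, but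
      \<open>y_k\<close> counts only \<open>m - 1\<close>: replacing \<open>x_n y_k\<close> by
      \<open>t_k y_k\<close> gains one degree.\<close>
    have dega': "sum a' {1..n} + (m - 1) < d"
      using degb[of A] fw[of A "\<lambda>_. 1"] less.prems nm by simp
    have memU: "xmon n (b U) \<in> V" if U: "U \<in> Pow A - {A}" for U
    proof -
      have U': "U \<subseteq> A" using U by auto
      have deg: "sum (b U) {1..n} \<le> d" using degb[OF U'] less.prems by simp
      let ?v = "\<lambda>i. n + 1 - i"
      have "(\<Sum>i\<in>{1..n}. a i * ?v i) = (\<Sum>i\<in>{1..n}. b A i * ?v i)" using aA by (intro sum.cong) auto
      moreover have "sum ?v A = sum ?v U + sum ?v (A - U)"
        using sum.subset_diff[OF U', of ?v] by simp
      \<comment> \<open>Replacing \<open>x_l\<close> by \<open>x_n\<close> lowers the weight: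
        position \<open>n\<close> weighs 1, every position of \<open>A\<close> at least 2.\<close>
      moreover have "card (A - U) < sum ?v (A - U)"
      proof -
        have "A - U \<noteq> {}" using U by auto
        hence "(\<Sum>i\<in>A - U. 1) < sum ?v (A - U)" by (intro sum_strict_mono) auto
        thus ?thesis by simp
      qed
      ultimately have sums: "(\<Sum>i\<in>{1..n}. a i * ?v i) = (\<Sum>i\<in>{1..n}. b A i * ?v i)"
        "sum ?v A = sum ?v U + sum ?v (A - U)" "card (A - U) < sum ?v (A - U)" by blast+
      have "(\<Sum>i\<in>{1..n}. b U i * ?v i) < (\<Sum>i\<in>{1..n}. a i * ?v i)"
      proof -
        have "(\<Sum>i\<in>{1..n}. b U i * ?v i) = (\<Sum>i\<in>{1..n}. a' i * ?v i) + (sum ?v U + (card (A - U) + 1))"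
          unfolding fw[OF U', of ?v] by simp
        moreover have "(\<Sum>i\<in>{1..n}. b A i * ?v i) = (\<Sum>i\<in>{1..n}. a' i * ?v i) + (sum ?v A + 1)"
          unfolding fw[OF subset_refl, of ?v] by simp
        ultimately show ?thesis using sums(1) sums(2) sums(3) by linarith
      qed
      from less.hyps[OF this deg] show ?thesis .
    qed
    have xb: "xmon n (b U) w = xmon n a' w * tvar (w n) * ((\<Prod>l\<in>U. tvar (w l)) * (\<Prod>l\<in>A - U. tvar (w n)))"
      if "U \<subseteq> A" for U w
    proof -
      have "U \<subseteq> {1..n}" using that A_subset by blast
      hence "xmon n (\<lambda>i. if i \<in> U then 1 else 0) w = (\<Prod>l\<in>U. tvar (w l))"
        using xmon_indicator[of U n 1 w] by simp
      moreover have "xmon n (\<lambda>i. if i = n then card (A - U) + 1 else 0) w = tvar (w n) * (\<Prod>l\<in>A - U. tvar (w n))"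
        by (simp only: xmon_single[OF nn] power_add power_one_right prod_constant mult.commute)
      ultimately show ?thesis unfolding b_def xmon_add by (simp only: mult_ac)
    qed
    let ?F = "\<lambda>w. (\<Sum>k\<in>{1..n}. tvar k * (xmon n a' w * yfun n m k w)) - (\<Sum>U\<in>Pow A - {A}. (-1) ^ card U * xmon n (b U) w)"
    have "?F \<in> V"
    proof (intro diff sum)
      show "(\<lambda>w. tvar k * (xmon n a' w * yfun n m k w)) \<in> V" if "k \<in> {1..n}" for k
        by (intro scale tvar_in_polys low_y dega' that)
      show "(\<lambda>w. (-1) ^ card U * xmon n (b U) w) \<in> V" if "U \<in> Pow A - {A}" for U
        unfolding uminus_power by (rule memU[OF that])
    qed
    hence "(\<lambda>w. (-1) ^ card A * xmon n a w) \<in> V"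
    proof (rule eq_on)
      fix w assume w: "w \<in> sym_group n"
      have "(\<Sum>k\<in>{1..n}. tvar k * (xmon n a' w * yfun n m k w)) =
        xmon n a' w * (\<Sum>k\<in>{1..n}. tvar k * yfun n m k w)"
        by (simp add: sum_distrib_left mult_ac)
      also have "\<dots> = xmon n a' w * tvar (w n) * (\<Prod>l\<in>A. tvar (w n) - tvar (w l))"
        using sum_yfun[OF w, of tvar m] nm by (simp add: mult_ac)
      also have "\<dots> = xmon n a' w * tvar (w n) *
        (\<Sum>U\<in>Pow A. (-1) ^ card U * (\<Prod>l\<in>U. tvar (w l)) * (\<Prod>l\<in>A - U. tvar (w n)))"
        by (subst prod_diff_conv_sum) simp_all
      also have "\<dots> = (\<Sum>U\<in>Pow A. (-1) ^ card U * xmon n (b U) w)"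
        unfolding sum_distrib_left
      proof (rule sum.cong)
        fix U assume "U \<in> Pow A"
        hence "U \<subseteq> A" by simp
        from xb[OF this, of w]
        show "xmon n a' w * tvar (w n) * ((-1) ^ card U * (\<Prod>l\<in>U. tvar (w l)) * (\<Prod>l\<in>A - U. tvar (w n)))
          = (-1) ^ card U * xmon n (b U) w" by (simp only: mult_ac)
      qed simp
      also have "\<dots> = (-1) ^ card A * xmon n (b A) w + (\<Sum>U\<in>Pow A - {A}. (-1) ^ card U * xmon n (b U) w)"
        by (rule sum.remove) auto
      also have "xmon n (b A) = xmon n a" by (rule xmon_cong) (simp add: aA)
      finally show "?F w = (-1) ^ card A * xmon n a w" by simp
    qed
    thus ?thesis by (simp only: uminus_power)
  next
    case basis
    have "restrict a {1..n} \<in> exps_i n m"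
      unfolding exps_i_iff using basis nm by fastforce
    from mem_i[OF this] show ?thesis
      using xmon_cong[of n "restrict a {1..n}" a] by simp
  qed
qed

text \<open>In the expansion of \<open>\<Prod>_B (t_k - x_l) y_k\<close> all terms but one lose
  degree to \<open>t_k\<close>. The other side of the relation has degree
  \<open>n - 1 = (n - m) + (m - 1)\<close> in \<open>x_n\<close>, so it yields pure
  \<open>x\<close>-monomials within the bound \<open>d\<close>.\<close>

lemma xmon_yfun_prod_B:
  assumes low_y: "\<And>b k. sum b {1..n} + (m - 1) < d \<Longrightarrow> k \<in> {1..n} \<Longrightarrow> (\<lambda>w. xmon n b w * yfun n m k w) \<in> V"
    and low_x: "\<And>b. sum b {1..n} \<le> d \<Longrightarrow> xmon n b \<in> V"
    and d: "sum a {1..n} + (m - 1) \<le> d" and a: "\<forall>l\<in>B. 1 \<le> a l" and k: "k \<in> {1..n}"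
  shows "(\<lambda>w. xmon n a w * yfun n m k w) \<in> V"
proof -
  have nn: "n \<in> {1..n}" using nm by simp
  define a' where "a' i = a i - (if i \<in> B then 1 else 0)" for i
  define b where "b U i = a' i + (if i \<in> U then 1 else 0)" for U i
  have aB: "a i = b B i" for i using a by (auto simp: a'_def b_def)
  have sb: "sum (b U) {1..n} = sum a' {1..n} + card U" if "U \<subseteq> B" for U
  proof -
    have "U \<subseteq> {1..n}" using that B_subset by blast
    hence "(\<Sum>i\<in>{1..n}. if i \<in> U then 1 else 0) = card U" by (simp add: sum.If_cases Int_absorb1)
    thus ?thesis by (simp add: b_def sum.distrib)
  qed
  have sa: "sum a {1..n} = sum a' {1..n} + (n - m)"
    using sb[of B] aB by simp
  have memU: "(\<lambda>w. xmon n (b U) w * yfun n m k w) \<in> V" if U: "U \<in> Pow B - {B}" for U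
  proof (rule low_y[OF _ k])
    have "card U < card B" using U by (intro psubset_card_mono) auto
    thus "sum (b U) {1..n} + (m - 1) < d" using sb[of U] sa d U by simp
  qed
  have q: "(\<lambda>w. (\<Prod>j\<in>{1..n} - {k}. tvar (w n) - tvar j) * (xmon n a' w * 1)) \<in> V"
  proof (rule xdeg_mult_mem)
    show "xdeg n {n} (\<lambda>w. \<Prod>j\<in>{1..n} - {k}. tvar (w n) - tvar j) (card ({1..n} - {k}))"
      by (rule xdeg_prod_linear) auto
    fix c assume c: "\<And>i. i \<in> {1..n} - {n} \<Longrightarrow> c i = a' i" "\<And>i. i \<in> {n} \<Longrightarrow> a' i \<le> c i"
      "sum c {n} \<le> sum a' {n} + card ({1..n} - {k})"
    have "sum c ({1..n} - {n}) = sum a' ({1..n} - {n})" using c(1) by (rule sum.cong[OF refl])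
    hence "sum c {1..n} \<le> sum a' {1..n} + card ({1..n} - {k})"
      using c(3) sum.remove[OF _ nn, of c] sum.remove[OF _ nn, of a'] by simp
    hence "sum c {1..n} \<le> d" using d sa k nm by simp
    thus "(\<lambda>w. xmon n c w * 1) \<in> V" using low_x by simp
  qed (use nn in auto)
  have xb: "xmon n (b U) w = xmon n a' w * (\<Prod>l\<in>U. tvar (w l))" if "U \<subseteq> B" for U w
  proof -
    have "U \<subseteq> {1..n}" using that B_subset by blast
    thus ?thesis unfolding b_def xmon_add using xmon_indicator[of U n 1 w] by simp
  qed
  let ?F = "\<lambda>w. (\<Prod>j\<in>{1..n} - {k}. tvar (w n) - tvar j) * (xmon n a' w * 1) -
    (\<Sum>U\<in>Pow B - {B}. (-1) ^ card U * (tvar k ^ card (B - U) * (xmon n (b U) w * yfun n m k w)))"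
  have "?F \<in> V"
    using k memU by (intro diff sum q) (simp only: uminus_power, intro scale polys_power tvar_in_polys, auto)
  hence "(\<lambda>w. (-1) ^ card B * (xmon n a w * yfun n m k w)) \<in> V"
  proof (rule eq_on)
    fix w assume w: "w \<in> sym_group n"
    have "(\<Prod>j\<in>{1..n} - {k}. tvar (w n) - tvar j) * (xmon n a' w * 1) =
      xmon n a' w * yfun n m k w * (\<Prod>l\<in>B. tvar k - tvar (w l))"
      unfolding prod_B_yfun[OF w nm(2,3) k, symmetric] by (simp add: mult_ac)
    also have "\<dots> = xmon n a' w * yfun n m k w *
      (\<Sum>U\<in>Pow B. (-1) ^ card U * (\<Prod>l\<in>U. tvar (w l)) * (\<Prod>l\<in>B - U. tvar k))"
      by (subst prod_diff_conv_sum) simp_all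
    also have "\<dots> = (\<Sum>U\<in>Pow B. (-1) ^ card U * (tvar k ^ card (B - U) * (xmon n (b U) w * yfun n m k w)))"
      unfolding sum_distrib_left
    proof (rule sum.cong)
      fix U assume "U \<in> Pow B"
      hence "U \<subseteq> B" by simp
      from xb[OF this, of w]
      show "xmon n a' w * yfun n m k w * ((-1) ^ card U * (\<Prod>l\<in>U. tvar (w l)) * (\<Prod>l\<in>B - U. tvar k))
        = (-1) ^ card U * (tvar k ^ card (B - U) * (xmon n (b U) w * yfun n m k w))"
        by (simp only: mult_ac prod_constant)
    qed simp
    also have "\<dots> = (-1) ^ card B * (tvar k ^ card (B - B) * (xmon n (b B) w * yfun n m k w)) +
      (\<Sum>U\<in>Pow B - {B}. (-1) ^ card U * (tvar k ^ card (B - U) * (xmon n (b U) w * yfun n m k w)))"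
      by (rule sum.remove) auto
    also have "xmon n (b B) = xmon n a" by (rule xmon_cong) (simp add: aB)
    finally show "?F w = (-1) ^ card B * (xmon n a w * yfun n m k w)" by simp
  qed
  thus ?thesis by (simp only: uminus_power)
qed

text \<open>Here the weight grows with the index, except that \<open>n\<close> weighs least, because
  (ii) bounds the exponent of \<open>x_(n-j)\<close> by \<open>j - 1\<close> and has no
  \<open>x_n\<close>. The difference is carried along as a fixed factor, which Artin reduction
  allows.\<close>

lemma xmon_yfun_diff_step:
  assumes low_y: "\<And>b k. sum b {1..n} + (m - 1) < d \<Longrightarrow> k \<in> {1..n} \<Longrightarrow> (\<lambda>w. xmon n b w * yfun n m k w) \<in> V"
    and low_x: "\<And>b. sum b {1..n} \<le> d \<Longrightarrow> xmon n b \<in> V"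
    and "sum a {1..n} + (m - 1) \<le> d" and k: "k \<in> {1..n - 1}"
  shows "(\<lambda>w. xmon n a w * (yfun n m (k + 1) w - yfun n m 1 w)) \<in> V"
  using assms(3)
proof (induction "\<Sum>i\<in>{1..n}. a i * (if i = n then 1 else i + 1)" arbitrary: a rule: less_induct)
  case less
  have nn: "n \<in> {1..n}" using nm by simp
  have k1: "k + 1 \<in> {1..n}" "1 \<in> {1..n}" using k nm by auto
  consider (last) "1 \<le> a n" | (artin) j where "j \<in> {1..n - 1}" "j \<le> a (n - j)"
    | (prod) "\<forall>l\<in>B. 1 \<le> a l"
    | (basis) "a n = 0" "\<forall>j\<in>{1..n - 1}. a (n - j) < j" "\<not> (\<forall>l\<in>B. 1 \<le> a l)"
    by force
  thus ?case
  proof cases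
    case last
    define a' where "a' i = a i - (if i = n then 1 else 0)" for i
    have a: "a = (\<lambda>i. a' i + (if i = n then 1 else 0))" using last by (auto simp: a'_def)
    have "sum a {1..n} = sum a' {1..n} + 1"
      by (subst a) (use nm in \<open>simp add: sum.distrib\<close>)
    hence "sum a' {1..n} + (m - 1) < d" using less.prems by simp
    note low_y[OF this]
    \<comment> \<open>\<open>x_n\<close> acts on the two \<open>y\<close> by the different scalars
      \<open>t_(k+1)\<close> and \<open>t_1\<close>, so the difference splits into two terms of
      lower degree.\<close>
    hence "(\<lambda>w. tvar (k + 1) * (xmon n a' w * yfun n m (k + 1) w) - tvar 1 * (xmon n a' w * yfun n m 1 w)) \<in> V"
      using k1 by (intro diff scale tvar_in_polys) auto
    moreover have "xmon n a w = xmon n a' w * tvar (w n)" for w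
      by (subst a) (simp add: xmon_add xmon_single[OF nn])
    ultimately show ?thesis
      by (elim eq_on) (auto simp: yfun_def algebra_simps)
  next
    case (artin j)
    let ?t = "n - j"
    \<comment> \<open>With \<open>n\<close> in \<open>?T\<close> the complement is
      \<open>{n - j..n - 1}\<close>, of size \<open>j\<close>. The powers of \<open>x_n\<close>
      created here are removed by the case \<open>last\<close>.\<close>
    let ?T = "insert n {1..<?t}" and ?v = "\<lambda>i. if i = n then 1 else i + 1"
    have t: "?t \<in> {1..n} - ?T" using artin by auto
    have "{1..n} - ?T = {n - j..n - 1}" using artin by auto
    hence "card ({1..n} - ?T) = card {n - j..n - 1}" by (rule arg_cong)
    also have "\<dots> = j" using artin by auto
    finally have R: "card ({1..n} - ?T) = j" .
    show ?thesis
    proof (rule artin_reduction[of ?T ?t])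
      show "card ({1..n} - ?T) \<le> a ?t" using R artin by simp
      fix b assume b: "\<And>i. i \<in> {1..n} - insert ?t ?T \<Longrightarrow> b i = a i" "\<And>i. i \<in> ?T \<Longrightarrow> a i \<le> b i"
        "b ?t < a ?t" "b ?t + sum b ?T \<le> a ?t + sum a ?T"
      have "?T \<subseteq> {1..n}" using nn by auto
      moreover have "?v i < ?v ?t" if "i \<in> ?T" for i using that t by auto
      moreover have "0 < ?v ?t" by simp
      ultimately have "sum b {1..n} \<le> sum a {1..n}"
        "(\<Sum>i\<in>{1..n}. b i * ?v i) < (\<Sum>i\<in>{1..n}. a i * ?v i)"
        using weight_decreases[of ?T n ?t ?v b a] b t by blast+
      thus "(\<lambda>w. xmon n b w * (yfun n m (k + 1) w - yfun n m 1 w)) \<in> V"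
        using less.hyps[of b] less.prems by simp
    qed (use t nn in auto)
  next
    case prod
    have "(\<lambda>w. xmon n a w * yfun n m (k + 1) w - xmon n a w * yfun n m 1 w) \<in> V"
      by (intro diff xmon_yfun_prod_B[OF low_y low_x less.prems prod] k1)
    thus ?thesis by (simp add: right_diff_distrib)
  next
    case basis
    let ?e = "\<lambda>j\<in>{1..n - 1}. a (n - j)"
    have e: "?e (n - l) = a l" if "l \<in> {1..n - 1}" for l using that by auto
    have "?e \<in> (\<Pi>\<^sub>E j\<in>{1..n - 1}. {0..j - 1})" using basis by fastforce
    moreover have "\<not> (\<forall>l\<in>B. 1 \<le> ?e (n - l))"
    proof -
      obtain l where l: "l \<in> B" "a l = 0" using basis(3) by (auto simp: not_le)
      hence "l \<in> {1..n - 1}" using nm by auto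
      thus ?thesis using l e by fastforce
    qed
    ultimately have "?e \<in> exps_ii n m" using nm by (subst exps_ii_iff) auto
    note mem_ii[OF this k]
    moreover have "(\<Prod>j = 1..n - 1. tvar (w (n - j)) ^ ?e j) = xmon n a w" for w
    proof -
      obtain n' where n': "n = Suc n'" using nm by (cases n) auto
      have "(\<Prod>j = 1..n - 1. tvar (w (n - j)) ^ ?e j) = (\<Prod>i = 1..n - 1. tvar (w i) ^ a i)"
        by (rule prod.reindex_bij_witness[of _ "\<lambda>j. n - j" "\<lambda>j. n - j"]) (auto simp: n')
      also have "\<dots> = xmon n a w" using basis(1) by (simp add: xmon_def n')
      finally show ?thesis .
    qed
    ultimately show ?thesis by simp
  qed
qed

text \<open>The sum of all \<open>y_k\<close> is the polynomial
  \<open>\<Prod>_A (x_n - x_l)\<close>; subtracting the differences leaves \<open>n y_1\<close>, and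
  \<open>n\<close> is invertible in the complex numbers.\<close>

lemma xmon_yfun_step:
  assumes low_y: "\<And>b k. sum b {1..n} + (m - 1) < d \<Longrightarrow> k \<in> {1..n} \<Longrightarrow> (\<lambda>w. xmon n b w * yfun n m k w) \<in> V"
    and low_x: "\<And>b. sum b {1..n} \<le> d \<Longrightarrow> xmon n b \<in> V"
    and d: "sum a {1..n} + (m - 1) \<le> d" and k: "k \<in> {1..n}"
  shows "(\<lambda>w. xmon n a w * yfun n m k w) \<in> V"
proof -
  have nn: "n \<in> {1..n}" using nm by simp
  note dif = xmon_yfun_diff_step[OF low_y low_x d]
  have top: "(\<lambda>w. xmon n a w * (\<Prod>l\<in>A. tvar (w n) - tvar (w l))) \<in> V"
  proof -
    let ?b = "\<lambda>U i. a i + ((if i \<in> U then 1 else 0) + (if i = n then card (A - U) else 0))"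
    have eq: "xmon n (?b U) w = xmon n a w * ((\<Prod>l\<in>U. tvar (w l)) * (\<Prod>l\<in>A - U. tvar (w n)))"
      if "U \<subseteq> A" for U w
    proof -
      have "U \<subseteq> {1..n}" using that A_subset by blast
      thus ?thesis unfolding xmon_add
        using xmon_indicator[of U n 1 w] xmon_single[OF nn, of "card (A - U)" w] by simp
    qed
    have "(\<lambda>w. \<Sum>U\<in>Pow A. (-1) ^ card U * xmon n (?b U) w) \<in> V"
    proof (intro sum, unfold uminus_power, rule low_x)
      fix U assume "U \<in> Pow A"
      hence U: "U \<subseteq> A" by simp
      hence U': "U \<subseteq> {1..n}" using A_subset by blast
      have "card A = card U + card (A - U)"
        using U by (intro card_subset_split) auto
      moreover have "(\<Sum>i\<in>{1..n}. if i \<in> U then 1 else 0) = card U"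
        using U' by (simp add: sum.If_cases Int_absorb1)
      ultimately show "sum (?b U) {1..n} \<le> d" using d nm by (simp add: sum.distrib)
    qed
    thus ?thesis
    proof (rule eq_on)
      fix w
      show "(\<Sum>U\<in>Pow A. (-1) ^ card U * xmon n (?b U) w) = xmon n a w * (\<Prod>l\<in>A. tvar (w n) - tvar (w l))"
        by (subst prod_diff_conv_sum) (auto simp: sum_distrib_left eq mult_ac intro!: sum.cong)
    qed
  qed
  have y1: "(\<lambda>w. xmon n a w * yfun n m 1 w) \<in> V"
  proof -
    have "(\<lambda>w. tconst (1 / of_nat n) * (xmon n a w * (\<Prod>l\<in>A. tvar (w n) - tvar (w l)) -
      (\<Sum>k\<in>{1..n - 1}. xmon n a w * (yfun n m (k + 1) w - yfun n m 1 w)))) \<in> V"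
      by (intro scale polys_closed(3) diff top sum dif)
    thus ?thesis
    proof (rule eq_on)
      fix w assume w: "w \<in> sym_group n"
      obtain n' where n': "n = Suc n'" using nm by (cases n) auto
      have "(\<Prod>l\<in>A. tvar (w n) - tvar (w l)) = (\<Sum>k\<in>{1..n}. yfun n m k w)"
        using sum_yfun[OF w, of "\<lambda>_. 1" m] nm by simp
      also have "\<dots> = yfun n m 1 w + (\<Sum>k\<in>{1..n - 1}. yfun n m (k + 1) w)"
        using sum.atLeast_Suc_atMost[of 1 n "\<lambda>k. yfun n m k w"] nm
          sum.shift_bounds_cl_Suc_ivl[of "\<lambda>k. yfun n m k w" 1 n'] by (simp add: n')
      finally have "xmon n a w * (\<Prod>l\<in>A. tvar (w n) - tvar (w l)) -
        (\<Sum>k\<in>{1..n - 1}. xmon n a w * (yfun n m (k + 1) w - yfun n m 1 w)) =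
        of_nat n * (xmon n a w * yfun n m 1 w)"
        using nm by (simp add: sum_distrib_left[symmetric] sum_subtractf algebra_simps of_nat_diff)
      moreover have "tconst (1 / of_nat n) * of_nat n = 1"
      proof -
        have "(of_nat n :: cpoly) = tconst (of_nat n)" by (simp add: tconst_def)
        thus ?thesis using nm tconst_simps(4)[of "1 / of_nat n" "of_nat n"] by (simp add: tconst_simps)
      qed
      ultimately show "tconst (1 / of_nat n) * (xmon n a w * (\<Prod>l\<in>A. tvar (w n) - tvar (w l)) -
      (\<Sum>k\<in>{1..n - 1}. xmon n a w * (yfun n m (k + 1) w - yfun n m 1 w))) = xmon n a w * yfun n m 1 w"
        by (simp only: mult.assoc[symmetric] mult_1)
    qed
  qed
  show ?thesis
  proof (cases "k = 1")
    case False
    hence "(\<lambda>w. xmon n a w * (yfun n m (k - 1 + 1) w - yfun n m 1 w) + xmon n a w * yfun n m 1 w) \<in> V"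
      using k by (intro add dif y1) auto
    thus ?thesis using False k by (simp add: algebra_simps)
  qed (use y1 in simp)
qed

text \<open>The order within one degree avoids circularity: pure monomials need only
  \<open>y\<close>-terms of smaller degree, while \<open>y\<close>-terms need pure monomials of the
  same degree.\<close>

lemma monomials_mem:
  shows xmon_mem: "xmon n a \<in> V"
    and xmon_yfun_mem: "k \<in> {1..n} \<Longrightarrow> (\<lambda>w. xmon n a w * yfun n m k w) \<in> V"
proof -
  have main: "(\<forall>a. sum a {1..n} \<le> d \<longrightarrow> xmon n a \<in> V) \<and>
    (\<forall>a k. sum a {1..n} + (m - 1) \<le> d \<longrightarrow> k \<in> {1..n} \<longrightarrow> (\<lambda>w. xmon n a w * yfun n m k w) \<in> V)" for d
  proof (induction d rule: less_induct)
    case (less d)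
    have low_y: "(\<lambda>w. xmon n b w * yfun n m k w) \<in> V"
      if "sum b {1..n} + (m - 1) < d" "k \<in> {1..n}" for b k
      using less.IH[OF that(1)] that(2) by auto
    have low_x: "xmon n b \<in> V" if "sum b {1..n} \<le> d" for b
      by (rule xmon_step[OF low_y that])
    show ?case using low_x xmon_yfun_step[OF low_y low_x] by blast
  qed
  show "xmon n a \<in> V" using main by blast
  show "(\<lambda>w. xmon n a w * yfun n m k w) \<in> V" if "k \<in> {1..n}" using main that by blast
qed

text \<open>Quantifying over all monomials in the hypothesis makes the product case work: after one
  factor is absorbed, the new \<open>g\<close> satisfies the hypothesis again.\<close>

lemma xpolys_mult_mem:
  assumes "f \<in> xpolys n" "\<And>a. (\<lambda>w. xmon n a w * g w) \<in> V"
  shows "(\<lambda>w. xmon n a w * (f w * g w)) \<in> V"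
  using assms
proof (induction arbitrary: a g rule: xpolys.induct)
  case (const p)
  thus ?case using scale[OF const(1)] by (simp add: mult.left_commute)
next
  case (var i)
  show ?case
    using var(2)[of "\<lambda>l. a l + (if l = i then 1 else 0)"]
    by (simp add: xmon_add xmon_single[OF var(1)] mult.assoc)
next
  case (add f1 f2)
  from tuple_submodule.add[OF tuple_submodule_axioms add.IH(1)[OF add.prems] add.IH(2)[OF add.prems]]
  show ?case by (simp add: algebra_simps)
next
  case (mult f1 f2)
  from mult.IH(1)[OF mult.IH(2)[OF mult.prems]] show ?case by (simp add: mult.assoc)
qed

lemma gkm_carrier_mem:
  assumes "\<alpha> \<in> gkm_carrier n (hfun n m)"
  shows "\<alpha> \<in> V"
proof -
  obtain P Q where P: "P \<in> xpolys n" and Q: "\<forall>k\<in>{1..n}. Q k \<in> xpolys n"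
    and eq: "\<forall>w\<in>sym_group n. \<alpha> w = xy_tuple n A P Q w"
    using gkm_carrier_is_xy_generated[OF nm assms] unfolding xy_generated_def by auto
  have one: "xmon n (\<lambda>_. 0) w = 1" for w by (simp add: xmon_def)
  have "(\<lambda>w. P w + (\<Sum>k\<in>{1..n}. Q k w * yfun n m k w)) \<in> V"
  proof (intro add sum)
    show "P \<in> V" using xpolys_mult_mem[OF P, of "\<lambda>w. 1" "\<lambda>_. 0"] xmon_mem by (simp add: one)
    show "(\<lambda>w. Q k w * yfun n m k w) \<in> V" if "k \<in> {1..n}" for k
      using xpolys_mult_mem[of "Q k" "yfun n m k" "\<lambda>_. 0"] Q that xmon_yfun_mem[OF that] by (simp add: one)
  qed
  thus ?thesis
  proof (rule eq_on)
    fix w assume w: "w \<in> sym_group n"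
    have "(\<Sum>k\<in>{1..n}. Q k w * yfun n m k w) = Q (w n) w * (\<Prod>l\<in>A. tvar (w n) - tvar (w l))"
      by (rule sum_yfun[OF w]) (use nm in simp)
    thus "P w + (\<Sum>k\<in>{1..n}. Q k w * yfun n m k w) = \<alpha> w"
      using eq w by (simp add: xy_tuple_def mult.commute)
  qed
qed

end

section \<open>Cardinality and linear independence\<close>

text \<open>The factors run through \<open>1, ..., r\<close> and \<open>r, ..., n - 1\<close>, so
  \<open>r\<close> occurs twice.\<close>

lemma prod_shifted_eq:
  assumes "r < n"
  shows "(\<Prod>j\<in>{1..n}. if r < j then j - 1 else j) = r * fact (n - 1)"
proof -
  have "Suc r \<le> n" using assms by simp
  thus ?thesis
  proof (induction n rule: dec_induct)
    case base
    have "(\<Prod>j\<in>{1..r}. if r < j then j - 1 else j) = \<Prod>{1..r}" by (rule prod.cong) auto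
    thus ?case by (simp add: fact_prod)
  next
    case (step n)
    then obtain n' where "n = Suc n'" by (cases n) auto
    thus ?case using step by (simp add: algebra_simps)
  qed
qed

text \<open>Divisibility leaves \<open>j - 1\<close> instead of \<open>j\<close> choices for the
  exponent at each \<open>j > r\<close>.\<close>

lemma card_artin_not_divisible:
  assumes "r < n"
  shows "card {e \<in> (\<Pi>\<^sub>E j\<in>{1..n}. {0..j - 1}). \<not> (\<forall>l\<in>{r + 1..n}. 1 \<le> e l)} + r * fact (n - 1) = fact n"
proof -
  let ?P = "\<Pi>\<^sub>E j\<in>{1..n}. {0..j - 1}"
  let ?D = "\<Pi>\<^sub>E j\<in>{1..n}. if r < j then {1..j - 1} else {0..j - 1}"
  have fin: "finite ?P" by (rule finite_PiE) auto
  have D: "?D \<subseteq> ?P" by (rule PiE_mono) auto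
  have "e \<in> ?D \<longleftrightarrow> (\<forall>l\<in>{r + 1..n}. 1 \<le> e l)" if e: "e \<in> ?P" for e
  proof
    assume "e \<in> ?D"
    show "\<forall>l\<in>{r + 1..n}. 1 \<le> e l"
    proof
      fix l assume "l \<in> {r + 1..n}"
      thus "1 \<le> e l" using PiE_mem[OF \<open>e \<in> ?D\<close>, of l] by simp
    qed
  next
    assume pos: "\<forall>l\<in>{r + 1..n}. 1 \<le> e l"
    show "e \<in> ?D"
    proof (rule PiE_I)
      fix j assume "j \<in> {1..n}"
      thus "e j \<in> (if r < j then {1..j - 1} else {0..j - 1})" using PiE_mem[OF e, of j] pos by auto
    qed (rule PiE_arb[OF e])
  qed
  hence "{e \<in> ?P. \<not> (\<forall>l\<in>{r + 1..n}. 1 \<le> e l)} = ?P - ?D" by blast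
  hence "card {e \<in> ?P. \<not> (\<forall>l\<in>{r + 1..n}. 1 \<le> e l)} = card (?P - ?D)" by (rule arg_cong)
  moreover note card_subset_split[OF fin D]
  moreover have "card ?P = fact n"
    by (subst card_PiE) (auto simp: fact_prod intro!: prod.cong)
  moreover have "card ?D = (\<Prod>j\<in>{1..n}. if r < j then j - 1 else j)"
    by (subst card_PiE) (auto intro!: prod.cong)
  ultimately show ?thesis using prod_shifted_eq[OF assms] by linarith
qed

lemma finite_exps: "finite (exps_i n m)" "finite (exps_ii n m)"
  unfolding exps_i_def exps_ii_def
  by (rule finite_subset[OF Collect_restrict], rule finite_PiE; simp)+

text \<open>(i) loses \<open>(n-m)(n-1)!\<close> of \<open>n!\<close> monomials. (ii) keeps
  \<open>(n-1)! - (m-1)(n-2)!\<close> monomials when \<open>m < n\<close>, and \<open>n - 1\<close>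
  times this number is \<open>(n-m)(n-1)!\<close>.\<close>

lemma card_exps:
  assumes "2 \<le> n" "1 \<le> m" "m \<le> n"
  shows "card (exps_i n m) + card (exps_ii n m) * (n - 1) = fact n"
proof -
  have i: "card (exps_i n m) + (n - m) * fact (n - 1) = fact n"
  proof -
    have "exps_i n m = {e \<in> (\<Pi>\<^sub>E j\<in>{1..n}. {0..j - 1}). \<not> (\<forall>l\<in>{n - m + 1..n}. 1 \<le> e l)}"
      using exps_i_iff by blast
    thus ?thesis using card_artin_not_divisible[of "n - m" n] assms by simp
  qed
  have ii: "exps_ii n m = {e \<in> (\<Pi>\<^sub>E j\<in>{1..n - 1}. {0..j - 1}). \<not> (\<forall>j\<in>{m - 1 + 1..n - 1}. 1 \<le> e j)}"
  proof -
    have "(\<forall>l\<in>{1..n - m}. 1 \<le> e (n - l)) \<longleftrightarrow> (\<forall>j\<in>{m - 1 + 1..n - 1}. 1 \<le> e j)" for e :: "nat \<Rightarrow> nat"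
    proof -
      have "{m - 1 + 1..n - 1} = (\<lambda>l. n - l) ` {1..n - m}"
      proof (intro equalityI subsetI)
        fix j assume "j \<in> {m - 1 + 1..n - 1}"
        thus "j \<in> (\<lambda>l. n - l) ` {1..n - m}" using assms by (intro image_eqI[of _ _ "n - j"]) auto
      qed (use assms in auto)
      thus ?thesis by simp
    qed
    note eq = this
    have "1 \<le> n" using assms by simp
    thus ?thesis unfolding set_eq_iff mem_Collect_eq exps_ii_iff[OF \<open>1 \<le> n\<close> assms(2)] eq by blast
  qed
  obtain n' where n': "n = Suc (Suc n')" using assms(1) by (metis Suc_le_D numeral_2_eq_2 Suc_le_mono)
  obtain m' where m': "m = Suc m'" using assms(2) by (cases m) auto
  show ?thesis
  proof (cases "m = n")
    case True
    \<comment> \<open>For \<open>m = n\<close> the forbidden product in (ii) is empty and divides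
      everything; the counting lemma covers only \<open>m - 1 < n - 1\<close>.\<close>
    hence "exps_ii n m = {}" using ii assms by auto
    thus ?thesis using i True by simp
  next
    case False
    hence "card (exps_ii n m) + (m - 1) * fact (n - 1 - 1) = fact (n - 1)"
      unfolding ii using assms by (intro card_artin_not_divisible) auto
    hence "(card (exps_ii n m) + (m - 1) * fact n') * (n - 1) = fact (n - 1) * (n - 1)"
      by (simp add: n')
    hence "card (exps_ii n m) * (n - 1) + (m - 1) * fact (n - 1) = (n - 1) * fact (n - 1)"
      by (simp add: n' m' algebra_simps)
    moreover have "(m - 1) * fact (n - 1) + (n - m) * fact (n - 1) = (n - 1) * fact (n - 1)"
      using assms by (simp flip: add_mult_distrib)
    ultimately show ?thesis using i by linarith
  qed
qed

text \<open>\<open>C\<close> is a left inverse of the square matrix \<open>M\<close> up to the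
  factor \<open>\<Delta>\<close>, so \<open>det M\<close> is nonzero and the transposed matrix has
  no kernel.\<close>

lemma square_spanning_independent:
  fixes M :: "'i \<Rightarrow> 'w \<Rightarrow> 'a :: idom"
  assumes fin: "finite I" "finite W" and card: "card I = card W" and \<Delta>: "\<Delta> \<noteq> 0"
    and C: "\<And>w v. w \<in> W \<Longrightarrow> v \<in> W \<Longrightarrow> (\<Sum>i\<in>I. C w i * M i v) = (if w = v then \<Delta> else 0)"
    and p: "\<And>v. v \<in> W \<Longrightarrow> (\<Sum>i\<in>I. p i * M i v) = 0" and i: "i \<in> I"
  shows "p i = 0"
proof -
  define N where "N = card I"
  obtain f where f: "bij_betw f {0..<N} I" using ex_bij_betw_nat_finite[OF fin(1)] N_def by auto
  obtain g where g: "bij_betw g {0..<N} W" using ex_bij_betw_nat_finite[OF fin(2)] card N_def by auto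
  have gW: "g a \<in> W" if "a < N" for a using g that by (auto simp: bij_betw_def)
  have g_inj: "g a = g b \<longleftrightarrow> a = b" if "a < N" "b < N" for a b
    using g that by (auto simp: bij_betw_def inj_on_def)
  have reindex: "(\<Sum>a\<in>{0..<N}. q (f a)) = (\<Sum>i\<in>I. q i)" for q :: "'i \<Rightarrow> 'a"
    by (rule sum.reindex_bij_betw[OF f])
  define Mm where "Mm = mat N N (\<lambda>(a, b). M (f a) (g b))"
  define v where "v = vec N (\<lambda>a. p (f a))"
  define Cm where "Cm = mat N N (\<lambda>(a, b). C (g a) (f b))"
  have carr: "Mm \<in> carrier_mat N N" "Cm \<in> carrier_mat N N" by (auto simp: Mm_def Cm_def)
  have "Cm * Mm = \<Delta> \<cdot>\<^sub>m 1\<^sub>m N"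
  proof (rule eq_matI)
    fix a b assume "a < dim_row (\<Delta> \<cdot>\<^sub>m 1\<^sub>m N)" "b < dim_col (\<Delta> \<cdot>\<^sub>m 1\<^sub>m N)"
    hence ab: "a < N" "b < N" by auto
    have "(Cm * Mm) $$ (a, b) = (\<Sum>c\<in>{0..<N}. C (g a) (f c) * M (f c) (g b))"
      using ab by (auto simp: Mm_def Cm_def scalar_prod_def intro!: sum.cong)
    also have "\<dots> = (\<Sum>i\<in>I. C (g a) i * M i (g b))"
      by (rule reindex[of "\<lambda>i. C (g a) i * M i (g b)"])
    also have "\<dots> = (if a = b then \<Delta> else 0)" using C[OF gW gW] ab g_inj by simp
    finally show "(Cm * Mm) $$ (a, b) = (\<Delta> \<cdot>\<^sub>m 1\<^sub>m N) $$ (a, b)" using ab by simp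
  qed (auto simp: Mm_def Cm_def)
  hence "det Cm * det Mm = \<Delta> ^ N" using det_mult[OF carr(2,1)] by simp
  hence "det (transpose_mat Mm) \<noteq> 0" using \<Delta> det_transpose[OF carr(1)] by auto
  moreover have "transpose_mat Mm \<in> carrier_mat N N" using carr by simp
  moreover have "v \<in> carrier_vec N" by (simp add: v_def)
  moreover have "transpose_mat Mm *\<^sub>v v = 0\<^sub>v N"
  proof (rule eq_vecI)
    fix b assume "b < dim_vec (0\<^sub>v N)"
    hence b: "b < N" by simp
    have "(transpose_mat Mm *\<^sub>v v) $ b = (\<Sum>a\<in>{0..<N}. p (f a) * M (f a) (g b))"
      using b by (auto simp: Mm_def v_def scalar_prod_def mult.commute intro!: sum.cong)
    also have "\<dots> = 0" using reindex[of "\<lambda>i. p i * M i (g b)"] p[OF gW[OF b]] by simp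
    finally show "(transpose_mat Mm *\<^sub>v v) $ b = 0\<^sub>v N $ b" using b by simp
  qed (auto simp: Mm_def)
  ultimately have "v = 0\<^sub>v N" using det_0_iff_vec_prod_zero[of "transpose_mat Mm" N] by blast
  moreover obtain a where "a < N" "f a = i" using f i by (auto simp: bij_betw_def)
  ultimately show ?thesis unfolding v_def by (metis index_vec index_zero_vec(1))
qed

section \<open>The lifts as a free generating family\<close>

type_synonym hess_index = "(nat \<Rightarrow> nat) + (nat \<Rightarrow> nat) \<times> nat"

text \<open>A disjoint sum, so that independence of the family also shows that the listed elements
  are distinct.\<close>

definition hess_indices :: "nat \<Rightarrow> nat \<Rightarrow> hess_index set" where
  "hess_indices n m = exps_i n m <+> exps_ii n m \<times> {1..n - 1}"

definition hess_lift :: "nat \<Rightarrow> nat \<Rightarrow> hess_index \<Rightarrow> tuple" where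
  "hess_lift n m = case_sum (xmon n) (\<lambda>(e, k) w.
     (\<Prod>j = 1..n - 1. tvar (w (n - j)) ^ e j) * (yfun n m (k + 1) w - yfun n m 1 w))"

lemma finite_hess_indices: "finite (hess_indices n m)"
  by (simp add: hess_indices_def finite_exps)

lemma finite_sym_group: "finite (sym_group n)"
  unfolding sym_group_def by (rule finite_permutations) simp

locale hess_params =
  fixes n m :: nat
  assumes nm: "2 \<le> n" "1 \<le> m" "m \<le> n"
begin

lemma card_hess_indices: "card (hess_indices n m) = card (sym_group n)"
  using card_exps[OF nm] card_permutations[of "{1..n}" n]
  by (simp add: hess_indices_def card_Plus finite_exps sym_group_def)

lemma gkm_carrier_lift_combination:
  assumes "\<alpha> \<in> gkm_carrier n (hfun n m)"
  shows "\<exists>c. (\<forall>i\<in>hess_indices n m. c i \<in> polys n) \<and>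
    (\<forall>w\<in>sym_group n. \<alpha> w = (\<Sum>i\<in>hess_indices n m. c i * hess_lift n m i w))"
proof -
  let ?I = "hess_indices n m" and ?b = "hess_lift n m"
  define V where "V = {f. \<exists>c. (\<forall>i\<in>?I. c i \<in> polys n) \<and> (\<forall>w\<in>sym_group n. f w = (\<Sum>i\<in>?I. c i * ?b i w))}"
  have b: "?b i \<in> V" if "i \<in> ?I" for i
  proof -
    have "?b i w = (\<Sum>l\<in>?I. (if l = i then 1 else 0) * ?b l w)" for w
    proof -
      have "(\<Sum>l\<in>?I. (if l = i then 1 else 0) * ?b l w) = (\<Sum>l\<in>?I. if l = i then ?b l w else 0)"
        by (rule sum.cong) auto
      thus ?thesis using that finite_hess_indices[of n m] by simp
    qed
    thus ?thesis unfolding V_def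
      by (intro CollectI exI[of _ "\<lambda>l. if l = i then 1 else 0"]) (auto simp: polys_closed)
  qed
  interpret tuple_submodule n V
  proof
    show "(\<lambda>w. 0) \<in> V" unfolding V_def by (auto intro!: exI[of _ "\<lambda>_. 0"] simp: polys_closed)
    fix f g assume "f \<in> V" "g \<in> V"
    then obtain c d where "\<forall>i\<in>?I. c i \<in> polys n" "\<forall>w\<in>sym_group n. f w = (\<Sum>i\<in>?I. c i * ?b i w)"
      "\<forall>i\<in>?I. d i \<in> polys n" "\<forall>w\<in>sym_group n. g w = (\<Sum>i\<in>?I. d i * ?b i w)"
      unfolding V_def by auto
    thus "(\<lambda>w. f w + g w) \<in> V" unfolding V_def
      by (intro CollectI exI[of _ "\<lambda>i. c i + d i"]) (auto simp: polys_closed distrib_right sum.distrib)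
  next
    fix p f assume "p \<in> polys n" "f \<in> V"
    then obtain c where "\<forall>i\<in>?I. c i \<in> polys n" "\<forall>w\<in>sym_group n. f w = (\<Sum>i\<in>?I. c i * ?b i w)"
      unfolding V_def by auto
    thus "(\<lambda>w. p * f w) \<in> V" unfolding V_def using \<open>p \<in> polys n\<close>
      by (intro CollectI exI[of _ "\<lambda>i. p * c i"]) (auto simp: polys_closed sum_distrib_left mult.assoc)
  next
    fix f g assume "f \<in> V" "\<And>w. w \<in> sym_group n \<Longrightarrow> f w = g w"
    thus "g \<in> V" unfolding V_def by auto
  qed
  interpret hess_submodule n V m
  proof
    show "2 \<le> n" "1 \<le> m" "m \<le> n" by (fact nm)+
    show "xmon n e \<in> V" if "e \<in> exps_i n m" for e
      using b[of "Inl e"] that by (simp add: hess_indices_def hess_lift_def InlI)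
    show "(\<lambda>w. (\<Prod>j = 1..n - 1. tvar (w (n - j)) ^ e j) * (yfun n m (k + 1) w - yfun n m 1 w)) \<in> V"
      if "e \<in> exps_ii n m" "k \<in> {1..n - 1}" for e k
      using b[of "Inr (e, k)", unfolded hess_indices_def, OF InrI[OF SigmaI[OF that]]]
      by (simp add: hess_lift_def)
  qed
  show ?thesis using gkm_carrier_mem[OF assms] unfolding V_def by blast
qed

lemma hess_lift_independent:
  assumes "\<And>w. w \<in> sym_group n \<Longrightarrow> (\<Sum>i\<in>hess_indices n m. p i * hess_lift n m i w) = 0"
    and "i \<in> hess_indices n m"
  shows "p i = 0"
proof -
  \<comment> \<open>Ordered pairs: each difference occurs with both signs, so every edge label
    divides \<open>\<Delta>\<close> without a discussion of signs.\<close>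
  let ?D = "{(a, b). a \<in> {1..n} \<and> b \<in> {1..n} \<and> a \<noteq> b}"
  define \<Delta> where "\<Delta> = (\<Prod>(a, b)\<in>?D. tvar a - tvar b)"
  have finD: "finite ?D" by (rule finite_subset[of _ "{1..n} \<times> {1..n}"]) auto
  have poly: "(\<Prod>(a, b)\<in>D. tvar a - tvar b) \<in> polys n" if "D \<subseteq> ?D" for D
    by (rule polys_prod) (use that in \<open>auto intro!: polys_closed tvar_in_polys\<close>)
  have dvd: "poly_divides n (tvar a - tvar b) \<Delta>" if "a \<in> {1..n}" "b \<in> {1..n}" "a \<noteq> b" for a b
  proof -
    have "\<Delta> = (tvar a - tvar b) * (\<Prod>(a, b)\<in>?D - {(a, b)}. tvar a - tvar b)"
      unfolding \<Delta>_def using prod.remove[OF finD, of "(a, b)" "\<lambda>(a, b). tvar a - tvar b"] that by simp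
    thus ?thesis unfolding poly_divides_def using poly[of "?D - {(a, b)}"] by blast
  qed
  have "\<Delta> \<noteq> 0" using finD by (auto simp: \<Delta>_def prod_zero_iff)
  have mem: "(\<lambda>v\<in>sym_group n. if w = v then \<Delta> else 0) \<in> gkm_carrier n (hfun n m)" for w
  proof (rule gkm_carrierI)
    fix v i j assume a: "v \<in> sym_group n" "i \<in> {1..n}" "j \<in> {1..n}" "i < j"
    have d: "poly_divides n (tvar (v i) - tvar (v j)) \<Delta>"
      using a sym_group_range[OF a(1)] sym_group_inj[OF a(1), of i j] by (intro dvd) auto
    show "poly_divides n (tvar (v i) - tvar (v j))
       ((if w = v then \<Delta> else 0) - (if w = v \<circ> transpose i j then \<Delta> else 0))"
      by (intro poly_divides_diff) (simp_all add: d poly_divides_closed)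
  qed (use poly[of ?D] hfun_le in \<open>auto simp: \<Delta>_def polys_closed\<close>)
  have "\<exists>c. \<forall>v\<in>sym_group n. (\<Sum>i\<in>hess_indices n m. c i * hess_lift n m i v) = (if w = v then \<Delta> else 0)" for w
  proof -
    obtain c where c: "\<forall>v\<in>sym_group n. (\<lambda>v\<in>sym_group n. if w = v then \<Delta> else 0) v =
        (\<Sum>i\<in>hess_indices n m. c i * hess_lift n m i v)"
      using gkm_carrier_lift_combination[OF mem[of w]] by blast
    show ?thesis
    proof (intro exI ballI)
      fix v assume v: "v \<in> sym_group n"
      from c[rule_format, OF v, symmetric] v
      show "(\<Sum>i\<in>hess_indices n m. c i * hess_lift n m i v) = (if w = v then \<Delta> else 0)" by simp
    qed
  qed
  hence "\<forall>w. \<exists>c. \<forall>v\<in>sym_group n.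
      (\<Sum>i\<in>hess_indices n m. c i * hess_lift n m i v) = (if w = v then \<Delta> else 0)" by blast
  from choice[OF this] obtain C where "\<forall>w. \<forall>v\<in>sym_group n.
      (\<Sum>i\<in>hess_indices n m. C w i * hess_lift n m i v) = (if w = v then \<Delta> else 0)" by blast
  thus ?thesis
    using square_spanning_independent[OF finite_hess_indices finite_sym_group card_hess_indices
        \<open>\<Delta> \<noteq> 0\<close>, of C "hess_lift n m" p i] assms by blast
qed

end

section \<open>Passage to the quotient\<close>

definition aug_ideal :: "nat \<Rightarrow> cpoly set" where
  "aug_ideal n = {p. \<exists>q. (\<forall>i\<in>{1..n}. q i \<in> polys n) \<and> p = (\<Sum>i\<in>{1..n}. tvar i * q i)}"

lemma aug_ideal_closed:
  shows aug_ideal_zero: "0 \<in> aug_ideal n"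
    and aug_ideal_add: "p \<in> aug_ideal n \<Longrightarrow> q \<in> aug_ideal n \<Longrightarrow> p + q \<in> aug_ideal n"
    and aug_ideal_mult: "r \<in> polys n \<Longrightarrow> p \<in> aug_ideal n \<Longrightarrow> r * p \<in> aug_ideal n"
    and aug_ideal_tvar: "j \<in> {1..n} \<Longrightarrow> tvar j \<in> aug_ideal n"
proof -
  show "0 \<in> aug_ideal n" unfolding aug_ideal_def by (auto intro!: exI[of _ "\<lambda>_. 0"] simp: polys_closed)
  show "p + q \<in> aug_ideal n" if pq: "p \<in> aug_ideal n" "q \<in> aug_ideal n" for p q
  proof -
    obtain f g where "\<forall>i\<in>{1..n}. f i \<in> polys n" "p = (\<Sum>i\<in>{1..n}. tvar i * f i)"
      "\<forall>i\<in>{1..n}. g i \<in> polys n" "q = (\<Sum>i\<in>{1..n}. tvar i * g i)"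
      using pq unfolding aug_ideal_def by blast
    thus ?thesis unfolding aug_ideal_def
      by (intro CollectI exI[of _ "\<lambda>i. f i + g i"]) (auto simp: polys_closed distrib_left sum.distrib)
  qed
  show "r * p \<in> aug_ideal n" if rp: "r \<in> polys n" "p \<in> aug_ideal n" for r p
  proof -
    obtain f where "\<forall>i\<in>{1..n}. f i \<in> polys n" "p = (\<Sum>i\<in>{1..n}. tvar i * f i)"
      using rp unfolding aug_ideal_def by blast
    thus ?thesis unfolding aug_ideal_def using rp(1)
      by (intro CollectI exI[of _ "\<lambda>i. r * f i"]) (auto simp: polys_closed sum_distrib_left mult.left_commute)
  qed
  show "tvar j \<in> aug_ideal n" if "j \<in> {1..n}"
  proof -
    have "(\<Sum>i\<in>{1..n}. tvar i * (if i = j then 1 else 0)) = (\<Sum>i\<in>{1..n}. if i = j then tvar i else 0)"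
      by (rule sum.cong) auto
    hence "tvar j = (\<Sum>i\<in>{1..n}. tvar i * (if i = j then 1 else 0))" using that by simp
    thus ?thesis unfolding aug_ideal_def
      by (intro CollectI exI[of _ "\<lambda>i. if i = j then 1 else 0"]) (auto simp: polys_closed)
  qed
qed

lemma polys_minus_const_in_aug_ideal:
  assumes "p \<in> polys n"
  shows "\<exists>c. p - tconst c \<in> aug_ideal n"
  using assms
proof (induction rule: polys_induct)
  case (const c)
  show ?case by (rule exI[of _ c]) (simp add: aug_ideal_zero)
next
  case (tvar i)
  show ?case using aug_ideal_tvar[OF tvar] by (intro exI[of _ 0]) (simp add: tconst_simps)
next
  case (add p q)
  then obtain c d where "p - tconst c \<in> aug_ideal n" "q - tconst d \<in> aug_ideal n" by blast
  from aug_ideal_add[OF this] show ?case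
    by (intro exI[of _ "c + d"]) (simp add: tconst_simps algebra_simps)
next
  case (mult p q)
  then obtain c d where cd: "p - tconst c \<in> aug_ideal n" "q - tconst d \<in> aug_ideal n" by blast
  have "q * (p - tconst c) + tconst c * (q - tconst d) \<in> aug_ideal n"
    by (intro aug_ideal_add aug_ideal_mult cd polys_closed mult)
  thus ?case by (intro exI[of _ "c * d"]) (simp add: tconst_simps algebra_simps)
qed

text \<open>A multiple of a variable has constant term 0.\<close>

lemma tconst_in_aug_idealD:
  assumes "tconst c \<in> aug_ideal n"
  shows "c = 0"
proof -
  obtain q where q: "tconst c = (\<Sum>i\<in>{1..n}. tvar i * q i)" using assms by (auto simp: aug_ideal_def)
  have "Poly_Mapping.lookup (tvar i * r) 0 = 0" for i r
  proof (rule ccontr)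
    assume "Poly_Mapping.lookup (tvar i * r) 0 \<noteq> 0"
    hence "0 \<in> Poly_Mapping.keys (tvar i * r)" by (simp add: in_keys_iff)
    then obtain b where "0 = Poly_Mapping.single i (1::nat) + b"
      using keys_mult[of "tvar i" r] by (auto simp: tvar_def)
    hence "Poly_Mapping.lookup (Poly_Mapping.single i (1::nat) + b) i = 0" by (metis lookup_zero)
    thus False by (simp add: lookup_add)
  qed
  hence "Poly_Mapping.lookup (tconst c) 0 = 0" unfolding q by (simp add: lookup_sum)
  thus ?thesis by (simp add: tconst_def)
qed

section \<open>Calculus of classes for unrestricted representatives\<close>

definition is_gkm :: "nat \<Rightarrow> nat \<Rightarrow> tuple \<Rightarrow> bool" where
  "is_gkm n m f \<longleftrightarrow> restrict f (sym_group n) \<in> gkm_carrier n (hfun n m)"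

definition in_t_ideal :: "nat \<Rightarrow> nat \<Rightarrow> tuple \<Rightarrow> bool" where
  "in_t_ideal n m f \<longleftrightarrow> restrict f (sym_group n) \<in> t_ideal n (hfun n m)"

definition tuple_class :: "nat \<Rightarrow> nat \<Rightarrow> tuple \<Rightarrow> tuple set" where
  "tuple_class n m f = hess_class n (hfun n m) (restrict f (sym_group n))"

context hess_params
begin

abbreviation "S \<equiv> sym_group n"
abbreviation "G \<equiv> gkm_ring n (hfun n m)"
abbreviation "H \<equiv> hess_cohomology n (hfun n m)"
abbreviation "T \<equiv> t_ideal n (hfun n m)"
abbreviation "cls \<equiv> tuple_class n m"
abbreviation "gkm \<equiv> is_gkm n m"
abbreviation "inT \<equiv> in_t_ideal n m"

interpretation G: cring G by (rule cring_gkm_ring[OF hfun_le])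
interpretation T: ideal T G by (rule t_ideal[OF hfun_le])
interpretation H: cring H by (rule cring_hess_cohomology[OF hfun_le])
interpretation VS: vectorspace class_ring H by (rule vectorspace_hess_cohomology[OF hfun_le])

lemma gkm_intros:
  shows gkm_const': "p \<in> polys n \<Longrightarrow> gkm (\<lambda>w. p)"
    and gkm_add': "gkm f \<Longrightarrow> gkm g \<Longrightarrow> gkm (\<lambda>w. f w + g w)"
    and gkm_mult': "gkm f \<Longrightarrow> gkm g \<Longrightarrow> gkm (\<lambda>w. f w * g w)"
    and gkm_uminus': "gkm f \<Longrightarrow> gkm (\<lambda>w. - f w)"
  unfolding is_gkm_def
  using gkm_const[OF hfun_le[of _ n m]]
    gkm_add[OF hfun_le[of _ n m], where \<alpha> = "restrict f S" and \<beta> = "restrict g S"]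
    gkm_mult[OF hfun_le[of _ n m], where \<alpha> = "restrict f S" and \<beta> = "restrict g S"]
    gkm_uminus[OF hfun_le[of _ n m], where \<alpha> = "restrict f S"]
  by (simp_all cong: restrict_cong)

lemma gkm_diff': "gkm f \<Longrightarrow> gkm g \<Longrightarrow> gkm (\<lambda>w. f w - g w)"
  using gkm_add'[OF _ gkm_uminus', of f g] by simp

lemma gkm_power: "gkm f \<Longrightarrow> gkm (\<lambda>w. f w ^ k)"
  by (induction k) (auto intro: gkm_const' gkm_mult' polys_closed)

lemma gkm_prod: "(\<And>j. j \<in> A \<Longrightarrow> gkm (f j)) \<Longrightarrow> gkm (\<lambda>w. \<Prod>j\<in>A. f j w)"
  by (induction A rule: infinite_finite_induct) (auto intro: gkm_const' gkm_mult' polys_closed)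

lemma gkm_sum: "(\<And>j. j \<in> A \<Longrightarrow> gkm (f j)) \<Longrightarrow> gkm (\<lambda>w. \<Sum>j\<in>A. f j w)"
  by (induction A rule: infinite_finite_induct) (auto intro: gkm_const' gkm_add' polys_closed)

lemma gkm_carrier: "gkm f \<Longrightarrow> restrict f S \<in> carrier G"
  by (simp add: gkm_ring_def is_gkm_def)

lemma gkm_restrict: "\<alpha> \<in> gkm_carrier n (hfun n m) \<Longrightarrow> restrict \<alpha> S = \<alpha>"
  by (auto simp: fun_eq_iff gkm_carrierD(2) restrict_def)

lemma gkm_carrier_gkm: "\<alpha> \<in> gkm_carrier n (hfun n m) \<Longrightarrow> gkm \<alpha>"
  by (simp add: is_gkm_def gkm_restrict)

lemma gkm_ring_ops:
  "restrict f S \<oplus>\<^bsub>G\<^esub> restrict g S = restrict (\<lambda>w. f w + g w) S"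
  "restrict f S \<otimes>\<^bsub>G\<^esub> restrict g S = restrict (\<lambda>w. f w * g w) S"
  "c \<odot>\<^bsub>G\<^esub> restrict f S = restrict (\<lambda>w. tconst c * f w) S"
  by (simp_all add: gkm_ring_def cong: restrict_cong)

lemma hess_ops:
  "carrier H = carrier (G Quot T)" "mult H = mult (G Quot T)" "one H = one (G Quot T)"
  "zero H = zero (G Quot T)" "add H = add (G Quot T)"
  by (simp_all add: hess_cohomology_def Let_def)

lemma cls_carrier: "gkm f \<Longrightarrow> cls f \<in> carrier H"
  using gkm_carrier[of f] unfolding tuple_class_def hess_ops hess_class_def FactRing_def A_RCOSETS_def' by auto

lemma carrier_cls: "X \<in> carrier H \<Longrightarrow> \<exists>f. gkm f \<and> X = cls f"
proof -
  assume "X \<in> carrier H"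
  then obtain \<alpha> where \<alpha>: "\<alpha> \<in> carrier G" "X = hess_class n (hfun n m) \<alpha>"
    unfolding hess_ops hess_class_def FactRing_def A_RCOSETS_def' by auto
  thus ?thesis
    by (intro exI[of _ \<alpha>]) (simp add: gkm_ring_def gkm_carrier_gkm gkm_restrict tuple_class_def)
qed

lemma cls_add: "gkm f \<Longrightarrow> gkm g \<Longrightarrow> cls f \<oplus>\<^bsub>H\<^esub> cls g = cls (\<lambda>w. f w + g w)"
  using T.a_rcos_sum[OF gkm_carrier gkm_carrier, of f g]
  by (simp add: hess_ops FactRing_def hess_class_def tuple_class_def gkm_ring_ops)

lemma cls_mult: "gkm f \<Longrightarrow> gkm g \<Longrightarrow> cls f \<otimes>\<^bsub>H\<^esub> cls g = cls (\<lambda>w. f w * g w)"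
  using T.rcoset_mult_add[OF gkm_carrier gkm_carrier, of f g]
  by (simp add: hess_ops FactRing_def hess_class_def tuple_class_def gkm_ring_ops)

lemma cls_one: "\<one>\<^bsub>H\<^esub> = cls (\<lambda>w. 1)"
  by (simp add: hess_ops FactRing_def hess_class_def tuple_class_def) (simp add: gkm_ring_def)

lemma cls_smult: "gkm f \<Longrightarrow> c \<odot>\<^bsub>H\<^esub> cls f = cls (\<lambda>w. tconst c * f w)"
  using hess_smult_class[OF hfun_le[of _ n m], where \<alpha> = "restrict f S" and c = c]
  by (simp add: gkm_ring_ops is_gkm_def tuple_class_def)

lemma cls_eq_zero_iff:
  assumes "gkm f"
  shows "cls f = \<zero>\<^bsub>H\<^esub> \<longleftrightarrow> inT f"
proof -
  have z: "\<zero>\<^bsub>H\<^esub> = T" by (simp add: hess_ops FactRing_def)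
  show ?thesis
  proof
    assume "cls f = \<zero>\<^bsub>H\<^esub>"
    moreover have "restrict f S \<in> cls f"
      unfolding tuple_class_def hess_class_def by (rule T.a_rcos_self[OF gkm_carrier[OF assms]])
    ultimately show "inT f" using z by (simp add: in_t_ideal_def)
  next
    assume "inT f"
    thus "cls f = \<zero>\<^bsub>H\<^esub>" unfolding z tuple_class_def hess_class_def in_t_ideal_def by (rule T.a_rcos_const)
  qed
qed

lemma cls_zero: "cls (\<lambda>w. 0) = \<zero>\<^bsub>H\<^esub>"
proof -
  have "restrict (\<lambda>w. 0) S = \<zero>\<^bsub>G\<^esub>" by (simp add: gkm_ring_def)
  moreover have "\<zero>\<^bsub>G\<^esub> \<in> T" by (rule T.zero_closed)
  ultimately show ?thesis using cls_eq_zero_iff[OF gkm_const'[OF polys_closed(1)]] by (simp add: in_t_ideal_def)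
qed

lemma cls_eqI:
  assumes "gkm f" "gkm g" "inT (\<lambda>w. f w - g w)"
  shows "cls f = cls g"
proof -
  have "cls f = cls (\<lambda>w. f w - g w) \<oplus>\<^bsub>H\<^esub> cls g"
    using cls_add[OF gkm_diff'[OF assms(1,2)] assms(2)] by simp
  also have "cls (\<lambda>w. f w - g w) = \<zero>\<^bsub>H\<^esub>" using cls_eq_zero_iff[OF gkm_diff'[OF assms(1,2)]] assms(3) by simp
  finally show ?thesis using cls_carrier[OF assms(2)] by simp
qed

lemma cls_diff:
  assumes "gkm f" "gkm g"
  shows "cls f \<ominus>\<^bsub>H\<^esub> cls g = cls (\<lambda>w. f w - g w)"
proof -
  note c = cls_carrier[OF assms(1)] cls_carrier[OF assms(2)] cls_carrier[OF gkm_diff'[OF assms]]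
  have "cls f = cls (\<lambda>w. f w - g w) \<oplus>\<^bsub>H\<^esub> cls g"
    using cls_add[OF gkm_diff'[OF assms] assms(2)] by simp
  thus ?thesis using c by (simp add: a_minus_def H.a_assoc H.r_neg)
qed

lemma cls_power: "gkm f \<Longrightarrow> cls f [^]\<^bsub>H\<^esub> (k::nat) = cls (\<lambda>w. f w ^ k)"
proof (induction k)
  case 0
  thus ?case by (simp add: cls_one)
next
  case (Suc k)
  thus ?case using cls_mult[OF gkm_power[of f k] Suc.prems] by (simp add: mult.commute)
qed

lemma cls_prod:
  assumes "finite A" "\<And>j. j \<in> A \<Longrightarrow> gkm (f j)"
  shows "(\<Otimes>\<^bsub>H\<^esub>j\<in>A. cls (f j)) = cls (\<lambda>w. \<Prod>j\<in>A. f j w)"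
  using assms
proof (induction A rule: finite_induct)
  case empty
  thus ?case by (simp add: cls_one)
next
  case (insert a A)
  have "(\<Otimes>\<^bsub>H\<^esub>j\<in>insert a A. cls (f j)) = cls (f a) \<otimes>\<^bsub>H\<^esub> (\<Otimes>\<^bsub>H\<^esub>j\<in>A. cls (f j))"
    using insert by (intro H.finprod_insert) (auto intro: cls_carrier)
  also have "\<dots> = cls (\<lambda>w. f a w * (\<Prod>j\<in>A. f j w))"
    using insert by (subst insert.IH) (auto intro!: cls_mult gkm_prod)
  finally show ?case using insert.hyps by simp
qed

lemma cls_lincomb:
  assumes "finite A" "\<And>j. j \<in> A \<Longrightarrow> gkm (f j)"
  shows "(\<Oplus>\<^bsub>H\<^esub>j\<in>A. c j \<odot>\<^bsub>H\<^esub> cls (f j)) = cls (\<lambda>w. \<Sum>j\<in>A. tconst (c j) * f j w)"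
  using assms
proof (induction A rule: finite_induct)
  case empty
  thus ?case by (simp add: cls_zero)
next
  case (insert a A)
  have gk: "gkm (\<lambda>w. tconst (c j) * f j w)" if "j \<in> insert a A" for j
    using insert.prems[OF that] by (intro gkm_mult' gkm_const' polys_closed)
  have car: "c j \<odot>\<^bsub>H\<^esub> cls (f j) \<in> carrier H" if "j \<in> insert a A" for j
    using cls_smult[OF insert.prems[OF that]] cls_carrier[OF gk[OF that]] by simp
  have "(\<Oplus>\<^bsub>H\<^esub>j\<in>insert a A. c j \<odot>\<^bsub>H\<^esub> cls (f j)) = c a \<odot>\<^bsub>H\<^esub> cls (f a) \<oplus>\<^bsub>H\<^esub> (\<Oplus>\<^bsub>H\<^esub>j\<in>A. c j \<odot>\<^bsub>H\<^esub> cls (f j))"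
    using insert.hyps car by (intro H.finsum_insert) auto
  also have "\<dots> = cls (\<lambda>w. tconst (c a) * f a w + (\<Sum>j\<in>A. tconst (c j) * f j w))"
    using insert gk by (subst insert.IH) (auto simp: cls_smult intro!: cls_add gkm_sum)
  finally show ?case using insert.hyps by simp
qed

lemma T_add: "inT f \<Longrightarrow> inT g \<Longrightarrow> inT (\<lambda>w. f w + g w)"
  using T.a_closed[of "restrict f S" "restrict g S"] by (simp add: gkm_ring_ops in_t_ideal_def)

lemma T_mult: "gkm f \<Longrightarrow> inT g \<Longrightarrow> inT (\<lambda>w. f w * g w)"
  using T.I_l_closed[of "restrict g S" "restrict f S"] gkm_carrier[of f]
  by (simp add: gkm_ring_ops in_t_ideal_def)

lemma T_sum: "(\<And>j. j \<in> A \<Longrightarrow> inT (f j)) \<Longrightarrow> inT (\<lambda>w. \<Sum>j\<in>A. f j w)"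
proof (induction A rule: infinite_finite_induct)
  case (insert a A)
  thus ?case using T_add[of "f a" "\<lambda>w. \<Sum>j\<in>A. f j w"] by simp
qed (use cls_eq_zero_iff[OF gkm_const'[OF polys_closed(1)]] cls_zero in simp_all)

lemma aug_ideal_in_T:
  assumes "p \<in> aug_ideal n" "gkm f"
  shows "inT (\<lambda>w. p * f w)"
proof -
  obtain q where q: "\<forall>i\<in>{1..n}. q i \<in> polys n" "p = (\<Sum>i\<in>{1..n}. tvar i * q i)"
    using assms by (auto simp: aug_ideal_def)
  have t: "inT (\<lambda>w. tvar i)" if "i \<in> {1..n}" for i
  proof -
    have "(\<lambda>i. \<lambda>w\<in>S. tvar i) ` {1..n} \<subseteq> carrier G"
      using gkm_const' tvar_in_polys gkm_carrier by blast
    from G.genideal_self[OF this] show ?thesis unfolding in_t_ideal_def t_ideal_def using that by blast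
  qed
  have "inT (\<lambda>w. \<Sum>i\<in>{1..n}. (q i * f w) * tvar i)"
    using q(1) assms(2) t by (intro T_sum T_mult gkm_mult' gkm_const') auto
  moreover have "(\<Sum>i\<in>{1..n}. (q i * f w) * tvar i) = p * f w" for w
    unfolding q(2) sum_distrib_right by (simp add: mult_ac)
  ultimately show ?thesis by simp
qed

lemma gkm_yfun: "k \<in> {1..n} \<Longrightarrow> gkm (yfun n m k)"
  using y_tuple_in_gkm[OF nm(2,3)]
  by (simp add: y_tuple_def yfun_def[abs_def] gkm_ring_def is_gkm_def)

lemma gkm_x: "k \<in> {1..n} \<Longrightarrow> gkm (\<lambda>w. tvar (w k))"
  using x_tuple_in_gkm[of k n m] by (simp add: x_tuple_def gkm_ring_def is_gkm_def)

lemma gkm_hess_lift: "i \<in> hess_indices n m \<Longrightarrow> gkm (hess_lift n m i)"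
proof (cases i)
  case (Inl e)
  have "gkm (xmon n e)" unfolding xmon_def by (intro gkm_prod gkm_power gkm_x)
  thus ?thesis by (simp add: Inl hess_lift_def)
next
  case (Inr r)
  assume "i \<in> hess_indices n m"
  then obtain e k where r: "r = (e, k)" "k \<in> {1..n - 1}" by (auto simp: Inr hess_indices_def)
  have "gkm (\<lambda>w. (\<Prod>j = 1..n - 1. tvar (w (n - j)) ^ e j) * (yfun n m (k + 1) w - yfun n m 1 w))"
    using r nm by (intro gkm_mult' gkm_prod gkm_power gkm_x gkm_diff' gkm_yfun) auto
  thus ?thesis by (simp add: Inr r(1) hess_lift_def)
qed

lemma elem_i_eq: "elem_i n m e = cls (hess_lift n m (Inl e))"
proof -
  have "elem_i n m e = (\<Otimes>\<^bsub>H\<^esub>j\<in>{1..n}. cls (\<lambda>w. tvar (w j)) [^]\<^bsub>H\<^esub> e j)"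
    by (simp add: elem_i_def Let_def x_class_def x_tuple_def tuple_class_def)
  also have "\<dots> = (\<Otimes>\<^bsub>H\<^esub>j\<in>{1..n}. cls (\<lambda>w. tvar (w j) ^ e j))"
    by (rule H.finprod_cong') (auto simp: cls_power gkm_x intro!: cls_carrier gkm_power)
  also have "\<dots> = cls (\<lambda>w. \<Prod>j\<in>{1..n}. tvar (w j) ^ e j)"
    by (intro cls_prod gkm_power gkm_x) auto
  finally show ?thesis by (simp add: hess_lift_def xmon_def[abs_def])
qed

lemma elem_ii_eq:
  assumes "k \<in> {1..n - 1}"
  shows "elem_ii n m (e, k) = cls (hess_lift n m (Inr (e, k)))"
proof -
  let ?A = "{1..n - 1}"
  have A: "n - j \<in> {1..n}" if "j \<in> ?A" for j using that by auto
  have "(\<Otimes>\<^bsub>H\<^esub>j\<in>?A. cls (\<lambda>w. tvar (w (n - j))) [^]\<^bsub>H\<^esub> e j) = (\<Otimes>\<^bsub>H\<^esub>j\<in>?A. cls (\<lambda>w. tvar (w (n - j)) ^ e j))"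
    using A by (intro H.finprod_cong') (auto simp: cls_power gkm_x intro!: cls_carrier gkm_power)
  also have "\<dots> = cls (\<lambda>w. \<Prod>j\<in>?A. tvar (w (n - j)) ^ e j)"
    using A by (intro cls_prod gkm_power gkm_x) auto
  finally have 1: "(\<Otimes>\<^bsub>H\<^esub>j\<in>?A. cls (\<lambda>w. tvar (w (n - j))) [^]\<^bsub>H\<^esub> e j) = \<dots>" .
  have k: "k + 1 \<in> {1..n}" "1 \<in> {1..n}" using assms nm by auto
  have "elem_ii n m (e, k) = (\<Otimes>\<^bsub>H\<^esub>j\<in>?A. cls (\<lambda>w. tvar (w (n - j))) [^]\<^bsub>H\<^esub> e j)
      \<otimes>\<^bsub>H\<^esub> (cls (yfun n m (k + 1)) \<ominus>\<^bsub>H\<^esub> cls (yfun n m 1))"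
    by (simp add: elem_ii_def Let_def x_class_def x_tuple_def y_class_def y_tuple_def yfun_def[abs_def] tuple_class_def)
  also have "\<dots> = cls (\<lambda>w. (\<Prod>j\<in>?A. tvar (w (n - j)) ^ e j) * (yfun n m (k + 1) w - yfun n m 1 w))"
    unfolding 1 cls_diff[OF gkm_yfun[OF k(1)] gkm_yfun[OF k(2)]]
    using A k by (intro cls_mult gkm_prod gkm_power gkm_x gkm_diff' gkm_yfun) auto
  finally show ?thesis by (simp add: hess_lift_def)
qed

text \<open>The tuples with coefficients in the augmentation ideal form an ideal of
  \<open>G\<close>: a product of a lift with a GKM tuple expands in the lifts again. This ideal
  contains the generators of \<open>T\<close>, hence all of it.\<close>

lemma T_lift_combination:
  assumes "\<alpha> \<in> T"
  shows "\<exists>c. (\<forall>i\<in>hess_indices n m. c i \<in> aug_ideal n) \<and>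
    (\<forall>w\<in>S. \<alpha> w = (\<Sum>i\<in>hess_indices n m. c i * hess_lift n m i w))"
proof -
  let ?I = "hess_indices n m" and ?b = "hess_lift n m"
  define comb where "comb \<alpha> \<longleftrightarrow> (\<exists>c. (\<forall>i\<in>?I. c i \<in> aug_ideal n) \<and> (\<forall>w\<in>S. \<alpha> w = (\<Sum>i\<in>?I. c i * ?b i w)))" for \<alpha>
  define J where "J = {\<alpha> \<in> gkm_carrier n (hfun n m). comb \<alpha>}"
  have mult: "comb (\<lambda>w. p * \<alpha> w)" if p: "p \<in> aug_ideal n" and \<alpha>: "\<alpha> \<in> gkm_carrier n (hfun n m)" for p \<alpha>
  proof -
    obtain c where c: "\<forall>i\<in>?I. c i \<in> polys n" "\<forall>w\<in>S. \<alpha> w = (\<Sum>i\<in>?I. c i * ?b i w)"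
      using gkm_carrier_lift_combination[OF \<alpha>] by blast
    have "\<forall>i\<in>?I. c i * p \<in> aug_ideal n" using c(1) p aug_ideal_mult by blast
    moreover have "\<forall>w\<in>S. p * \<alpha> w = (\<Sum>i\<in>?I. (c i * p) * ?b i w)"
      using c(2) by (simp add: sum_distrib_left mult_ac)
    ultimately show ?thesis unfolding comb_def by (intro exI conjI)
  qed
  have comb_add: "comb (\<lambda>w. \<alpha> w + \<beta> w)" if ab: "comb \<alpha>" "comb \<beta>" for \<alpha> \<beta>
  proof -
    obtain c where c: "\<forall>i\<in>?I. c i \<in> aug_ideal n" "\<forall>w\<in>S. \<alpha> w = (\<Sum>i\<in>?I. c i * ?b i w)"
      using ab(1) unfolding comb_def by (elim exE conjE)
    obtain d where d: "\<forall>i\<in>?I. d i \<in> aug_ideal n" "\<forall>w\<in>S. \<beta> w = (\<Sum>i\<in>?I. d i * ?b i w)"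
      using ab(2) unfolding comb_def by (elim exE conjE)
    from c d show ?thesis unfolding comb_def
      by (intro exI[of _ "\<lambda>i. c i + d i"]) (auto simp: aug_ideal_add distrib_right sum.distrib)
  qed
  have comb_zero: "comb (\<lambda>w. 0)" unfolding comb_def by (auto intro!: exI[of _ "\<lambda>_. 0"] simp: aug_ideal_zero)
  have comb_sum: "comb (\<lambda>w. \<Sum>j\<in>A. f j w)" if "\<And>j. j \<in> A \<Longrightarrow> comb (f j)" for A :: "hess_index set" and f
    using that by (induction A rule: infinite_finite_induct) (auto intro: comb_zero comb_add)
  have comb_cong: "comb \<beta>" if "comb \<alpha>" "\<And>w. w \<in> S \<Longrightarrow> \<alpha> w = \<beta> w" for \<alpha> \<beta>
    using that unfolding comb_def by auto
  have comb_mult: "comb (\<lambda>w. \<alpha> w * \<beta> w)" if \<alpha>: "comb \<alpha>" and \<beta>: "\<beta> \<in> gkm_carrier n (hfun n m)" for \<alpha> \<beta>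
  proof -
    obtain c where c: "\<forall>i\<in>?I. c i \<in> aug_ideal n" "\<forall>w\<in>S. \<alpha> w = (\<Sum>i\<in>?I. c i * ?b i w)"
      using \<alpha> unfolding comb_def by (elim exE conjE)
    note \<beta>r = gkm_carrier_gkm[OF \<beta>]
    have "comb (\<lambda>w. \<Sum>i\<in>?I. c i * restrict (\<lambda>w. ?b i w * \<beta> w) S w)"
    proof (rule comb_sum)
      fix i assume i: "i \<in> ?I"
      from mult[OF bspec[OF c(1) i] gkm_mult'[OF gkm_hess_lift[OF i] \<beta>r, unfolded is_gkm_def]]
      show "comb (\<lambda>w. c i * restrict (\<lambda>w. ?b i w * \<beta> w) S w)" .
    qed
    thus ?thesis by (rule comb_cong) (use c(2) in \<open>simp add: sum_distrib_right mult.assoc\<close>)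
  qed
  have comb_uminus: "comb (\<lambda>w. - \<alpha> w)" if "comb \<alpha>" for \<alpha>
    using comb_mult[OF that gkm_const'[OF polys_closed(5)[OF polys_closed(2)], unfolded is_gkm_def]]
    by (rule comb_cong) simp
  have "ideal J G"
  proof (rule idealI[OF G.ring_axioms])
    show "subgroup J (add_monoid G)"
    proof (rule G.add.subgroupI)
      show "J \<subseteq> carrier G" by (auto simp: J_def gkm_ring_def)
      have "restrict (\<lambda>w. 0) S \<in> J"
        unfolding J_def using gkm_const'[OF polys_closed(1)] comb_cong[OF comb_zero] by (auto simp: is_gkm_def)
      thus "J \<noteq> {}" by blast
      fix \<alpha> \<beta> assume \<alpha>: "\<alpha> \<in> J"
      hence c: "\<alpha> \<in> carrier G" by (simp add: J_def gkm_ring_def)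
      have r: "restrict \<alpha> S = \<alpha>" using \<alpha> by (simp add: J_def gkm_restrict)
      have gk: "gkm \<alpha>" using \<alpha> by (simp add: J_def gkm_carrier_gkm)
      have "restrict (\<lambda>w. - \<alpha> w) S \<oplus>\<^bsub>G\<^esub> \<alpha> = \<zero>\<^bsub>G\<^esub>"
        using gkm_ring_ops(1)[of "\<lambda>w. - \<alpha> w" \<alpha>] r by (simp add: gkm_ring_def)
      hence "\<ominus>\<^bsub>G\<^esub> \<alpha> = restrict (\<lambda>w. - \<alpha> w) S"
        using G.minus_equality c gkm_carrier[OF gkm_uminus'[OF gk]] by blast
      moreover have "comb (restrict (\<lambda>w. - \<alpha> w) S)"
        by (rule comb_cong[OF comb_uminus]) (use \<alpha> in \<open>auto simp: J_def\<close>)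
      ultimately show "\<ominus>\<^bsub>G\<^esub> \<alpha> \<in> J" using gkm_uminus'[OF gk] by (simp add: J_def is_gkm_def)
      assume \<beta>: "\<beta> \<in> J"
      have "\<alpha> \<oplus>\<^bsub>G\<^esub> \<beta> = restrict (\<lambda>w. \<alpha> w + \<beta> w) S" by (simp add: gkm_ring_def)
      moreover have "\<alpha> \<oplus>\<^bsub>G\<^esub> \<beta> \<in> carrier G" using \<alpha> \<beta> by (intro G.a_closed) (auto simp: J_def gkm_ring_def)
      moreover have "comb (restrict (\<lambda>w. \<alpha> w + \<beta> w) S)"
        by (rule comb_cong[OF comb_add]) (use \<alpha> \<beta> in \<open>auto simp: J_def\<close>)
      ultimately show "\<alpha> \<oplus>\<^bsub>G\<^esub> \<beta> \<in> J" by (simp add: J_def) (simp add: gkm_ring_def)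
    qed
    fix \<alpha> \<beta> assume \<alpha>: "\<alpha> \<in> J" and \<beta>: "\<beta> \<in> carrier G"
    have eq: "\<alpha> \<otimes>\<^bsub>G\<^esub> \<beta> = restrict (\<lambda>w. \<alpha> w * \<beta> w) S" by (simp add: gkm_ring_def)
    have c: "\<alpha> \<in> carrier G" using \<alpha> by (simp add: J_def gkm_ring_def)
    have "\<alpha> \<otimes>\<^bsub>G\<^esub> \<beta> \<in> carrier G" using c \<beta> by (rule G.m_closed)
    moreover have "comb (\<alpha> \<otimes>\<^bsub>G\<^esub> \<beta>)" unfolding eq
      by (rule comb_cong[OF comb_mult[of \<alpha> \<beta>]]) (use \<alpha> \<beta> in \<open>auto simp: J_def gkm_ring_def\<close>)
    ultimately show "\<alpha> \<otimes>\<^bsub>G\<^esub> \<beta> \<in> J" unfolding J_def gkm_ring_def by simp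
    thus "\<beta> \<otimes>\<^bsub>G\<^esub> \<alpha> \<in> J" using G.m_comm[OF \<beta> c] by simp
  qed
  moreover have "(\<lambda>i. \<lambda>w\<in>S. tvar i) ` {1..n} \<subseteq> J"
  proof
    fix \<tau> assume "\<tau> \<in> (\<lambda>i. \<lambda>w\<in>S. tvar i) ` {1..n}"
    then obtain i where i: "i \<in> {1..n}" "\<tau> = (\<lambda>w\<in>S. tvar i)" by blast
    have "comb \<tau>"
      by (rule comb_cong[OF mult[OF aug_ideal_tvar[OF i(1)] gkm_const'[OF polys_closed(2), unfolded is_gkm_def]]]) (simp add: i(2))
    thus "\<tau> \<in> J" using i gkm_const'[OF tvar_in_polys[OF i(1)]] by (simp add: J_def is_gkm_def)
  qed
  ultimately have "T \<subseteq> J" unfolding t_ideal_def by (rule G.genideal_minimal)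
  thus ?thesis using assms unfolding J_def comb_def by blast
qed

text \<open>A vanishing combination lies in \<open>T\<close> and so has a second expansion with
  coefficients in the augmentation ideal. Freeness equates the two, and 0 is the only constant in
  that ideal.\<close>

lemma cls_lift_independent:
  assumes "cls (\<lambda>w. \<Sum>i\<in>hess_indices n m. tconst (c i) * hess_lift n m i w) = \<zero>\<^bsub>H\<^esub>"
    and i: "i \<in> hess_indices n m"
  shows "c i = 0"
proof -
  have gk: "gkm (\<lambda>w. \<Sum>i\<in>hess_indices n m. tconst (c i) * hess_lift n m i w)"
    by (intro gkm_sum gkm_mult' gkm_const' polys_closed gkm_hess_lift)
  obtain d where d: "\<forall>i\<in>hess_indices n m. d i \<in> aug_ideal n"
    "\<forall>w\<in>S. restrict (\<lambda>w. \<Sum>i\<in>hess_indices n m. tconst (c i) * hess_lift n m i w) S w =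
      (\<Sum>i\<in>hess_indices n m. d i * hess_lift n m i w)"
    using T_lift_combination assms(1) cls_eq_zero_iff[OF gk] unfolding in_t_ideal_def by blast
  have "tconst (c i) - d i = 0"
  proof (rule hess_lift_independent[OF _ i])
    fix w assume "w \<in> S"
    thus "(\<Sum>i\<in>hess_indices n m. (tconst (c i) - d i) * hess_lift n m i w) = 0"
      using d(2) by (simp add: left_diff_distrib sum_subtractf)
  qed
  hence "tconst (c i) \<in> aug_ideal n" using d(1) i by simp
  thus ?thesis by (rule tconst_in_aug_idealD)
qed

text \<open>Modulo \<open>T\<close> each polynomial coefficient may be replaced by a constant
  congruent to it modulo the augmentation ideal.\<close>

lemma cls_lift_spanning:
  assumes "X \<in> carrier H"
  shows "\<exists>c. X = cls (\<lambda>w. \<Sum>i\<in>hess_indices n m. tconst (c i) * hess_lift n m i w)"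
proof -
  let ?I = "hess_indices n m" and ?b = "hess_lift n m"
  obtain f where f: "gkm f" "X = cls f" using carrier_cls[OF assms] by blast
  obtain p where p: "\<forall>i\<in>?I. p i \<in> polys n" "\<forall>w\<in>S. restrict f S w = (\<Sum>i\<in>?I. p i * ?b i w)"
    using gkm_carrier_lift_combination[OF f(1)[unfolded is_gkm_def]] by blast
  have "\<forall>i\<in>?I. \<exists>c. p i - tconst c \<in> aug_ideal n" using p(1) polys_minus_const_in_aug_ideal by blast
  then obtain c where c: "\<forall>i\<in>?I. p i - tconst (c i) \<in> aug_ideal n" by metis
  have "inT (\<lambda>w. \<Sum>i\<in>?I. (p i - tconst (c i)) * ?b i w)"
    using c by (intro T_sum aug_ideal_in_T gkm_hess_lift) auto
  moreover have "restrict (\<lambda>w. \<Sum>i\<in>?I. (p i - tconst (c i)) * ?b i w) S =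
    restrict (\<lambda>w. f w - (\<Sum>i\<in>?I. tconst (c i) * ?b i w)) S"
    using p(2) by (auto simp: fun_eq_iff left_diff_distrib sum_subtractf)
  ultimately have "inT (\<lambda>w. f w - (\<Sum>i\<in>?I. tconst (c i) * ?b i w))" by (simp only: in_t_ideal_def)
  hence "cls f = cls (\<lambda>w. \<Sum>i\<in>?I. tconst (c i) * ?b i w)"
    by (intro cls_eqI f gkm_sum gkm_mult' gkm_const' polys_closed gkm_hess_lift)
  thus ?thesis using f(2) by blast
qed

lemma hess_lift_basis:
  defines "b \<equiv> \<lambda>i. cls (hess_lift n m i)"
  shows "inj_on b (hess_indices n m) \<and> vectorspace.basis class_ring H (b ` hess_indices n m)"
proof -
  let ?I = "hess_indices n m"
  note fin = finite_hess_indices[of n m]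
  have comb: "(\<Oplus>\<^bsub>H\<^esub>i\<in>?I. c i \<odot>\<^bsub>H\<^esub> b i) = cls (\<lambda>w. \<Sum>i\<in>?I. tconst (c i) * hess_lift n m i w)" for c
    unfolding b_def by (intro cls_lincomb fin gkm_hess_lift)
  have inj: "inj_on b ?I"
  proof (rule inj_onI, rule ccontr)
    fix i j assume i: "i \<in> ?I" and j: "j \<in> ?I" and eq: "b i = b j" and ne: "i \<noteq> j"
    \<comment> \<open>Two indices with the same class would give a relation with coefficients 1 and
      -1.\<close>
    define c :: "hess_index \<Rightarrow> complex" where "c l = (if l = i then 1 else if l = j then - 1 else 0)" for l
    have sum: "(\<Sum>l\<in>?I. tconst (c l) * f l) = f i - f j" for f :: "hess_index \<Rightarrow> cpoly"
    proof -
      have "tconst (- 1) = - 1" using tconst_simps(3)[of "-1" 1] by (simp add: tconst_simps eq_neg_iff_add_eq_0)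
      hence "(\<Sum>l\<in>?I. tconst (c l) * f l) = (\<Sum>l\<in>?I. (if l = i then f l else 0) - (if l = j then f l else 0))"
        using ne by (intro sum.cong) (auto simp: c_def tconst_simps)
      thus ?thesis using i j fin by (simp add: sum_subtractf)
    qed
    have "b i \<ominus>\<^bsub>H\<^esub> b j = cls (\<lambda>w. \<Sum>l\<in>?I. tconst (c l) * hess_lift n m l w)"
      unfolding b_def sum by (rule cls_diff[OF gkm_hess_lift[OF i] gkm_hess_lift[OF j]])
    moreover have "b i \<ominus>\<^bsub>H\<^esub> b j = \<zero>\<^bsub>H\<^esub>"
      using eq cls_carrier[OF gkm_hess_lift[OF j]] by (simp add: b_def a_minus_def H.r_neg)
    ultimately have "c i = 0" using cls_lift_independent[OF _ i] by simp
    thus False by (simp add: c_def)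
  qed
  have sub: "b ` ?I \<subseteq> carrier H" unfolding b_def using cls_carrier[OF gkm_hess_lift] by blast
  have sm: "c \<odot>\<^bsub>H\<^esub> v \<in> carrier H" if "v \<in> b ` ?I" for c v
    using that sub by (intro VS.smult_closed) auto
  have lc: "VS.lincomb a (b ` ?I) = cls (\<lambda>w. \<Sum>i\<in>?I. tconst (a (b i)) * hess_lift n m i w)" for a
    unfolding VS.lincomb_def comb[symmetric, of "\<lambda>i. a (b i)"]
    using sm by (intro H.finsum_reindex inj) auto
  have "VS.lin_indpt (b ` ?I)"
  proof (rule VS.finite_lin_indpt2[OF _ sub])
    fix a assume "VS.lincomb a (b ` ?I) = \<zero>\<^bsub>H\<^esub>"
    hence "a (b i) = 0" if "i \<in> ?I" for i
      unfolding lc using that by (rule cls_lift_independent)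
    thus "\<forall>v\<in>b ` ?I. a v = \<zero>\<^bsub>class_ring\<^esub>" by (simp add: class_ring_simps)
  qed (use fin in simp)
  moreover have "VS.gen_set (b ` ?I)"
  proof -
    have "X \<in> VS.span (b ` ?I)" if X: "X \<in> carrier H" for X
    proof -
      obtain c where c: "X = cls (\<lambda>w. \<Sum>i\<in>?I. tconst (c i) * hess_lift n m i w)"
        using cls_lift_spanning[OF X] by blast
      \<comment> \<open>Coefficients on indices become coefficients on vectors, which injectivity of
        \<open>b\<close> makes consistent.\<close>
      define a where "a v = c (inv_into ?I b v)" for v
      have "a (b i) = c i" if "i \<in> ?I" for i using inv_into_f_f[OF inj that] by (simp add: a_def)
      hence "VS.lincomb a (b ` ?I) = X" unfolding lc c by (intro arg_cong[where f = cls] ext sum.cong) simp_all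
      thus ?thesis using VS.finite_span[OF _ sub] fin by (auto simp: Pi_def)
    qed
    thus ?thesis using VS.span_is_subset2[OF sub] by blast
  qed
  ultimately show ?thesis using inj sub unfolding VS.basis_def by blast
qed

lemma elem_eq:
  assumes "i \<in> hess_indices n m"
  shows "case_sum (elem_i n m) (elem_ii n m) i = cls (hess_lift n m i)"
  using assms elem_i_eq elem_ii_eq by (auto simp: hess_indices_def)

lemma elem_basis:
  "inj_on (case_sum (elem_i n m) (elem_ii n m)) (exps_i n m <+> exps_ii n m \<times> {1..n - 1})
    \<and> vectorspace.basis class_ring (hess_cohomology n (hfun n m))
        (elem_i n m ` exps_i n m \<union> elem_ii n m ` (exps_ii n m \<times> {1..n - 1}))"
proof -
  let ?f = "case_sum (elem_i n m) (elem_ii n m)"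
  have "?f ` hess_indices n m = elem_i n m ` exps_i n m \<union> elem_ii n m ` (exps_ii n m \<times> {1..n - 1})"
    unfolding hess_indices_def Plus_def image_Un image_image by simp
  moreover have "?f ` hess_indices n m = (\<lambda>i. cls (hess_lift n m i)) ` hess_indices n m"
    using elem_eq by (rule image_cong[OF refl])
  moreover have "inj_on ?f (hess_indices n m) \<longleftrightarrow> inj_on (\<lambda>i. cls (hess_lift n m i)) (hess_indices n m)"
    using elem_eq by (rule inj_on_cong)
  ultimately show ?thesis using hess_lift_basis unfolding hess_indices_def by simp
qed

end

theorem theoremE:
  fixes n m :: nat
  assumes "2 \<le> n" and "1 \<le> m" and "m \<le> n"
  shows "inj_on (case_sum (elem_i n m) (elem_ii n m)) (exps_i n m <+> exps_ii n m \<times> {1..n - 1})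
    \<and> vectorspace.basis class_ring (hess_cohomology n (hfun n m))
        (elem_i n m ` exps_i n m \<union> elem_ii n m ` (exps_ii n m \<times> {1..n - 1}))"
  by (rule hess_params.elem_basis) (unfold_locales; fact assms)

end
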